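(* Let $p$ be a prime, let $G$ be a finitely presented group and let $Q=\langle X\mid R\rangle$ be a finite presentation for $G$ with $p$-deficiency $def_p(Q)=1$. Let $R=\{r_1,\ldots,r_d\}$ and let $r_i=u_i^{m_i}=w_i^{p^{a_i}}$ for all $1\le i\le d$, where $u_i$ and $w_i$ are the minimal root and the minimal $p$-root of $r_i$, respectively. Denote by $k_i$ the order of $\psi(u_i)$ in $G/R_G$ and by $l_i$ the order of $\psi(w_i)$ in $G/R_G$, for all $1\le i\le d$. Then: 1. If $l_i<p^{a_i}$ for some $i$, then $G$ is $p$-large and $RG(G)>0$. 2. Suppose $l_i=p^{a_i}$ for all $i$. If $l_i<k_i$ for some $i$, then $G$ has a finite index subgroup which is $p$-large. Moreover, $G$ is large and $RG(G)>0$.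
   Context: $X$ freely generates the non-abelian free group $F_n$ of finite rank $n$. Relators are understood to be nontrivial elements of $F_n$. For $1\neq r\in F_n$, the minimal root of $r$ is the element $u\in F_n$ with $u^m=r$, where $m$ is the largest integer which can appear as an exponent $l$ in an expression $v^l=r$ with $v\in F_n$. Let $\nu_p(r)$ be the largest integer $a\ge 0$ such that $r=w^{p^a}$ for some $w\in F_n$; the minimal $p$-root of $r$ is the element $w\in F_n$ with $r=w^{p^{\nu_p(r)}}$ (so $a_i=\nu_p(r_i)$). The $p$-deficiency of $Q$ is $$def_p(Q)=n-\sum_{r\in R}p^{-\nu_p(r)}.$$ $R_G$ denotes the finite residual of $G$, i.e. the intersection of all finite index subgroups of $G$. $\psi:F_n\to G/R_G$ is the composition of the canonical map $F_n\to G$ induced by the presentation $Q$ with the canonical map $G\to G/R_G$. A group is large if it has a finite index normal subgroup with a non-abelian free quotient. A group $G$ is $p$-large if it has a normal subgroup whose index in $G$ is a power of $p$ and which has a non-abelian free quotient. The rank gradient of a finitely generated group $G$ is $$RG(G)=\inf_{H}\frac{d(H)-1}{|G:H|},$$ where $H$ ranges over all finite index subgroups of $G$ and $d(H)$ is the minimal number of generators of $H$. *)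

theory Defs
  imports Complex_Main "HOL-Algebra.Generated_Groups" "HOL-Algebra.Multiplicative_Group" "HOL-Computational_Algebra.Primes"
begin

section \<open>Free groups\<close>

text \<open>
  Group words over \<open>S\<close> are lists of letters \<open>(x, b)\<close>, where \<open>(x, True)\<close> stands for
  \<open>x\<close> and \<open>(x, False)\<close> for the formal inverse of \<open>x\<close>.
\<close>

definition reduced_word :: "('a \<times> bool) list \<Rightarrow> bool" where
  "reduced_word w \<longleftrightarrow> successively (\<lambda>s t. \<not> (fst s = fst t \<and> snd s \<noteq> snd t)) w"

definition word_value :: "('a, 'm) monoid_scheme \<Rightarrow> ('a \<times> bool) list \<Rightarrow> 'a" where
  "word_value F w =
     foldr (\<lambda>(x, b) y. (if b then x else inv\<^bsub>F\<^esub> x) \<otimes>\<^bsub>F\<^esub> y) w \<one>\<^bsub>F\<^esub>"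

text \<open>
  Every element is the value of exactly one reduced word over the basis, i.e. evaluation
  identifies the group with the reduced-word model of the free group on \<open>S\<close>.
\<close>

definition freely_generates :: "('a, 'm) monoid_scheme \<Rightarrow> 'a set \<Rightarrow> bool" where
  "freely_generates F S \<longleftrightarrow>
     group F \<and> S \<subseteq> carrier F \<and>
     bij_betw (word_value F) {w. reduced_word w \<and> fst ` set w \<subseteq> S} (carrier F)"

definition nonabelian_free :: "('a, 'm) monoid_scheme \<Rightarrow> bool" where
  "nonabelian_free F \<longleftrightarrow> (\<exists>S. freely_generates F S) \<and> \<not> comm_group F"


section \<open>Presentations, roots and the p-deficiency\<close>

definition normal_closure :: "('a, 'm) monoid_scheme \<Rightarrow> 'a set \<Rightarrow> 'a set" where
  "normal_closure F R = \<Inter> {N. N \<lhd> F \<and> R \<subseteq> N}"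

text \<open>
  \<open>\<pi>\<close> is the canonical epimorphism that exhibits \<open>G\<close> as the group presented by
  \<open>\<langle>S | R\<rangle>\<close>, where \<open>S\<close> is a basis of the free group \<open>F\<close>. Relators are nontrivial.
\<close>

definition presentation ::
    "('a, 'm) monoid_scheme \<Rightarrow> 'a set \<Rightarrow> 'a set \<Rightarrow> ('b, 'n) monoid_scheme \<Rightarrow> ('a \<Rightarrow> 'b) \<Rightarrow> bool" where
  "presentation F S R G \<pi> \<longleftrightarrow>
     freely_generates F S \<and> R \<subseteq> carrier F - {\<one>\<^bsub>F\<^esub>} \<and>
     \<pi> \<in> hom F G \<and> \<pi> ` carrier F = carrier G \<and> kernel F G \<pi> = normal_closure F R"

text \<open>
  In a free group the maxima below exist for every nontrivial \<open>r\<close>; at \<open>r = \<one>\<close>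
  the values are unspecified.
\<close>

definition root_exponent :: "('a, 'm) monoid_scheme \<Rightarrow> 'a \<Rightarrow> nat" where
  "root_exponent F r = (GREATEST l. \<exists>v\<in>carrier F. v [^]\<^bsub>F\<^esub> l = r)"

definition minimal_root :: "('a, 'm) monoid_scheme \<Rightarrow> 'a \<Rightarrow> 'a \<Rightarrow> bool" where
  "minimal_root F r u \<longleftrightarrow> u \<in> carrier F \<and> u [^]\<^bsub>F\<^esub> root_exponent F r = r"

definition p_exponent :: "('a, 'm) monoid_scheme \<Rightarrow> nat \<Rightarrow> 'a \<Rightarrow> nat" where
  "p_exponent F p r = (GREATEST a. \<exists>w\<in>carrier F. r = w [^]\<^bsub>F\<^esub> (p ^ a))"

definition minimal_p_root :: "('a, 'm) monoid_scheme \<Rightarrow> nat \<Rightarrow> 'a \<Rightarrow> 'a \<Rightarrow> bool" where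
  "minimal_p_root F p r w \<longleftrightarrow> w \<in> carrier F \<and> r = w [^]\<^bsub>F\<^esub> (p ^ p_exponent F p r)"

definition p_deficiency :: "('a, 'm) monoid_scheme \<Rightarrow> 'a set \<Rightarrow> 'a set \<Rightarrow> nat \<Rightarrow> real" where
  "p_deficiency F S R p = real (card S) - (\<Sum>r\<in>R. 1 / real p ^ p_exponent F p r)"


section \<open>Finite residual, largeness and rank gradient\<close>

definition finite_index_subgroup :: "'a set \<Rightarrow> ('a, 'm) monoid_scheme \<Rightarrow> bool" where
  "finite_index_subgroup H G \<longleftrightarrow> subgroup H G \<and> finite (rcosets\<^bsub>G\<^esub> H)"

definition finite_residual :: "('a, 'm) monoid_scheme \<Rightarrow> 'a set" where
  "finite_residual G = \<Inter> {H. finite_index_subgroup H G}"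

definition has_nonabelian_free_quotient :: "('a, 'm) monoid_scheme \<Rightarrow> bool" where
  "has_nonabelian_free_quotient H \<longleftrightarrow> (\<exists>N. N \<lhd> H \<and> nonabelian_free (H Mod N))"

definition large :: "('a, 'm) monoid_scheme \<Rightarrow> bool" where
  "large G \<longleftrightarrow>
     (\<exists>H. H \<lhd> G \<and> finite (rcosets\<^bsub>G\<^esub> H) \<and> has_nonabelian_free_quotient (G\<lparr>carrier := H\<rparr>))"

definition p_large :: "nat \<Rightarrow> ('a, 'm) monoid_scheme \<Rightarrow> bool" where
  "p_large p G \<longleftrightarrow>
     (\<exists>H. H \<lhd> G \<and> finite (rcosets\<^bsub>G\<^esub> H) \<and> (\<exists>k. card (rcosets\<^bsub>G\<^esub> H) = p ^ k) \<and>
          has_nonabelian_free_quotient (G\<lparr>carrier := H\<rparr>))"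

definition min_generators :: "('a, 'm) monoid_scheme \<Rightarrow> 'a set \<Rightarrow> nat" where
  "min_generators G H = (LEAST n. \<exists>T\<subseteq>H. finite T \<and> card T = n \<and> generate G T = H)"

text \<open>
  Only meant for finitely generated \<open>G\<close>: then each finite index subgroup is finitely
  generated, and the terms of the infimum are bounded below by \<open>-1\<close>.
\<close>

definition rank_gradient :: "('a, 'm) monoid_scheme \<Rightarrow> real" where
  "rank_gradient G =
     Inf {(real (min_generators G H) - 1) / real (card (rcosets\<^bsub>G\<^esub> H)) | H.
            finite_index_subgroup H G}"

end

theory Submission
  imports Defs "HOL-Number_Theory.Cong" "HOL-Algebra.Elementary_Groups"
begin

text \<open>
  For a subgroup \<open>L\<close> of index \<open>q\<close>, a homomorphism from \<open>L\<close> to the integers modulo \<open>p\<close> is a labelling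
  of the \<open>q * card S\<close> edges of the Schreier graph of \<open>L\<close> that sums to zero along every relator loop, up to
  \<open>q - 1\<close> dimensions of coboundaries. A relator \<open>w^(p^a)\<close> imposes one condition per \<open>w\<close>-orbit of full length
  \<open>p^a\<close> on the cosets and none on the shorter orbits. For deficiency one this count is exactly critical,
  and an unexpectedly small order of \<open>w\<close>, or large order of \<open>u\<close>, modulo the finite residual makes the
  number of characters grow linearly in the index. With Schreier's bound this gives positive rank gradient.

  Linear growth implies largeness by an argument of Lackenby. Descending the tower \<open>L' = L^p [L, L]\<close>,
  the cocycles \<open>g * d\<phi>\<close>, with \<open>d\<phi>\<close> from \<open>L\<close> and \<open>g\<close> linear on the deck group \<open>L / L'\<close>, vanish wherever \<open>g\<close>
  does, so the relative size of supports tends to zero. Once a cocycle \<open>\<phi>\<close> has small support there are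
  cocycles \<open>\<psi>\<close> that no relator loop links with it, and \<open>\<phi>\<close> and \<open>\<psi>\<close> together map \<open>L\<close> onto a free product
  of finite \<open>p\<close>-groups, whose free normal subgroup of \<open>p\<close>-power index gives the free quotient.
\<close>

section \<open>Free groups\<close>

text \<open>One device serves throughout: a labelling of the Cayley graph of \<open>G\<close> whose
  product along every relator loop is trivial integrates to a function on \<open>G\<close>, and if
  the labels are invariant under a subgroup, this function is a homomorphism there. Labels in the
  integers modulo \<open>p\<close> yield characters; labels in a free group yield the free quotient.
  The free product of the overview enters only through such a labelling, invariant under the common
  kernel of \<open>\<phi>\<close> and two cocycles \<open>\<psi>\<close>.

  A single cocycle may not suffice for the descent. With \<open>k\<close> independent ones on a
  subgroup of index \<open>q\<close> that has \<open>u\<close> independent characters, there are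
  \<open>(u - k) * k\<close> products to combine, against \<open>q * card R\<close> relator
  conditions. Linear growth gives \<open>q \<le> c * u\<close>, so the fixed value
  \<open>k = c * (card R + 1)\<close> wins at every sufficiently deep level, while the number of
  independent characters stays proportional to the index. Dimensions are compared through powers of
  \<open>p\<close>, with integer-valued functions read modulo \<open>p\<close> as vectors.\<close>

fun cancel_cons :: "'a \<times> bool \<Rightarrow> ('a \<times> bool) list \<Rightarrow> ('a \<times> bool) list" where
  "cancel_cons l [] = [l]"
| "cancel_cons l (m # w) = (if fst l = fst m \<and> snd l \<noteq> snd m then w else l # m # w)"

text \<open>Freeness is stated for reduced words, whereas products and relator spellings are
  arbitrary words; \<open>reduce\<close> is the normal form that connects the two.\<close>

definition reduce :: "('a \<times> bool) list \<Rightarrow> ('a \<times> bool) list" where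
  "reduce w = foldr cancel_cons w []"

lemma reduce_Nil [simp]: "reduce [] = []"
  and reduce_Cons [simp]: "reduce (l # w) = cancel_cons l (reduce w)"
  by (simp_all add: reduce_def)

lemma reduced_cancel_cons: "reduced_word w \<Longrightarrow> reduced_word (cancel_cons l w)"
  by (cases w) (auto simp: reduced_word_def successively_Cons)

lemma reduced_reduce: "reduced_word (reduce w)"
  by (induction w) (auto simp: reduced_cancel_cons, simp add: reduced_word_def)

lemma set_cancel_cons: "set (cancel_cons l w) \<subseteq> insert l (set w)"
  by (cases w) auto

lemma set_reduce: "set (reduce w) \<subseteq> set w"
  by (induction w) (use set_cancel_cons in fastforce)+

lemma word_value_Nil [simp]: "word_value F [] = \<one>\<^bsub>F\<^esub>"
  and word_value_Cons [simp]: "word_value F (l # w) =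
    (if snd l then fst l else inv\<^bsub>F\<^esub> fst l) \<otimes>\<^bsub>F\<^esub> word_value F w"
  by (auto simp: word_value_def split_beta)

context group begin

lemma word_value_closed: "fst ` set w \<subseteq> carrier G \<Longrightarrow> word_value G w \<in> carrier G"
  by (induction w) auto

lemma word_value_append:
  "fst ` set v \<subseteq> carrier G \<Longrightarrow> fst ` set w \<subseteq> carrier G \<Longrightarrow>
     word_value G (v @ w) = word_value G v \<otimes> word_value G w"
  by (induction v) (auto simp: word_value_closed m_assoc)

lemma word_value_concat_replicate:
  "fst ` set w \<subseteq> carrier G \<Longrightarrow> word_value G (concat (replicate n w)) = word_value G w [^] n"
proof (induction n)
  case (Suc n)
  have "fst ` set (concat (replicate n w)) \<subseteq> carrier G"
    using Suc.prems by (auto simp: image_subset_iff)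
  then show ?case using Suc nat_pow_Suc2[OF word_value_closed[OF Suc.prems], of n] by (simp add: word_value_append)
qed simp

lemma word_value_cancel_cons:
  assumes "fst l \<in> carrier G" "fst ` set w \<subseteq> carrier G"
  shows "word_value G (cancel_cons l w) = word_value G (l # w)"
proof (cases w)
  case (Cons m v)
  then show ?thesis using assms word_value_closed[of v] by (auto simp flip: m_assoc)
qed simp

lemma word_value_reduce:
  "fst ` set w \<subseteq> carrier G \<Longrightarrow> word_value G (reduce w) = word_value G w"
proof (induction w)
  case (Cons l w)
  then have "fst ` set (reduce w) \<subseteq> carrier G" using set_reduce[of w] by auto
  then show ?case using Cons by (simp add: word_value_cancel_cons)
qed simp

end

text \<open>The letters in \<open>A\<close> act on \<open>X\<close>, the first letter of a word
  acting first. Opposite letters undo each other, so deleting a cancelling pair does not change the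
  action.\<close>

lemma fold_cancel_cons:
  assumes "\<And>l x. l \<in> A \<Longrightarrow> x \<in> X \<Longrightarrow> st l x \<in> X"
    and "\<And>s b x. (s, b) \<in> A \<Longrightarrow> x \<in> X \<Longrightarrow> st (s, \<not> b) (st (s, b) x) = x"
    and "l \<in> A" "x \<in> X"
  shows "fold st (cancel_cons l w) x = fold st w (st l x)"
proof (cases w)
  case (Cons m v)
  show ?thesis
  proof (cases "fst l = fst m \<and> snd l \<noteq> snd m")
    case True
    then have "m = (fst l, \<not> snd l)" by (cases m) auto
    then have "st m (st l x) = x" using assms(2)[of "fst l" "snd l" x] assms(3,4) by simp
    then show ?thesis using Cons True by simp
  next
    case False
    then have "cancel_cons l w = l # m # v" by (auto simp: Cons)
    then show ?thesis by (simp add: Cons)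
  qed
qed simp

lemma fold_reduce:
  assumes "\<And>l x. l \<in> A \<Longrightarrow> x \<in> X \<Longrightarrow> st l x \<in> X"
    and "\<And>s b x. (s, b) \<in> A \<Longrightarrow> x \<in> X \<Longrightarrow> st (s, \<not> b) (st (s, b) x) = x"
    and "set w \<subseteq> A" "x \<in> X"
  shows "fold st (reduce w) x = fold st w x"
  using assms(3,4)
proof (induction w arbitrary: x)
  case (Cons l w)
  then have "fold st (reduce (l # w)) x = fold st (reduce w) (st l x)"
    using fold_cancel_cons[of A X st l x "reduce w", OF assms(1,2)] by auto
  then show ?case using Cons assms(1) by auto
qed simp

lemma freely_generates_group: "freely_generates F S \<Longrightarrow> group F"
  and freely_generates_subset: "freely_generates F S \<Longrightarrow> S \<subseteq> carrier F"
  by (simp_all add: freely_generates_def)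

lemma free_word_ex:
  assumes "freely_generates F S" "x \<in> carrier F"
  shows "\<exists>w. fst ` set w \<subseteq> S \<and> word_value F w = x"
proof -
  have "x \<in> word_value F ` {w. reduced_word w \<and> fst ` set w \<subseteq> S}"
    using assms by (simp add: freely_generates_def bij_betw_def)
  then show ?thesis by (elim imageE) auto
qed

text \<open>The universal property of a free group in the form of an action: words with equal value
  have the same reduced form, and reduction preserves the action. Hence maps attached to the
  letters, mutually inverse for opposite letters, define an action of the whole group.\<close>

lemma free_fold_eq:
  assumes F: "freely_generates F S"
    and st: "\<And>l x. l \<in> S \<times> UNIV \<Longrightarrow> x \<in> X \<Longrightarrow> st l x \<in> X"
      "\<And>s b x. (s, b) \<in> S \<times> UNIV \<Longrightarrow> x \<in> X \<Longrightarrow> st (s, \<not> b) (st (s, b) x) = x"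
    and w: "fst ` set v \<subseteq> S" "fst ` set w \<subseteq> S" "word_value F v = word_value F w" "x \<in> X"
  shows "fold st v x = fold st w x"
proof -
  interpret group F using F by (rule freely_generates_group)
  have SF: "S \<subseteq> carrier F" using F by (rule freely_generates_subset)
  have "inj_on (word_value F) {w. reduced_word w \<and> fst ` set w \<subseteq> S}"
    using F by (simp add: freely_generates_def bij_betw_def)
  moreover have "word_value F (reduce v) = word_value F (reduce w)"
    using w SF by (subst (1 2) word_value_reduce) auto
  moreover have "fst ` set (reduce v) \<subseteq> S" "fst ` set (reduce w) \<subseteq> S"
    using w(1,2) image_mono[OF set_reduce[of v], of fst] image_mono[OF set_reduce[of w], of fst]
    by simp_all
  ultimately have "reduce v = reduce w"
    by (auto elim!: inj_onD simp: reduced_reduce)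
  moreover have "fold st (reduce v) x = fold st v x" "fold st (reduce w) x = fold st w x"
    using w by (auto intro!: fold_reduce[of "S \<times> UNIV" X] st simp: image_subset_iff)
  ultimately show ?thesis by simp
qed

lemma (in group) normal_closure_subset:
  assumes "N \<lhd> G" "R \<subseteq> N" shows "normal_closure G R \<subseteq> N"
  using assms by (auto simp: normal_closure_def)


section \<open>Maps out of a presented group defined along the Cayley graph\<close>

text \<open>\<open>\<rho>\<close> fixes a spelling of each relator, not necessarily reduced. It is a
  parameter because a relator \<open>v^n\<close> is to be spelled as \<open>n\<close> copies of a
  word for \<open>v\<close>; whether \<open>v\<close> is the minimal root or the minimal
  \<open>p\<close>-root depends on the case treated.\<close>

locale presented_group = group G for G :: "('g, 'n) monoid_scheme" (structure) +
  fixes F :: "('a, 'm) monoid_scheme" and S R :: "'a set" and \<pi> :: "'a \<Rightarrow> 'g"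
    and \<rho> :: "'a \<Rightarrow> ('a \<times> bool) list"
  assumes pres: "presentation F S R G \<pi>" and finite_S: "finite S" and finite_R: "finite R"
    and rel_over: "r \<in> R \<Longrightarrow> fst ` set (\<rho> r) \<subseteq> S"
    and rel_value: "r \<in> R \<Longrightarrow> word_value F (\<rho> r) = r"
begin

primrec walk_end :: "'g \<Rightarrow> ('a \<times> bool) list \<Rightarrow> 'g" where
  "walk_end g [] = g"
| "walk_end g (l # w) = walk_end (g \<otimes> (if snd l then \<pi> (fst l) else inv (\<pi> (fst l)))) w"

text \<open>Edges of the Cayley graph run from \<open>g\<close> to
  \<open>g \<otimes> \<pi> s\<close> and carry their label at the initial vertex. An inverse letter
  runs an edge backwards, so the label is read at the vertex that is reached.\<close>

primrec walk :: "('e, 'k) monoid_scheme \<Rightarrow> ('g \<Rightarrow> 'a \<Rightarrow> 'e) \<Rightarrow> 'g \<Rightarrow> ('a \<times> bool) list \<Rightarrow> 'e" where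
  "walk E lab g [] = \<one>\<^bsub>E\<^esub>"
| "walk E lab g (l # w) =
    (if snd l then lab g (fst l) \<otimes>\<^bsub>E\<^esub> walk E lab (g \<otimes> \<pi> (fst l)) w
     else inv\<^bsub>E\<^esub> (lab (g \<otimes> inv (\<pi> (fst l))) (fst l)) \<otimes>\<^bsub>E\<^esub> walk E lab (g \<otimes> inv (\<pi> (fst l))) w)"

lemma free_F: "freely_generates F S" and \<pi>_hom: "\<pi> \<in> hom F G"
  and \<pi>_surj: "\<pi> ` carrier F = carrier G" and \<pi>_kernel: "kernel F G \<pi> = normal_closure F R"
  and R_carrier: "R \<subseteq> carrier F"
  using pres by (auto simp: presentation_def)

sublocale F: group F using free_F by (rule freely_generates_group)

sublocale \<pi>: group_hom F G \<pi> by unfold_locales (rule \<pi>_hom)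

lemma S_carrier: "S \<subseteq> carrier F" using free_F by (rule freely_generates_subset)

lemma S_closed [simp]: "s \<in> S \<Longrightarrow> s \<in> carrier F" using S_carrier by auto

lemma \<pi>_closed [simp]: "x \<in> carrier F \<Longrightarrow> \<pi> x \<in> carrier G" by simp

lemma over_carrier: "fst ` set w \<subseteq> S \<Longrightarrow> fst ` set w \<subseteq> carrier F" using S_carrier by auto

lemma walk_end_eq:
  "g \<in> carrier G \<Longrightarrow> fst ` set w \<subseteq> S \<Longrightarrow> walk_end g w = g \<otimes> \<pi> (word_value F w)"
proof (induction w arbitrary: g)
  case (Cons l w)
  then have "word_value F w \<in> carrier F" using F.word_value_closed[OF over_carrier] by simp
  with Cons show ?case by (auto simp: m_assoc)
qed simp

lemma walk_end_closed: "g \<in> carrier G \<Longrightarrow> fst ` set w \<subseteq> S \<Longrightarrow> walk_end g w \<in> carrier G"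
  by (simp add: walk_end_eq F.word_value_closed over_carrier)

lemma \<pi>_relator: "r \<in> R \<Longrightarrow> \<pi> r = \<one>"
proof -
  assume "r \<in> R"
  then have "r \<in> normal_closure F R" by (auto simp: normal_closure_def)
  then show ?thesis using \<pi>_kernel by (auto simp: kernel_def)
qed

lemma walk_end_relator: "r \<in> R \<Longrightarrow> g \<in> carrier G \<Longrightarrow> walk_end g (\<rho> r) = g"
  by (simp add: walk_end_eq rel_over rel_value \<pi>_relator)

lemma generators_induct [consumes 1, case_names one gen inv]:
  assumes "g \<in> carrier G" and "P \<one>"
    and "\<And>g s. g \<in> carrier G \<Longrightarrow> s \<in> S \<Longrightarrow> P g \<Longrightarrow> P (g \<otimes> \<pi> s)"
    and "\<And>g s. g \<in> carrier G \<Longrightarrow> s \<in> S \<Longrightarrow> P g \<Longrightarrow> P (g \<otimes> inv \<pi> s)"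
  shows "P g"
proof -
  obtain x where x: "x \<in> carrier F" "\<pi> x = g" using assms(1) \<pi>_surj by (metis imageE)
  obtain w where w: "fst ` set w \<subseteq> S" "word_value F w = x" using free_word_ex[OF free_F x(1)] by auto
  have "P h \<Longrightarrow> P (walk_end h w)" if "h \<in> carrier G" for h
    using w(1) that
  proof (induction w arbitrary: h)
    case (Cons l w)
    then show ?case using assms(3)[of h "fst l"] assms(4)[of h "fst l"] by simp
  qed simp
  from this[of \<one>] show ?thesis using walk_end_eq[of \<one> w] w x assms(1,2) by simp
qed

text \<open>Path independence of the integral of a labelling. The group \<open>F\<close> acts on
  pairs of a vertex and an accumulated value. Relators act trivially because their loops close up
  and have trivial product at every base point, so the action factors through \<open>G\<close>, and
  \<open>\<Phi> g\<close> is the value carried from the identity to \<open>g\<close>.\<close>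

theorem labelling_extends:
  fixes E :: "('e, 'k) monoid_scheme"
  assumes E: "group E" and lab: "\<And>g s. g \<in> carrier G \<Longrightarrow> s \<in> S \<Longrightarrow> lab g s \<in> carrier E"
    and rel: "\<And>r g. r \<in> R \<Longrightarrow> g \<in> carrier G \<Longrightarrow> walk E lab g (\<rho> r) = \<one>\<^bsub>E\<^esub>"
  obtains \<Phi> where "\<Phi> \<in> carrier G \<rightarrow> carrier E" "\<Phi> \<one> = \<one>\<^bsub>E\<^esub>"
    "\<And>g s. g \<in> carrier G \<Longrightarrow> s \<in> S \<Longrightarrow> \<Phi> (g \<otimes> \<pi> s) = \<Phi> g \<otimes>\<^bsub>E\<^esub> lab g s"
proof -
  interpret E: group E by fact
  define st where "st l x = (if snd l then (fst x \<otimes> \<pi> (fst l), snd x \<otimes>\<^bsub>E\<^esub> lab (fst x) (fst l))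
    else (fst x \<otimes> inv \<pi> (fst l), snd x \<otimes>\<^bsub>E\<^esub> inv\<^bsub>E\<^esub> lab (fst x \<otimes> inv \<pi> (fst l)) (fst l)))"
    for l :: "'a \<times> bool" and x :: "'g \<times> 'e"
  define X where "X = carrier G \<times> carrier E"
  have st_closed: "st l x \<in> X" if "l \<in> S \<times> UNIV" "x \<in> X" for l x
    using that lab by (auto simp: st_def X_def)
  have st_cancel: "st (s, \<not> b) (st (s, b) x) = x" if "(s, b) \<in> S \<times> UNIV" "x \<in> X" for s b x
    using that lab by (cases b) (auto simp: st_def X_def m_assoc E.m_assoc)
  have fold_closed: "fold st w x \<in> X" if "fst ` set w \<subseteq> S" "x \<in> X" for w x
    using that by (induction w arbitrary: x) (simp_all add: st_closed mem_Times_iff)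
  have walk_closed: "walk E lab g w \<in> carrier E" if "fst ` set w \<subseteq> S" "g \<in> carrier G" for w g
    using that by (induction w arbitrary: g) (auto simp: lab)
  have fold_st: "fold st w (g, e) = (walk_end g w, e \<otimes>\<^bsub>E\<^esub> walk E lab g w)"
    if "fst ` set w \<subseteq> S" "g \<in> carrier G" "e \<in> carrier E" for w g e
    using that by (induction w arbitrary: g e) (auto simp: st_def walk_closed E.m_assoc lab)
  define word where "word x = (SOME w. fst ` set w \<subseteq> S \<and> word_value F w = x)" for x
  have word: "fst ` set (word x) \<subseteq> S" "word_value F (word x) = x" if "x \<in> carrier F" for x
    using someI_ex[OF free_word_ex[OF free_F that]] by (auto simp: word_def)
  define act where "act x q = fold st (word x) q" for x q
  have act_fold: "act (word_value F w) q = fold st w q" if "fst ` set w \<subseteq> S" "q \<in> X" for w q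
    unfolding act_def
    by (rule free_fold_eq[OF free_F st_closed st_cancel])
      (use that word F.word_value_closed[OF over_carrier[OF that(1)]] in auto)
  have act_closed: "act x q \<in> X" if "x \<in> carrier F" "q \<in> X" for x q
    using that word by (simp add: act_def fold_closed)
  have act_mult: "act (x \<otimes>\<^bsub>F\<^esub> y) q = act y (act x q)"
    if "x \<in> carrier F" "y \<in> carrier F" "q \<in> X" for x y q
  proof -
    have "x \<otimes>\<^bsub>F\<^esub> y = word_value F (word x @ word y)"
      using F.word_value_append[OF over_carrier over_carrier, OF word(1) word(1)] word that by simp
    moreover have "fst ` set (word x @ word y) \<subseteq> S" using that word by auto
    ultimately show ?thesis using act_fold[of "word x @ word y" q] that by (simp add: act_def)
  qed
  have act_one: "act \<one>\<^bsub>F\<^esub> q = q" if "q \<in> X" for q using act_fold[of "[]" q] that by simp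
  \<comment> \<open>The elements acting trivially form a normal subgroup, so finding the relators in
    it puts the whole kernel of \<open>\<pi>\<close> there.\<close>
  define Z where "Z = {z \<in> carrier F. \<forall>q\<in>X. act z q = q}"
  have inv_act: "act (inv\<^bsub>F\<^esub> g) (act g q) = q" if "g \<in> carrier F" "q \<in> X" for g q
    using act_mult[of g "inv\<^bsub>F\<^esub> g" q] act_one that by simp
  have "subgroup Z F"
  proof (rule F.subgroupI)
    show "inv\<^bsub>F\<^esub> z \<in> Z" if "z \<in> Z" for z
      using that inv_act[of z] by (auto simp: Z_def)
    show "y \<otimes>\<^bsub>F\<^esub> z \<in> Z" if "y \<in> Z" "z \<in> Z" for y z
      using that by (auto simp: Z_def act_mult)
    show "Z \<noteq> {}" using act_one by (auto simp: Z_def)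
  qed (auto simp: Z_def)
  then have "Z \<lhd> F"
  proof (rule F.normal_invI)
    fix g z assume "g \<in> carrier F" "z \<in> Z"
    then show "g \<otimes>\<^bsub>F\<^esub> z \<otimes>\<^bsub>F\<^esub> inv\<^bsub>F\<^esub> g \<in> Z"
      by (auto simp: Z_def act_mult act_closed inv_act)
  qed
  moreover have "R \<subseteq> Z"
  proof
    fix r assume r: "r \<in> R"
    have "act r (g, e) = (g, e)" if "g \<in> carrier G" "e \<in> carrier E" for g e
      using that r act_fold[of "\<rho> r" "(g, e)"]
      by (simp add: rel_over rel_value X_def fold_st walk_end_relator rel)
    then show "r \<in> Z" using r R_carrier by (auto simp: Z_def X_def)
  qed
  ultimately have ker: "kernel F G \<pi> \<subseteq> Z" using \<pi>_kernel F.normal_closure_subset by simp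
  have one_X: "(\<one>, \<one>\<^bsub>E\<^esub>) \<in> X" by (simp add: X_def)
  have act_eq: "act x (\<one>, \<one>\<^bsub>E\<^esub>) = act y (\<one>, \<one>\<^bsub>E\<^esub>)"
    if "x \<in> carrier F" "y \<in> carrier F" "\<pi> x = \<pi> y" for x y
  proof -
    have "x \<otimes>\<^bsub>F\<^esub> inv\<^bsub>F\<^esub> y \<in> kernel F G \<pi>" using that by (simp add: kernel_def)
    then have "act (x \<otimes>\<^bsub>F\<^esub> inv\<^bsub>F\<^esub> y) (\<one>, \<one>\<^bsub>E\<^esub>) = (\<one>, \<one>\<^bsub>E\<^esub>)" using ker one_X by (auto simp: Z_def)
    then have "act ((x \<otimes>\<^bsub>F\<^esub> inv\<^bsub>F\<^esub> y) \<otimes>\<^bsub>F\<^esub> y) (\<one>, \<one>\<^bsub>E\<^esub>) = act y (\<one>, \<one>\<^bsub>E\<^esub>)"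
      using that one_X by (subst act_mult) auto
    then show ?thesis using that by (simp add: F.m_assoc)
  qed
  define lift where "lift g = (SOME x. x \<in> carrier F \<and> \<pi> x = g)" for g
  have lift: "lift g \<in> carrier F" "\<pi> (lift g) = g" if "g \<in> carrier G" for g
  proof -
    have "\<exists>x. x \<in> carrier F \<and> \<pi> x = g" using that \<pi>_surj by (metis imageE)
    then show "lift g \<in> carrier F" "\<pi> (lift g) = g"
      using someI_ex[of "\<lambda>x. x \<in> carrier F \<and> \<pi> x = g"] by (auto simp: lift_def)
  qed
  define \<Phi> where "\<Phi> g = snd (act (lift g) (\<one>, \<one>\<^bsub>E\<^esub>))" for g
  have \<Phi>: "\<Phi> (\<pi> x) = snd (act x (\<one>, \<one>\<^bsub>E\<^esub>))" if "x \<in> carrier F" for x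
    using act_eq[of "lift (\<pi> x)" x] lift[of "\<pi> x"] that by (simp add: \<Phi>_def)
  have fst_act: "fst (act x (\<one>, \<one>\<^bsub>E\<^esub>)) = \<pi> x" if "x \<in> carrier F" for x
    using word[OF that] that by (simp add: act_def fold_st walk_end_eq)
  show ?thesis
  proof (rule that)
    show "\<Phi> \<in> carrier G \<rightarrow> carrier E"
    proof
      fix g assume "g \<in> carrier G"
      then have "act (lift g) (\<one>, \<one>\<^bsub>E\<^esub>) \<in> X" using lift one_X by (intro act_closed) auto
      then show "\<Phi> g \<in> carrier E" by (simp add: \<Phi>_def X_def mem_Times_iff)
    qed
    show "\<Phi> \<one> = \<one>\<^bsub>E\<^esub>" using \<Phi>[of "\<one>\<^bsub>F\<^esub>"] act_one one_X by simp
    fix g s assume g: "g \<in> carrier G" and s: "s \<in> S"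
    define x where "x = lift g"
    have x: "x \<in> carrier F" "\<pi> x = g" using lift[OF g] by (auto simp: x_def)
    have "act s (g, \<Phi> g) = st (s, True) (g, \<Phi> g)"
      using act_fold[of "[(s, True)]" "(g, \<Phi> g)"] s g act_closed[OF x(1) one_X]
      by (simp add: X_def \<Phi>_def x_def[symmetric] mem_Times_iff)
    moreover have "act x (\<one>, \<one>\<^bsub>E\<^esub>) = (g, \<Phi> g)"
      using fst_act[OF x(1)] \<Phi>[OF x(1)] x by (simp add: prod_eq_iff)
    moreover have "\<Phi> (\<pi> (x \<otimes>\<^bsub>F\<^esub> s)) = snd (act s (act x (\<one>, \<one>\<^bsub>E\<^esub>)))"
      using x s one_X by (subst \<Phi>) (auto simp: act_mult)
    ultimately show "\<Phi> (g \<otimes> \<pi> s) = \<Phi> g \<otimes>\<^bsub>E\<^esub> lab g s"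
      using x s by (simp add: st_def)
  qed
qed

end

section \<open>Linear algebra over the integers modulo a prime\<close>

lemma card_le_fibres:
  assumes "finite A" "finite B" "f ` A \<subseteq> B" "\<And>b. b \<in> B \<Longrightarrow> card {x \<in> A. f x = b} \<le> k"
  shows "card A \<le> card B * k"
proof -
  have "A = (\<Union>b\<in>B. {x \<in> A. f x = b})" using assms(3) by auto
  then have "card A \<le> (\<Sum>b\<in>B. card {x \<in> A. f x = b})" using card_UN_le[OF assms(2)] by metis
  also have "\<dots> \<le> card B * k" using sum_bounded_above[of B _ k] assms(4) by simp
  finally show ?thesis .
qed

lemma card_image_mult_le_fibres:
  assumes "finite A" "\<And>x. x \<in> A \<Longrightarrow> k \<le> card {y \<in> A. f y = f x}"
  shows "card (f ` A) * k \<le> card A"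
proof -
  have "card (f ` A) * k \<le> (\<Sum>b\<in>f ` A. card {y \<in> A. f y = b})"
    using sum_bounded_below[of "f ` A" k "\<lambda>b. card {y \<in> A. f y = b}"] assms(2) by auto
  also have "\<dots> = card (\<Union>b\<in>f ` A. {y \<in> A. f y = b})"
    using assms(1) by (subst card_UN_disjoint) auto
  also have "(\<Union>b\<in>f ` A. {y \<in> A. f y = b}) = A" by auto
  finally show ?thesis .
qed

text \<open>A linear form over the integers modulo \<open>p\<close>, presented on integer-valued
  functions: additivity holds exactly, and the second clause makes the value modulo \<open>p\<close>
  depend only on the residues of the coordinates in \<open>J\<close>.\<close>

definition linear_mod :: "nat \<Rightarrow> 'j set \<Rightarrow> (('j \<Rightarrow> int) \<Rightarrow> int) \<Rightarrow> bool" where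
  "linear_mod p J D \<longleftrightarrow> (\<forall>c c'. D (\<lambda>j. c j - c' j) = D c - D c') \<and>
     (\<forall>c. (\<forall>j\<in>J. int p dvd c j) \<longrightarrow> int p dvd D c)"

lemma linear_mod_diff: "linear_mod p J D \<Longrightarrow> D (\<lambda>j. c j - c' j) = D c - D c'"
  and linear_mod_dvd: "linear_mod p J D \<Longrightarrow> (\<And>j. j \<in> J \<Longrightarrow> int p dvd c j) \<Longrightarrow> int p dvd D c"
  by (simp_all add: linear_mod_def)

lemma linear_mod_cong:
  assumes "linear_mod p J D" "\<And>j. j \<in> J \<Longrightarrow> [c j = c' j] (mod int p)"
  shows "[D c = D c'] (mod int p)"
proof -
  have "int p dvd D (\<lambda>j. c j - c' j)"
    by (rule linear_mod_dvd[OF assms(1)]) (use assms(2) in \<open>simp add: cong_iff_dvd_diff\<close>)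
  then show ?thesis by (simp add: linear_mod_diff[OF assms(1)] cong_iff_dvd_diff)
qed

text \<open>Rank-nullity as a count: there are at most \<open>p ^ card DD\<close> value vectors, and
  subtracting a fixed member embeds each fibre in the space of common zeros.\<close>

lemma card_solutions:
  assumes J: "finite J" and DD: "finite DD" and lin: "\<And>D. D \<in> DD \<Longrightarrow> linear_mod p J D" and p: "p > 0"
  shows "p ^ card J \<le> p ^ card DD * card {c \<in> J \<rightarrow>\<^sub>E {0..<int p}. \<forall>D\<in>DD. int p dvd D c}"
    (is "_ \<le> _ * card ?K")
proof -
  let ?A = "J \<rightarrow>\<^sub>E {0..<int p}" and ?B = "DD \<rightarrow>\<^sub>E {0..<int p}"
  have fin: "finite ?A" using J by (intro finite_PiE) auto
  let ?f = "\<lambda>c. restrict (\<lambda>D. D c mod int p) DD"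
  have fibre: "card {c \<in> ?A. ?f c = b} \<le> card ?K" for b
  proof (cases "{c \<in> ?A. ?f c = b} = {}")
    case False
    then obtain c0 where c0: "c0 \<in> ?A" "?f c0 = b" by auto
    let ?g = "\<lambda>c. restrict (\<lambda>j. (c j - c0 j) mod int p) J"
    show ?thesis
    proof (rule card_inj_on_le)
      show "inj_on ?g {c \<in> ?A. ?f c = b}"
      proof (rule inj_onI)
        fix c d assume c: "c \<in> {c \<in> ?A. ?f c = b}" and d: "d \<in> {c \<in> ?A. ?f c = b}" and eq: "?g c = ?g d"
        show "c = d"
        proof (rule PiE_ext[of _ J "\<lambda>_. {0..<int p}"])
          fix j assume j: "j \<in> J"
          have "[c j - c0 j = d j - c0 j] (mod int p)"
            using fun_cong[OF eq, of j] j by (simp add: cong_def)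
          then have "[c j = d j] (mod int p)" by (simp add: cong_iff_dvd_diff)
          moreover have "c j \<in> {0..<int p}" "d j \<in> {0..<int p}" using c d j by (auto simp: PiE_iff)
          ultimately show "c j = d j" by (simp add: cong_def)
        qed (use c d in auto)
      qed
      show "?g ` {c \<in> ?A. ?f c = b} \<subseteq> ?K"
      proof (clarify, intro conjI ballI)
        fix c assume c: "c \<in> ?A" and b: "b = ?f c"
        show "?g c \<in> ?A" using p by auto
        fix D assume D: "D \<in> DD"
        have "[D (?g c) = D (\<lambda>j. c j - c0 j)] (mod int p)"
          by (rule linear_mod_cong[OF lin[OF D]]) (simp add: cong_def)
        moreover have "D (\<lambda>j. c j - c0 j) = D c - D c0" using lin[OF D] by (auto simp: linear_mod_def)
        moreover have "D c mod int p = D c0 mod int p"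
          using fun_cong[OF b, of D] fun_cong[OF c0(2), of D] D by simp
        ultimately show "int p dvd D (?g c)"
          by (metis cong_0_iff cong_def cong_iff_dvd_diff cong_trans)
      qed
      show "finite ?K" using fin by simp
    qed
  next
    case True
    show ?thesis unfolding True by simp
  qed
  have "card ?A \<le> card ?B * card ?K"
    by (rule card_le_fibres[where f = ?f]) (use fin DD fibre p in \<open>auto intro!: finite_PiE\<close>)
  then show ?thesis using J DD by (simp add: card_PiE)
qed

text \<open>A nonzero solution has a coordinate \<open>j0\<close> that is invertible modulo
  \<open>p\<close>. Demanding that the remaining solutions vanish at \<open>j0\<close> costs one
  condition; a relation evaluated at \<open>j0\<close> then forces the coefficient of the first
  solution to be zero.\<close>

lemma independent_solutions:
  assumes J: "finite J" and p: "prime p"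
    and "finite DD" "\<And>D. D \<in> DD \<Longrightarrow> linear_mod p J D" "card DD + k \<le> card J"
  shows "\<exists>c :: nat \<Rightarrow> 'j \<Rightarrow> int. (\<forall>m<k. \<forall>D\<in>DD. int p dvd D (c m)) \<and>
    (\<forall>b. (\<forall>j\<in>J. int p dvd (\<Sum>m<k. b m * c m j)) \<longrightarrow> (\<forall>m<k. int p dvd b m))"
  using assms(3-)
proof (induction k arbitrary: DD)
  case (Suc k)
  let ?K = "{c \<in> J \<rightarrow>\<^sub>E {0..<int p}. \<forall>D\<in>DD. int p dvd D c}"
  have p1: "p > 1" using p prime_gt_1_nat by blast
  have "p ^ card DD * p ^ 1 \<le> p ^ card J"
    using Suc.prems(3) p1 unfolding power_add[symmetric] by (intro power_increasing) auto
  also have "\<dots> \<le> p ^ card DD * card ?K"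
    by (rule card_solutions) (use J Suc.prems p1 in auto)
  finally have card_K: "p \<le> card ?K" using p1 by simp
  have "\<exists>c0\<in>?K. \<exists>j\<in>J. c0 j \<noteq> 0"
  proof (rule ccontr)
    assume "\<not> ?thesis"
    then have "?K \<subseteq> {restrict (\<lambda>_. 0) J}" by (auto simp: PiE_iff extensional_def fun_eq_iff)
    then have "card ?K \<le> 1" using card_mono[of "{restrict (\<lambda>_. 0) J}" ?K] by simp
    then show False using card_K p1 by simp
  qed
  then obtain c0 j0 where c0: "c0 \<in> ?K" and j0: "j0 \<in> J" "c0 j0 \<noteq> 0" by auto
  have "c0 j0 \<in> {0..<int p}" using c0 j0 by (auto simp: PiE_iff)
  then have nz: "\<not> int p dvd c0 j0" using j0(2) by (auto dest: zdvd_imp_le)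
  have pi: "prime (int p)" using p by simp
  let ?DD = "insert (\<lambda>c. c j0) DD"
  have "card ?DD + k \<le> card J"
    using Suc.prems by (simp add: card_insert_if)
  moreover have "linear_mod p J D" if "D \<in> ?DD" for D
    using that Suc.prems j0 by (auto simp: linear_mod_def)
  ultimately obtain c where c: "\<forall>m<k. \<forall>D\<in>?DD. int p dvd D (c m)"
    and ind: "\<forall>b. (\<forall>j\<in>J. int p dvd (\<Sum>m<k. b m * c m j)) \<longrightarrow> (\<forall>m<k. int p dvd b m)"
    using Suc.IH[of ?DD] Suc.prems by blast
  show ?case
  proof (intro exI[of _ "case_nat c0 c"] conjI allI impI ballI)
    fix m D assume "m < Suc k" "D \<in> DD"
    then show "int p dvd D (case_nat c0 c m)" using c0 c by (auto split: nat.split)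
  next
    fix b m assume b: "\<forall>j\<in>J. int p dvd (\<Sum>m<Suc k. b m * case_nat c0 c m j)" and m: "m < Suc k"
    have b': "int p dvd b 0 * c0 j + (\<Sum>m<k. b (Suc m) * c m j)" if "j \<in> J" for j
      using b that by (simp add: sum.lessThan_Suc_shift del: sum.lessThan_Suc)
    have "int p dvd (\<Sum>m<k. b (Suc m) * c m j0)"
      by (intro dvd_sum dvd_mult) (use c in auto)
    then have "int p dvd b 0 * c0 j0" using b'[OF j0(1)] by (simp add: dvd_add_left_iff)
    then have b0: "int p dvd b 0" using nz pi by (simp add: prime_dvd_mult_iff)
    then have "int p dvd (\<Sum>m<k. b (Suc m) * c m j)" if "j \<in> J" for j
      using b'[OF that] by (simp add: dvd_add_right_iff)
    then show "int p dvd b m" using b0 spec[OF ind, of "\<lambda>m. b (Suc m)"] m by (cases m) auto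
  qed
qed simp

section \<open>Characters modulo p\<close>

definition additive_mod :: "nat \<Rightarrow> ('g, 'n) monoid_scheme \<Rightarrow> 'g set \<Rightarrow> ('g \<Rightarrow> int) \<Rightarrow> bool" where
  "additive_mod p G L h \<longleftrightarrow> (\<forall>x\<in>L. \<forall>y\<in>L. [h (x \<otimes>\<^bsub>G\<^esub> y) = h x + h y] (mod int p))"

text \<open>Linear independence of the characters \<open>h 0\<close>, ..., \<open>h (n - 1)\<close>
  modulo a prime, stated dually as surjectivity onto the vectors of length \<open>n\<close>. This
  form directly supplies elements with prescribed character values.\<close>

definition jointly_surj :: "nat \<Rightarrow> 'g set \<Rightarrow> (nat \<Rightarrow> 'g \<Rightarrow> int) \<Rightarrow> nat \<Rightarrow> bool" where
  "jointly_surj p L h n \<longleftrightarrow> (\<forall>v. \<exists>l\<in>L. \<forall>k<n. [h k l = v k] (mod int p))"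

text \<open>Values are standard residues and fixed outside \<open>L\<close>, so each homomorphism to
  the integers modulo \<open>p\<close> has exactly one representative and can be counted.\<close>

definition characters :: "nat \<Rightarrow> ('g, 'n) monoid_scheme \<Rightarrow> 'g set \<Rightarrow> ('g \<Rightarrow> int) set" where
  "characters p G L = {\<theta> \<in> L \<rightarrow>\<^sub>E {0..<int p}. additive_mod p G L \<theta>}"

text \<open>For prime \<open>p\<close> this is \<open>L^p [L, L]\<close>. Described as an
  intersection of kernels, its normality and its containing all commutators can be read off from the
  characters.\<close>

definition char_kernel :: "nat \<Rightarrow> ('g, 'n) monoid_scheme \<Rightarrow> 'g set \<Rightarrow> 'g set" where
  "char_kernel p G L = {l \<in> L. \<forall>\<theta>. additive_mod p G L \<theta> \<longrightarrow> int p dvd \<theta> l}"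

lemma jointly_surjD: "jointly_surj p L h n \<Longrightarrow> \<exists>l\<in>L. \<forall>k<n. [h k l = v k] (mod int p)"
  by (simp add: jointly_surj_def)

lemma additive_modD: "additive_mod p G L h \<Longrightarrow> x \<in> L \<Longrightarrow> y \<in> L \<Longrightarrow> [h (x \<otimes>\<^bsub>G\<^esub> y) = h x + h y] (mod int p)"
  by (simp add: additive_mod_def)

lemma additive_mod_subset: "additive_mod p G L h \<Longrightarrow> M \<subseteq> L \<Longrightarrow> additive_mod p G M h"
  by (auto simp: additive_mod_def)

lemma jointly_surj_cong:
  "jointly_surj p L h n \<Longrightarrow> (\<And>k l. k < n \<Longrightarrow> l \<in> L \<Longrightarrow> h' k l = h k l) \<Longrightarrow> jointly_surj p L h' n"
  unfolding jointly_surj_def by metis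

context group begin

lemma subgroup_nat_pow_closed: "subgroup L G \<Longrightarrow> x \<in> L \<Longrightarrow> x [^] (n::nat) \<in> L"
  by (induction n) (auto intro: subgroup.one_closed subgroup.m_closed)

context
  fixes p :: nat and L h assumes L: "subgroup L G" and h: "additive_mod p G L h"
begin

lemma additive_mod_one: "int p dvd h \<one>"
proof -
  have "[h (\<one> \<otimes> \<one>) = h \<one> + h \<one>] (mod int p)"
    using additive_modD[OF h] subgroup.one_closed[OF L] by blast
  then have "[h \<one> + 0 = h \<one> + h \<one>] (mod int p)" by simp
  then have "[0 = h \<one>] (mod int p)" unfolding cong_add_lcancel .
  then show ?thesis using cong_0_iff cong_sym by blast
qed

lemma additive_mod_inv: "x \<in> L \<Longrightarrow> [h (inv x) = - h x] (mod int p)"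
proof -
  assume x: "x \<in> L"
  then have "[h (inv x \<otimes> x) = h (inv x) + h x] (mod int p)"
    using additive_modD[OF h] subgroup.m_inv_closed[OF L] by blast
  then have "[h (inv x) + h x = h \<one>] (mod int p)"
    using x subgroup.mem_carrier[OF L] by (simp add: cong_sym_eq)
  then have "int p dvd h (inv x) + h x - h \<one>" by (simp add: cong_iff_dvd_diff)
  then have "int p dvd h (inv x) + h x" using additive_mod_one by (metis diff_add_cancel dvd_add)
  then show ?thesis by (simp add: cong_iff_dvd_diff)
qed

lemma additive_mod_pow: "x \<in> L \<Longrightarrow> [h (x [^] (n::nat)) = int n * h x] (mod int p)"
proof (induction n)
  case 0
  then show ?case using additive_mod_one by (simp add: cong_0_iff)
next
  case (Suc n)
  have "x [^] n \<in> L" using Suc.prems L by (rule subgroup_nat_pow_closed[rotated])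
  then have "[h (x [^] Suc n) = h (x [^] n) + h x] (mod int p)"
    using additive_modD[OF h] Suc.prems by simp
  also have "[h (x [^] n) + h x = int n * h x + h x] (mod int p)"
    using Suc by (intro cong_add) auto
  finally show ?case by (simp add: algebra_simps)
qed

end

context
  fixes p :: nat and L assumes L: "subgroup L G" and p: "prime p"
begin

text \<open>An element on which \<open>h n\<close> is nonzero while the others vanish exists unless \<open>h n\<close> is a combination.\<close>

lemma jointly_surj_Suc:
  assumes h: "\<And>k. k \<le> n \<Longrightarrow> additive_mod p G L (h k)" and surj: "jointly_surj p L h n"
    and indep: "\<not> (\<exists>b. \<forall>l\<in>L. [h n l = (\<Sum>k<n. b k * h k l)] (mod int p))"
  shows "jointly_surj p L h (Suc n)"
proof -
  have pow_closed: "x [^] t \<in> L" if "x \<in> L" for x and t :: nat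
    using that L by (simp add: subgroup_nat_pow_closed)
  have "\<forall>i. \<exists>x. x \<in> L \<and> (\<forall>k<n. [h k x = of_bool (k = i)] (mod int p))"
    using jointly_surjD[OF surj, of "\<lambda>k. of_bool (k = i)" for i] by (intro allI) blast
  then have "\<exists>e. \<forall>i. e i \<in> L \<and> (\<forall>k<n. [h k (e i) = of_bool (k = i)] (mod int p))" by (rule choice)
  then obtain e where e: "\<And>i. e i \<in> L" "\<And>i k. k < n \<Longrightarrow> [h k (e i) = of_bool (k = i)] (mod int p)"
    by metis
  have p0: "int p > 0" using p prime_gt_0_nat by simp
  have "\<exists>l\<in>L. (\<forall>k<n. int p dvd h k l) \<and> \<not> int p dvd h n l"
  proof (rule ccontr)
    assume contr: "\<not> ?thesis"
    \<comment> \<open>If \<open>h n\<close> vanished on the common kernel of the others, it would be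
      the combination with coefficients \<open>h n (e k)\<close>. The induction kills one value at a
      time: multiplying \<open>l\<close> by a power of the dual element \<open>e m\<close> makes
      \<open>h m\<close> vanish and leaves the other \<open>h k\<close> with \<open>k < n\<close>
      unchanged.\<close>
    have "[h n l = (\<Sum>k<m. h n (e k) * h k l)] (mod int p)"
      if "m \<le> n" "l \<in> L" "\<And>k. m \<le> k \<Longrightarrow> k < n \<Longrightarrow> int p dvd h k l" for m l
      using that
    proof (induction m arbitrary: l)
      case 0
      then show ?case using contr by (auto simp: cong_0_iff)
    next
      case (Suc m)
      define t where "t = nat ((- h m l) mod int p)"
      have t: "[int t = - h m l] (mod int p)" using p0 by (simp add: t_def cong_def)
      define l' where "l' = l \<otimes> e m [^] t"
      have l': "l' \<in> L" using Suc.prems e pow_closed L by (simp add: l'_def subgroup.m_closed)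
      have hl': "[h k l' = h k l - h m l * h k (e m)] (mod int p)" if "k \<le> n" for k
      proof -
        have "[h k l' = h k l + h k (e m [^] t)] (mod int p)"
          unfolding l'_def using additive_modD[OF h[OF that]] Suc.prems e pow_closed by blast
        also have "[h k l + h k (e m [^] t) = h k l + int t * h k (e m)] (mod int p)"
          using additive_mod_pow[OF L h[OF that] e(1)] by (intro cong_add) auto
        also have "[h k l + int t * h k (e m) = h k l + (- h m l) * h k (e m)] (mod int p)"
          by (intro cong_add cong_mult t cong_refl)
        finally show ?thesis by simp
      qed
      have dvd_iff: "[h k l' = h k l - h m l * of_bool (k = m)] (mod int p)" if "k < n" for k
      proof -
        have "[h k l - h m l * h k (e m) = h k l - h m l * of_bool (k = m)] (mod int p)"
          by (intro cong_diff cong_mult cong_refl e(2) that)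
        then show ?thesis using hl'[of k] that cong_trans by fastforce
      qed
      have "[h n l' = (\<Sum>k<m. h n (e k) * h k l')] (mod int p)"
      proof (rule Suc.IH)
        fix k assume k: "m \<le> k" "k < n"
        have "int p dvd h k l - h m l * of_bool (k = m)"
          using Suc.prems(3)[of k] k by (cases "k = m") auto
        then show "int p dvd h k l'" using dvd_iff[OF k(2)] by (simp add: cong_dvd_iff)
      qed (use Suc.prems l' in auto)
      also have "[(\<Sum>k<m. h n (e k) * h k l') = (\<Sum>k<m. h n (e k) * h k l)] (mod int p)"
      proof (intro cong_sum cong_mult cong_refl)
        fix k assume "k \<in> {..<m}"
        then show "[h k l' = h k l] (mod int p)" using dvd_iff[of k] Suc.prems(1) by simp
      qed
      finally have "[h n l - h m l * h n (e m) = (\<Sum>k<m. h n (e k) * h k l)] (mod int p)"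
        using hl'[of n] cong_trans cong_sym by blast
      then have "[h n l - h m l * h n (e m) + h m l * h n (e m) =
        (\<Sum>k<m. h n (e k) * h k l) + h m l * h n (e m)] (mod int p)"
        by (intro cong_add cong_refl)
      then show ?case by (simp add: mult.commute)
    qed
    from this[of n] indep show False by (meson le_refl not_less)
  qed
  then obtain l0 where l0: "l0 \<in> L" "\<And>k. k < n \<Longrightarrow> int p dvd h k l0" "\<not> int p dvd h n l0" by blast
  show ?thesis unfolding jointly_surj_def
  proof
    fix v
    obtain l where l: "l \<in> L" "\<And>k. k < n \<Longrightarrow> [h k l = v k] (mod int p)"
      using surj unfolding jointly_surj_def by blast
    have "coprime (h n l0) (int p)" using l0(3) p
      by (metis coprime_commute prime_imp_coprime prime_nat_int_transfer)
    \<comment> \<open>\<open>z\<close> inverts \<open>h n l0\<close>, so the power \<open>t\<close>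
      of \<open>l0\<close> chosen below corrects the value of \<open>h n\<close> without disturbing
      the values of the others.\<close>
    then obtain z where z: "[h n l0 * z = 1] (mod int p)" using cong_solve_coprime_int by blast
    define t where "t = nat (((v n - h n l) * z) mod int p)"
    have t: "[int t = (v n - h n l) * z] (mod int p)" using p0 by (simp add: t_def cong_def)
    have pow: "l0 [^] t \<in> L" using pow_closed l0 by simp
    have val: "[h k (l \<otimes> l0 [^] t) = h k l + int t * h k l0] (mod int p)" if "k \<le> n" for k
    proof -
      have "[h k (l \<otimes> l0 [^] t) = h k l + h k (l0 [^] t)] (mod int p)"
        using additive_modD[OF h[OF that]] l pow by blast
      also have "[h k l + h k (l0 [^] t) = h k l + int t * h k l0] (mod int p)"
        using additive_mod_pow[OF L h[OF that] l0(1)] by (intro cong_add) auto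
      finally show ?thesis .
    qed
    show "\<exists>l\<in>L. \<forall>k<Suc n. [h k l = v k] (mod int p)"
    proof (intro bexI allI impI)
      show "l \<otimes> l0 [^] t \<in> L" using l pow L by (simp add: subgroup.m_closed)
      fix k assume "k < Suc n"
      then consider "k < n" | "k = n" by linarith
      then show "[h k (l \<otimes> l0 [^] t) = v k] (mod int p)"
      proof cases
        case 1
        have "[h k l + int t * h k l0 = h k l + 0] (mod int p)"
          using l0(2)[OF 1] by (intro cong_add cong_refl) (simp add: cong_0_iff)
        then show ?thesis using val[of k] 1 l(2)[OF 1] cong_trans by (metis add.right_neutral less_imp_le)
      next
        case 2
        have "[h n l + int t * h n l0 = h n l + ((v n - h n l) * z) * h n l0] (mod int p)"
          by (intro cong_add cong_mult t cong_refl)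
        also have "h n l + ((v n - h n l) * z) * h n l0 = h n l + (v n - h n l) * (h n l0 * z)" by simp
        also have "[\<dots> = h n l + (v n - h n l) * 1] (mod int p)"
          by (intro cong_add cong_mult z cong_refl)
        finally show ?thesis using val[of n] 2 cong_trans by fastforce
      qed
    qed
  qed
qed

text \<open>By induction the first \<open>n\<close> characters are jointly onto; if the last one
  were a combination of them, giving it the coefficient \<open>-1\<close> would produce a nontrivial
  relation.\<close>

lemma jointly_surj_independent:
  assumes "\<And>k. k < n \<Longrightarrow> additive_mod p G L (h k)"
    and "\<And>b k. (\<And>l. l \<in> L \<Longrightarrow> int p dvd (\<Sum>k<n. b k * h k l)) \<Longrightarrow> k < n \<Longrightarrow> int p dvd b k"
  shows "jointly_surj p L h n"
  using assms
proof (induction n)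
  case 0
  then show ?case using subgroup.one_closed[OF L] by (auto simp: jointly_surj_def)
next
  case (Suc n)
  have surj: "jointly_surj p L h n"
  proof (rule Suc.IH)
    fix b k assume b: "\<And>l. l \<in> L \<Longrightarrow> int p dvd (\<Sum>k<n. b k * h k l)" and k: "k < n"
    have "int p dvd (\<Sum>k<Suc n. (b(n := 0)) k * h k l)" if "l \<in> L" for l
      using b[OF that] by simp
    then have "int p dvd (b(n := 0)) k" using k by (intro Suc.prems(2)[of "b(n := 0)" k]) auto
    then show "int p dvd b k" using k by simp
  qed (use Suc.prems in auto)
  show ?case
  proof (rule jointly_surj_Suc)
    show "\<not> (\<exists>b. \<forall>l\<in>L. [h n l = (\<Sum>k<n. b k * h k l)] (mod int p))"
    proof
      assume "\<exists>b. \<forall>l\<in>L. [h n l = (\<Sum>k<n. b k * h k l)] (mod int p)"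
      then obtain b where b: "\<And>l. l \<in> L \<Longrightarrow> [h n l = (\<Sum>k<n. b k * h k l)] (mod int p)" by blast
      have "int p dvd (\<Sum>k<Suc n. (b(n := - 1)) k * h k l)" if "l \<in> L" for l
        using b[OF that] by (simp add: cong_iff_dvd_diff dvd_diff_commute)
      then have "int p dvd (b(n := - 1)) n" by (intro Suc.prems(2)[of "b(n := - 1)" n]) auto
      then show False using p not_prime_unit by (fastforce simp: zdvd1_eq)
    qed
  qed (use Suc.prems surj in auto)
qed

text \<open>There are at most \<open>p ^ n\<close> combinations of the given characters, so a larger
  set of characters contains one outside their span.\<close>

lemma jointly_surj_extend_one:
  assumes fin: "finite (characters p G L)" and h: "\<And>k. k < n \<Longrightarrow> additive_mod p G L (h k)"
    and surj: "jointly_surj p L h n" and card: "p ^ n < card (characters p G L)"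
  shows "\<exists>\<theta>. additive_mod p G L \<theta> \<and> jointly_surj p L (h(n := \<theta>)) (Suc n)"
proof -
  have p0: "p > 0" using p prime_gt_0_nat by simp
  let ?comb = "\<lambda>b. restrict (\<lambda>l. (\<Sum>k<n. b k * h k l) mod int p) L"
  let ?B = "{..<n} \<rightarrow>\<^sub>E {0..<int p}"
  have finB: "finite ?B" by (intro finite_PiE) auto
  have "card (?comb ` ?B) \<le> card ?B" using finB by (rule card_image_le)
  also have "\<dots> = p ^ n" by (simp add: card_PiE)
  finally have "\<not> characters p G L \<subseteq> ?comb ` ?B"
    using card finB card_mono[of "?comb ` ?B" "characters p G L"] by auto
  then obtain \<theta> where \<theta>: "\<theta> \<in> characters p G L" "\<theta> \<notin> ?comb ` ?B" by blast
  have "jointly_surj p L (h(n := \<theta>)) (Suc n)"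
  proof (rule jointly_surj_Suc)
    show "jointly_surj p L (h(n := \<theta>)) n" using surj by (rule jointly_surj_cong) auto
    show "additive_mod p G L ((h(n := \<theta>)) k)" if "k \<le> n" for k
      using that h \<theta> by (auto simp: characters_def)
    show "\<not> (\<exists>b. \<forall>l\<in>L. [(h(n := \<theta>)) n l = (\<Sum>k<n. b k * (h(n := \<theta>)) k l)] (mod int p))"
    proof
      assume "\<exists>b. \<forall>l\<in>L. [(h(n := \<theta>)) n l = (\<Sum>k<n. b k * (h(n := \<theta>)) k l)] (mod int p)"
      then obtain b where b: "\<And>l. l \<in> L \<Longrightarrow> [\<theta> l = (\<Sum>k<n. b k * (h(n := \<theta>)) k l)] (mod int p)" by auto
      let ?b = "restrict (\<lambda>k. b k mod int p) {..<n}"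
      have "\<theta> = ?comb ?b"
      proof
        fix l
        show "\<theta> l = ?comb ?b l"
        proof (cases "l \<in> L")
          case True
          have "[\<theta> l = (\<Sum>k<n. b k * (h(n := \<theta>)) k l)] (mod int p)" using b True .
          also have "[(\<Sum>k<n. b k * (h(n := \<theta>)) k l) = (\<Sum>k<n. ?b k * h k l)] (mod int p)"
            by (intro cong_sum cong_mult) (auto simp: cong_def)
          finally have "\<theta> l mod int p = (\<Sum>k<n. ?b k * h k l) mod int p" by (simp add: cong_def)
          moreover have "\<theta> l \<in> {0..<int p}" using \<theta>(1) True by (auto simp: characters_def PiE_iff)
          ultimately show ?thesis using True by simp
        next
          case False
          then show ?thesis using \<theta>(1) by (auto simp: characters_def PiE_iff extensional_def)
        qed
      qed
      moreover have "?b \<in> ?B" using p0 by auto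
      ultimately show False using \<theta>(2) by blast
    qed
  qed
  then show ?thesis using \<theta> by (auto simp: characters_def)
qed

lemma jointly_surj_extend:
  assumes fin: "finite (characters p G L)" and h: "\<And>k. k < n \<Longrightarrow> additive_mod p G L (h k)"
    and surj: "jointly_surj p L h n" and nu: "n \<le> u" and card: "p ^ u \<le> card (characters p G L)"
  shows "\<exists>h'. (\<forall>k<n. h' k = h k) \<and> (\<forall>k<u. additive_mod p G L (h' k)) \<and> jointly_surj p L h' u"
  using nu card
proof (induction u rule: dec_induct)
  case base
  then show ?case using h surj by auto
next
  case (step u)
  have p1: "p > 1" using p prime_gt_1_nat by blast
  have "p ^ u < p ^ Suc u" using p1 by simp
  then have lt: "p ^ u < card (characters p G L)" using step.prems by linarith
  then obtain h' where h': "\<And>k. k < n \<Longrightarrow> h' k = h k" "\<And>k. k < u \<Longrightarrow> additive_mod p G L (h' k)"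
    "jointly_surj p L h' u" using step.IH by (metis less_imp_le)
  obtain \<theta> where \<theta>: "additive_mod p G L \<theta>" "jointly_surj p L (h'(u := \<theta>)) (Suc u)"
    using jointly_surj_extend_one[OF fin h'(2,3) lt] by blast
  show ?case
  proof (intro exI conjI)
    show "jointly_surj p L (h'(u := \<theta>)) (Suc u)" by fact
  qed (use \<theta>(1) h' step.hyps in \<open>auto simp: less_Suc_eq\<close>)
qed

text \<open>A longest jointly surjective family is a basis: by maximality every character is a
  combination of it, so its common zeros already form \<open>char_kernel\<close>. Lengths are
  bounded because dual elements separate the members, making their reductions distinct elements of a
  finite set.\<close>

lemma maximal_characters:
  assumes fin: "finite (characters p G L)"
  obtains n h where "\<And>k. k < n \<Longrightarrow> additive_mod p G L (h k)" "jointly_surj p L h n"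
    "card (characters p G L) \<le> p ^ n" "char_kernel p G L = {l \<in> L. \<forall>k<n. int p dvd h k l}"
proof -
  have p1: "p > 1" using p prime_gt_1_nat by blast
  let ?P = "\<lambda>n. \<exists>h. (\<forall>k<n. additive_mod p G L (h k)) \<and> jointly_surj p L h n"
  let ?C = "characters p G L"
  have bound: "n \<le> card ?C" if P: "?P n" for n
  proof -
    obtain h where h: "\<And>k. k < n \<Longrightarrow> additive_mod p G L (h k)" "jointly_surj p L h n" using P by blast
    let ?h = "\<lambda>k. restrict (\<lambda>l. h k l mod int p) L"
    have "?h k \<in> ?C" if "k < n" for k
    proof -
      have "[h k (x \<otimes> y) mod int p = h k x mod int p + h k y mod int p] (mod int p)"
        if "x \<in> L" "y \<in> L" for x y
        using additive_modD[OF h(1)[OF \<open>k < n\<close>] that] by (simp add: cong_def mod_simps)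
      then show ?thesis using L p1
        by (auto simp: characters_def additive_mod_def subgroup.m_closed)
    qed
    moreover have "inj_on ?h {..<n}"
    proof (rule inj_onI, rule ccontr)
      fix i k assume ik: "i \<in> {..<n}" "k \<in> {..<n}" "?h i = ?h k" "i \<noteq> k"
      obtain l where l: "l \<in> L" "\<And>j. j < n \<Longrightarrow> [h j l = of_bool (j = i)] (mod int p)"
        using jointly_surjD[OF h(2), of "\<lambda>k. of_bool (k = i)"] by blast
      have "h i l mod int p = h k l mod int p" using fun_cong[OF ik(3), of l] l by simp
      then have "[of_bool (i = i) = of_bool (k = i)] (mod int p)"
        using l(2)[of i] l(2)[of k] ik by (simp add: cong_def)
      then show False using ik p1 by (simp add: cong_def)
    qed
    ultimately show ?thesis using card_inj_on_le[of ?h "{..<n}" ?C] fin by auto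
  qed
  define n where "n = (GREATEST n. ?P n)"
  have P0: "?P 0" using subgroup.one_closed[OF L] by (auto simp: jointly_surj_def)
  have Pn: "?P n" unfolding n_def by (rule GreatestI_nat[of ?P 0 "card ?C"]) (use P0 bound in auto)
  have notSuc: "\<not> ?P (Suc n)"
    using Greatest_le_nat[of ?P "Suc n" "card ?C"] bound unfolding n_def by auto
  obtain h where h: "\<And>k. k < n \<Longrightarrow> additive_mod p G L (h k)" "jointly_surj p L h n" using Pn by blast
  have max: "\<exists>b. \<forall>l\<in>L. [\<theta> l = (\<Sum>k<n. b k * h k l)] (mod int p)" if \<theta>: "additive_mod p G L \<theta>" for \<theta>
  proof (rule ccontr)
    assume *: "\<not> ?thesis"
    have "jointly_surj p L (h(n := \<theta>)) (Suc n)"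
    proof (rule jointly_surj_Suc)
      show "jointly_surj p L (h(n := \<theta>)) n" using h(2) by (rule jointly_surj_cong) auto
      show "\<not> (\<exists>b. \<forall>l\<in>L. [(h(n := \<theta>)) n l = (\<Sum>k<n. b k * (h(n := \<theta>)) k l)] (mod int p))"
      proof -
        have "(\<Sum>k<n. b k * (h(n := \<theta>)) k l) = (\<Sum>k<n. b k * h k l)" for b l
          by (intro sum.cong) auto
        then show ?thesis using * by (simp del: fun_upd_apply) simp
      qed
    qed (use h \<theta> in auto)
    moreover have "\<forall>k<Suc n. additive_mod p G L ((h(n := \<theta>)) k)" using h \<theta> by auto
    ultimately show False using notSuc by blast
  qed
  show ?thesis
  proof (rule that)
    show "card ?C \<le> p ^ n"
    proof (rule ccontr)
      assume "\<not> ?thesis"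
      then obtain \<theta> where "additive_mod p G L \<theta>" "jointly_surj p L (h(n := \<theta>)) (Suc n)"
        using jointly_surj_extend_one[OF fin h] by auto
      then show False using notSuc h by (metis (no_types, lifting) fun_upd_apply less_SucE)
    qed
    show "char_kernel p G L = {l \<in> L. \<forall>k<n. int p dvd h k l}"
    proof (intro equalityI subsetI)
      fix l assume l: "l \<in> {l \<in> L. \<forall>k<n. int p dvd h k l}"
      have "int p dvd \<theta> l" if \<theta>: "additive_mod p G L \<theta>" for \<theta>
      proof -
        obtain b where "[\<theta> l = (\<Sum>k<n. b k * h k l)] (mod int p)" using max[OF \<theta>] l by auto
        moreover have "int p dvd (\<Sum>k<n. b k * h k l)" using l by (intro dvd_sum dvd_mult) auto
        ultimately show ?thesis by (simp add: cong_dvd_iff)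
      qed
      then show "l \<in> char_kernel p G L" using l by (auto simp: char_kernel_def)
    qed (use h in \<open>auto simp: char_kernel_def\<close>)
  qed (use h in auto)
qed

end

end

section \<open>Cosets and subgroups of finite index\<close>

lemma rcosets_image: "rcosets\<^bsub>G\<^esub> H = (\<lambda>a. H #>\<^bsub>G\<^esub> a) ` carrier G"
  by (auto simp: RCOSETS_def)

lemma rcosets_restrict_image: "rcosets\<^bsub>G\<lparr>carrier := B\<rparr>\<^esub> H = (\<lambda>a. H #>\<^bsub>G\<^esub> a) ` B"
  by (auto simp: RCOSETS_def)

text \<open>The coset \<open>L\<close> itself is represented by the identity, which lets the
  extension of a character from \<open>L\<close> to \<open>G\<close> restrict to the character
  itself.\<close>

definition coset_rep :: "('g, 'n) monoid_scheme \<Rightarrow> 'g set \<Rightarrow> 'g set \<Rightarrow> 'g" where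
  "coset_rep G L X = (if X = L then \<one>\<^bsub>G\<^esub> else SOME g. g \<in> X)"

text \<open>These are the integrals, normalised at the identity, of cocycles on the Schreier graph
  of \<open>L\<close>: their differences along edges of the Cayley graph are invariant under
  \<open>L\<close> modulo \<open>p\<close>. On \<open>L\<close> they are characters.\<close>

definition quasi_additive :: "nat \<Rightarrow> ('g, 'n) monoid_scheme \<Rightarrow> 'g set \<Rightarrow> ('g \<Rightarrow> int) \<Rightarrow> bool" where
  "quasi_additive p G L h \<longleftrightarrow>
     (\<forall>l\<in>L. \<forall>x\<in>carrier G. [h (l \<otimes>\<^bsub>G\<^esub> x) = h l + h x] (mod int p))"

text \<open>A character determines such an integral up to a coboundary of the Schreier graph, and
  \<open>\<beta>\<close> supplies the coboundary by prescribing the values at the coset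
  representatives.\<close>

definition coset_extension ::
    "('g, 'n) monoid_scheme \<Rightarrow> 'g set \<Rightarrow> ('g \<Rightarrow> int) \<Rightarrow> ('g set \<Rightarrow> int) \<Rightarrow> 'g \<Rightarrow> int" where
  "coset_extension G L \<theta> \<beta> g =
     \<theta> (g \<otimes>\<^bsub>G\<^esub> inv\<^bsub>G\<^esub> (coset_rep G L (L #>\<^bsub>G\<^esub> g))) + \<beta> (L #>\<^bsub>G\<^esub> g)"

lemma quasi_additiveD:
  "quasi_additive p G L h \<Longrightarrow> l \<in> L \<Longrightarrow> x \<in> carrier G \<Longrightarrow> [h (l \<otimes>\<^bsub>G\<^esub> x) = h l + h x] (mod int p)"
  by (simp add: quasi_additive_def)

lemma quasi_additive_imp_additive:
  "quasi_additive p G L h \<Longrightarrow> L \<subseteq> carrier G \<Longrightarrow> additive_mod p G L h"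
  by (auto simp: quasi_additive_def additive_mod_def)

context group begin

lemma coset_eq_iff:
  assumes "subgroup L G" "x \<in> carrier G" "y \<in> carrier G"
  shows "L #> x = L #> y \<longleftrightarrow> x \<otimes> inv y \<in> L"
proof -
  have "x \<in> L #> y \<longleftrightarrow> x \<otimes> inv y \<in> L"
    using subgroup.rcos_module[OF assms(1) is_group assms(3,2)] by simp
  moreover have "L #> x = L #> y \<longleftrightarrow> x \<in> L #> y"
    using repr_independence[OF _ assms(3,1)] rcos_self[OF assms(2,1)] by metis
  ultimately show ?thesis by simp
qed

lemma coset_mult_left: "subgroup L G \<Longrightarrow> l \<in> L \<Longrightarrow> x \<in> carrier G \<Longrightarrow> L #> (l \<otimes> x) = L #> x"
  by (simp add: coset_eq_iff subgroup.mem_carrier m_assoc)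

lemma coset_mult_right:
  assumes "subgroup L G" "x \<in> carrier G" "y \<in> carrier G" "z \<in> carrier G" "L #> x = L #> y"
  shows "L #> (x \<otimes> z) = L #> (y \<otimes> z)"
proof -
  have "x \<otimes> z \<otimes> inv (y \<otimes> z) = x \<otimes> inv y"
    using assms(2-4) by (simp add: inv_mult_group m_assoc) (simp flip: m_assoc)
  then show ?thesis using assms by (simp add: coset_eq_iff)
qed

lemma coset_in_rcosets: "x \<in> carrier G \<Longrightarrow> L #> x \<in> rcosets L"
  by (auto simp: rcosets_image)

lemma coset_one: "subgroup L G \<Longrightarrow> L #> \<one> = L"
  by (simp add: coset_mult_one subgroup.subset)

lemma coset_self: "subgroup L G \<Longrightarrow> l \<in> L \<Longrightarrow> L #> l = L"
  using coset_mult_left[of L l \<one>] coset_one by (simp add: subgroup.mem_carrier)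

lemma subgroup_in_rcosets': "subgroup L G \<Longrightarrow> L \<in> rcosets L"
  using coset_in_rcosets[OF one_closed, of L] coset_one by simp

lemma coset_rep:
  assumes L: "subgroup L G" and X: "X \<in> rcosets L"
  shows "coset_rep G L X \<in> carrier G" "L #> coset_rep G L X = X"
proof -
  obtain a where a: "a \<in> carrier G" "X = L #> a" using X by (auto simp: rcosets_image)
  have "coset_rep G L X \<in> carrier G \<and> L #> coset_rep G L X = X"
  proof (cases "X = L")
    case True
    then show ?thesis using coset_one[OF L] by (simp add: coset_rep_def)
  next
    case False
    have "(SOME g. g \<in> X) \<in> X" using rcos_self[OF a(1) L] a(2) by (metis someI)
    then have "coset_rep G L X \<in> L #> a" using False a by (simp add: coset_rep_def)
    then show ?thesis using repr_independence[OF _ a(1) L] a r_coset_subset_G[OF subgroup.subset[OF L] a(1)] by auto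
  qed
  then show "coset_rep G L X \<in> carrier G" "L #> coset_rep G L X = X" by auto
qed

lemma coset_rep_self: "coset_rep G L L = \<one>" by (simp add: coset_rep_def)

lemma coset_decomp:
  assumes L: "subgroup L G" and g: "g \<in> carrier G"
  shows "g \<otimes> inv (coset_rep G L (L #> g)) \<in> L"
    "g \<otimes> inv (coset_rep G L (L #> g)) \<otimes> coset_rep G L (L #> g) = g"
  using coset_rep[OF L coset_in_rcosets[OF g]] coset_eq_iff[OF L g, of "coset_rep G L (L #> g)"] g
  by (auto simp: m_assoc)

lemma finite_rcosets_if_fibres:
  assumes A: "subgroup A G" and T: "finite T" "f ` carrier G \<subseteq> T"
    and f: "\<And>x y. x \<in> carrier G \<Longrightarrow> y \<in> carrier G \<Longrightarrow> f x = f y \<Longrightarrow> x \<otimes> inv y \<in> A"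
  shows "finite (rcosets A)"
proof -
  let ?h = "\<lambda>X. f (coset_rep G A X)"
  have "inj_on ?h (rcosets A)"
  proof (rule inj_onI)
    fix X Y assume X: "X \<in> rcosets A" and Y: "Y \<in> rcosets A" and eq: "?h X = ?h Y"
    have "A #> coset_rep G A X = A #> coset_rep G A Y"
      unfolding coset_eq_iff[OF A coset_rep(1)[OF A X] coset_rep(1)[OF A Y]]
      by (rule f[OF coset_rep(1)[OF A X] coset_rep(1)[OF A Y] eq])
    then show "X = Y" using coset_rep(2)[OF A X] coset_rep(2)[OF A Y] by simp
  qed
  moreover have "?h ` (rcosets A) \<subseteq> T" using T coset_rep[OF A] by auto
  ultimately show ?thesis using T(1) by (metis finite_imageD finite_subset)
qed

context
  fixes A B assumes A: "subgroup A G" and B: "subgroup B G" and AB: "A \<subseteq> B"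
begin

lemma finite_rcosets_intermediate: "finite (rcosets A) \<Longrightarrow> finite (rcosets\<^bsub>G\<lparr>carrier := B\<rparr>\<^esub> A)"
proof (erule finite_subset[rotated])
  show "rcosets\<^bsub>G\<lparr>carrier := B\<rparr>\<^esub> A \<subseteq> rcosets A"
    using subgroup.subset[OF B] by (auto simp: rcosets_restrict_image rcosets_image[of G])
qed

text \<open>A coset of \<open>A\<close> is \<open>A b x\<close> with \<open>x\<close> the
  representative of a coset of \<open>B\<close> and \<open>b\<close> in \<open>B\<close>; passing to
  cosets of \<open>B\<close> recovers \<open>x\<close>, and then \<open>b\<close> up to
  \<open>A\<close>.\<close>

lemma bij_betw_rcosets:
  "bij_betw (\<lambda>(X, Y). Y #> coset_rep G B X) ((rcosets B) \<times> (rcosets\<^bsub>G\<lparr>carrier := B\<rparr>\<^esub> A)) (rcosets A)"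
    (is "bij_betw ?f ?D _")
proof -
  have BG: "b \<in> carrier G" if "b \<in> B" for b using that B by (rule subgroup.mem_carrier[rotated])
  have val: "?f (X, A #> b) = A #> (b \<otimes> coset_rep G B X)" if "X \<in> rcosets B" "b \<in> B" for X b
    using that coset_rep[OF B] BG subgroup.subset[OF A] by (simp add: coset_mult_assoc)
  show ?thesis unfolding bij_betw_def
  proof
    show "inj_on ?f ?D"
    proof (rule inj_onI, clarify)
      fix X Y X' Y' assume XY: "X \<in> rcosets B" "Y \<in> rcosets\<^bsub>G\<lparr>carrier := B\<rparr>\<^esub> A"
        "X' \<in> rcosets B" "Y' \<in> rcosets\<^bsub>G\<lparr>carrier := B\<rparr>\<^esub> A"
        and eq: "Y #> coset_rep G B X = Y' #> coset_rep G B X'"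
      obtain b b' where b: "b \<in> B" "Y = A #> b" "b' \<in> B" "Y' = A #> b'"
        using XY by (auto simp: rcosets_restrict_image)
      let ?x = "coset_rep G B X" and ?x' = "coset_rep G B X'"
      have x: "?x \<in> carrier G" "?x' \<in> carrier G" using XY coset_rep[OF B] by auto
      have "A #> (b \<otimes> ?x) = A #> (b' \<otimes> ?x')" using eq val XY b by simp
      then have in_A: "b \<otimes> ?x \<otimes> inv (b' \<otimes> ?x') \<in> A" using x b BG coset_eq_iff[OF A] by simp
      then have "B #> (b \<otimes> ?x) = B #> (b' \<otimes> ?x')" using x b BG AB coset_eq_iff[OF B] by auto
      then have "B #> ?x = B #> ?x'" using coset_mult_left[OF B] b x by simp
      then have X: "X = X'" using coset_rep[OF B] XY by simp
      have "b \<otimes> ?x \<otimes> inv (b' \<otimes> ?x) = b \<otimes> inv b'"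
        using x b BG by (simp add: inv_mult_group m_assoc) (simp flip: m_assoc)
      then have "A #> b = A #> b'" using in_A X b BG coset_eq_iff[OF A] by simp
      then show "X = X' \<and> Y = Y'" using X b by simp
    qed
    show "?f ` ?D = rcosets A"
    proof (intro equalityI subsetI)
      fix Z assume "Z \<in> ?f ` ?D"
      then obtain X b where "X \<in> rcosets B" "b \<in> B" "Z = ?f (X, A #> b)"
        by (auto simp: rcosets_restrict_image)
      then show "Z \<in> rcosets A" using val coset_rep[OF B] BG by (auto intro!: coset_in_rcosets)
    next
      fix Z assume "Z \<in> rcosets A"
      then obtain g where g: "g \<in> carrier G" "Z = A #> g" by (auto simp: rcosets_image)
      let ?b = "g \<otimes> inv coset_rep G B (B #> g)"
      have "Z = ?f (B #> g, A #> ?b)"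
        using val[OF coset_in_rcosets[OF g(1)] coset_decomp(1)[OF B g(1)]] coset_decomp[OF B g(1)] g by simp
      moreover have "(B #> g, A #> ?b) \<in> ?D"
        using coset_decomp(1)[OF B g(1)] coset_in_rcosets[OF g(1)] by (auto simp: rcosets_restrict_image)
      ultimately show "Z \<in> ?f ` ?D" by (rule image_eqI)
    qed
  qed
qed

lemma index_mult: "card (rcosets A) = card (rcosets B) * card (rcosets\<^bsub>G\<lparr>carrier := B\<rparr>\<^esub> A)"
  using bij_betw_same_card[OF bij_betw_rcosets] by (simp add: card_cartesian_product)

lemma finite_rcosets_trans:
  "finite (rcosets B) \<Longrightarrow> finite (rcosets\<^bsub>G\<lparr>carrier := B\<rparr>\<^esub> A) \<Longrightarrow> finite (rcosets A)"
  using bij_betw_finite[OF bij_betw_rcosets] by simp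

end

lemma finite_rcosets_Int:
  assumes A: "subgroup A G" and B: "subgroup B G" and "finite (rcosets A)" "finite (rcosets B)"
  shows "finite (rcosets (A \<inter> B))"
  by (rule finite_rcosets_if_fibres[OF subgroups_Inter_pair[OF A B], where f = "\<lambda>x. (A #> x, B #> x)"
        and T = "(rcosets A) \<times> (rcosets B)"])
    (use assms in \<open>auto simp: coset_eq_iff intro: coset_in_rcosets\<close>)

text \<open>The subgroup is the kernel of the action on the right cosets of \<open>H\<close>, so its
  cosets are separated by the induced self-maps of a finite set.\<close>

lemma finite_index_core:
  assumes H: "subgroup H G" and fin: "finite (rcosets H)"
  obtains N where "N \<lhd> G" "N \<subseteq> H" "finite (rcosets N)"
proof
  let ?N = "{g \<in> carrier G. \<forall>x\<in>carrier G. x \<otimes> g \<otimes> inv x \<in> H}"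
  have "subgroup ?N G"
  proof (rule subgroupI)
    show "?N \<noteq> {}" using subgroup.one_closed[OF H] by auto
    fix a assume a: "a \<in> ?N"
    have "x \<otimes> inv a \<otimes> inv x = inv (x \<otimes> a \<otimes> inv x)" if "x \<in> carrier G" for x
      using a that by (simp add: inv_mult_group m_assoc)
    then show "inv a \<in> ?N" using a subgroup.m_inv_closed[OF H] by auto
    fix b assume b: "b \<in> ?N"
    have "x \<otimes> (a \<otimes> b) \<otimes> inv x = (x \<otimes> a \<otimes> inv x) \<otimes> (x \<otimes> b \<otimes> inv x)" if "x \<in> carrier G" for x
    proof -
      have "inv x \<otimes> (x \<otimes> (b \<otimes> inv x)) = b \<otimes> inv x" using a b that by (simp flip: m_assoc)
      then show ?thesis using a b that by (simp add: m_assoc)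
    qed
    then show "a \<otimes> b \<in> ?N" using a b subgroup.m_closed[OF H] by auto
  qed auto
  then show N: "?N \<lhd> G"
  proof (rule normal_invI)
    fix x g assume x: "x \<in> carrier G" and g: "g \<in> ?N"
    have "y \<otimes> (x \<otimes> g \<otimes> inv x) \<otimes> inv y = (y \<otimes> x) \<otimes> g \<otimes> inv (y \<otimes> x)" if "y \<in> carrier G" for y
      using x g that by (simp add: inv_mult_group m_assoc)
    then show "x \<otimes> g \<otimes> inv x \<in> ?N" using x g by auto
  qed
  show "?N \<subseteq> H"
  proof
    fix g assume "g \<in> ?N"
    then have "\<one> \<otimes> g \<otimes> inv \<one> \<in> H" "g \<in> carrier G" by blast+
    then show "g \<in> H" by simp
  qed
  show "finite (rcosets ?N)"
  proof (rule finite_rcosets_if_fibres[OF normal_imp_subgroup[OF N],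
        where f = "\<lambda>g. restrict (\<lambda>X. X #> g) (rcosets H)" and T = "(rcosets H) \<rightarrow>\<^sub>E (rcosets H)"])
    show "finite ((rcosets H) \<rightarrow>\<^sub>E (rcosets H))" using fin by (intro finite_PiE)
    have mult: "(H #> x) #> g = H #> (x \<otimes> g)" if "x \<in> carrier G" "g \<in> carrier G" for x g
      using that subgroup.subset[OF H] by (simp add: coset_mult_assoc)
    then show "(\<lambda>g. restrict (\<lambda>X. X #> g) (rcosets H)) ` carrier G \<subseteq> (rcosets H) \<rightarrow>\<^sub>E (rcosets H)"
      by (auto simp: rcosets_image)
    fix a b assume a: "a \<in> carrier G" and b: "b \<in> carrier G"
      and eq: "restrict (\<lambda>X. X #> a) (rcosets H) = restrict (\<lambda>X. X #> b) (rcosets H)"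
    have "x \<otimes> (a \<otimes> inv b) \<otimes> inv x \<in> H" if x: "x \<in> carrier G" for x
    proof -
      have "H #> (x \<otimes> a) = H #> (x \<otimes> b)"
        using fun_cong[OF eq, of "H #> x"] coset_in_rcosets[OF x] mult x a b by simp
      then have "x \<otimes> a \<otimes> inv (x \<otimes> b) \<in> H" using x a b coset_eq_iff[OF H] by simp
      then show ?thesis using x a b by (simp add: inv_mult_group m_assoc)
    qed
    then show "a \<otimes> inv b \<in> ?N" using a b by simp
  qed
qed

text \<open>Every subgroup of finite index contains a normal one of finite index, so the
  intersection is stable under conjugation.\<close>

lemma finite_residual_normal: "finite_residual G \<lhd> G"
proof (rule normal_invI)
  have self: "finite_index_subgroup (carrier G) G"
    unfolding finite_index_subgroup_def
    using finite_rcosets_if_fibres[OF subgroup_self, of UNIV "\<lambda>_. ()"] subgroup_self by auto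
  show "subgroup (finite_residual G) G" unfolding finite_residual_def
    using self by (intro subgroups_Inter) (auto simp: finite_index_subgroup_def)
  fix x h assume x: "x \<in> carrier G" and h: "h \<in> finite_residual G"
  have "x \<otimes> h \<otimes> inv x \<in> H" if H: "finite_index_subgroup H G" for H
  proof -
    obtain N where N: "N \<lhd> G" "N \<subseteq> H" "finite (rcosets N)"
      using H finite_index_core unfolding finite_index_subgroup_def by blast
    then have "h \<in> N" using h by (auto simp: finite_residual_def finite_index_subgroup_def normal_imp_subgroup)
    then show ?thesis using normal.inv_op_closed2[OF N(1) x] N by auto
  qed
  then show "x \<otimes> h \<otimes> inv x \<in> finite_residual G" by (auto simp: finite_residual_def)
qed

text \<open>Schreier generators: the product of a representative, a generator and an inverse
  representative lies in \<open>H\<close> exactly when the last representative belongs to the coset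
  that is reached.\<close>

lemma finite_index_finitely_generated:
  assumes H: "subgroup H G" "finite (rcosets H)" and T: "finite T" "generate G T = carrier G"
  shows "\<exists>U. finite U \<and> U \<subseteq> H \<and> generate G U = H"
proof -
  have TG: "T \<subseteq> carrier G" using generate.incl[of _ T G] T(2) by auto
  let ?r = "coset_rep G H"
  let ?U = "((\<lambda>(X, t, Y). ?r X \<otimes> t \<otimes> inv ?r Y) ` ((rcosets H) \<times> T \<times> (rcosets H))) \<inter> H"
  have "finite ?U" using H T by auto
  moreover have "generate G ?U = H"
  proof
    show "generate G ?U \<subseteq> H" using H by (intro generate_subgroup_incl) auto
    have UG: "?U \<subseteq> carrier G" using subgroup.subset[OF H(1)] by auto
    have gen_U: "subgroup (generate G ?U) G" using UG by (rule generate_is_subgroup)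
    \<comment> \<open>The generated subgroup times the transversal. It contains the identity and is
      closed under right multiplication by \<open>T\<close> and inverses, hence is all of
      \<open>G\<close>; its elements in \<open>H\<close> carry the trivial representative.\<close>
    define M where "M = {u \<otimes> ?r X | u X. u \<in> generate G ?U \<and> X \<in> rcosets H}"
    have r: "?r X \<in> carrier G" "H #> ?r X = X" if "X \<in> rcosets H" for X
      using coset_rep[OF H(1) that] by auto
    have uG: "u \<in> carrier G" if "u \<in> generate G ?U" for u using that gen_U by (rule subgroup.mem_carrier[rotated])
    have MG: "m \<in> carrier G" if "m \<in> M" for m using that uG r by (auto simp: M_def)
    have U: "?r X \<otimes> t \<otimes> inv ?r Y \<in> generate G ?U"
      if "X \<in> rcosets H" "t \<in> T" "Y = H #> (?r X \<otimes> t)" for X Y t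
    proof -
      have "?r X \<otimes> t \<in> carrier G" using that r TG by auto
      then have "?r X \<otimes> t \<otimes> inv ?r Y \<in> H" "Y \<in> rcosets H"
        using coset_decomp(1)[OF H(1)] coset_in_rcosets that(3) by auto
      then have "?r X \<otimes> t \<otimes> inv ?r Y \<in> ?U"
        using that by (intro IntI image_eqI[of _ _ "(X, t, Y)"]) auto
      then show ?thesis by (rule generate.incl)
    qed
    have M_closed: "m \<otimes> g \<in> M" if "g \<in> generate G T" "m \<in> M" for g m
      using that
    proof (induction arbitrary: m rule: generate.induct)
      case one
      then show ?case using MG by simp
    next
      case (incl t)
      then obtain u X where m: "m = u \<otimes> ?r X" "u \<in> generate G ?U" "X \<in> rcosets H" by (auto simp: M_def)
      let ?Y = "H #> (?r X \<otimes> t)"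
      have t: "t \<in> carrier G" using incl TG by auto
      have Y: "?Y \<in> rcosets H" using r m t by (intro coset_in_rcosets) auto
      have "m \<otimes> t = (u \<otimes> (?r X \<otimes> t \<otimes> inv ?r ?Y)) \<otimes> ?r ?Y"
        using m t r[OF m(3)] r[OF Y] uG by (simp add: m_assoc)
      moreover have "u \<otimes> (?r X \<otimes> t \<otimes> inv ?r ?Y) \<in> generate G ?U"
        using m U[OF m(3) incl(1)] subgroup.m_closed[OF gen_U] by blast
      ultimately show ?case using Y by (auto simp: M_def)
    next
      case (inv t)
      then obtain u X where m: "m = u \<otimes> ?r X" "u \<in> generate G ?U" "X \<in> rcosets H" by (auto simp: M_def)
      let ?Y = "H #> (?r X \<otimes> inv t)"
      have t: "t \<in> carrier G" using inv TG by auto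
      have Y: "?Y \<in> rcosets H" using r m t by (intro coset_in_rcosets) auto
      have X: "X = H #> (?r ?Y \<otimes> t)"
        using coset_mult_right[OF H(1) r(1)[OF Y] _ t r(2)[OF Y]] r[OF m(3)] t by (simp add: m_assoc)
      have "inv (?r ?Y \<otimes> t \<otimes> inv ?r X) = ?r X \<otimes> inv t \<otimes> inv ?r ?Y"
        using t r[OF m(3)] r[OF Y] by (simp add: inv_mult_group m_assoc)
      then have *: "?r X \<otimes> inv t \<otimes> inv ?r ?Y \<in> generate G ?U"
        using U[OF Y inv(1) X] subgroup.m_inv_closed[OF gen_U] by metis
      have "m \<otimes> inv t = (u \<otimes> (?r X \<otimes> inv t \<otimes> inv ?r ?Y)) \<otimes> ?r ?Y"
        using m t r[OF m(3)] r[OF Y] uG by (simp add: m_assoc)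
      moreover have "u \<otimes> (?r X \<otimes> inv t \<otimes> inv ?r ?Y) \<in> generate G ?U"
        using m * subgroup.m_closed[OF gen_U] by blast
      ultimately show ?case using Y by (auto simp: M_def)
    next
      case (eng h1 h2)
      have "h1 \<in> carrier G" "h2 \<in> carrier G" "m \<in> carrier G"
        using eng generate_in_carrier[OF TG] uG r by (auto simp: M_def)
      then show ?case using eng by (simp flip: m_assoc)
    qed
    show "H \<subseteq> generate G ?U"
    proof
      fix g assume g: "g \<in> H"
      then have gG: "g \<in> carrier G" using H(1) by (rule subgroup.mem_carrier[rotated])
      have "\<one> \<otimes> ?r H \<in> M" unfolding M_def
        using subgroup_in_rcosets'[OF H(1)] generate.one[of G ?U] by blast
      then have "\<one> \<in> M" by (simp add: coset_rep_self)
      then have "g \<in> M" using M_closed[of g \<one>] T gG by simp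
      then obtain u X where u: "g = u \<otimes> ?r X" "u \<in> generate G ?U" "X \<in> rcosets H" by (auto simp: M_def)
      have "u \<in> H" using u(2) \<open>generate G ?U \<subseteq> H\<close> by blast
      have "X = H #> ?r X" using r u by simp
      also have "\<dots> = H #> (u \<otimes> ?r X)" using coset_mult_left[OF H(1) \<open>u \<in> H\<close>] r u by simp
      also have "\<dots> = H" using u(1) coset_self[OF H(1) g] by simp
      finally have "g = u" using u uG by (simp add: coset_rep_self)
      then show "g \<in> generate G ?U" using u by simp
    qed
  qed
  ultimately show ?thesis by blast
qed

section \<open>Counting characters\<close>

lemma coset_extension_quasi:
  assumes L: "subgroup L G" and \<theta>: "additive_mod p G L \<theta>" and \<beta>: "\<beta> L = 0"
  shows "quasi_additive p G L (coset_extension G L \<theta> \<beta>)"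
  unfolding quasi_additive_def
proof (intro ballI)
  fix l x assume l: "l \<in> L" and x: "x \<in> carrier G"
  have lG: "l \<in> carrier G" using l L by (rule subgroup.mem_carrier[rotated])
  have "coset_extension G L \<theta> \<beta> l = \<theta> l"
    using coset_self[OF L l] \<beta> lG by (simp add: coset_extension_def coset_rep_self)
  moreover have "[\<theta> (l \<otimes> (x \<otimes> inv coset_rep G L (L #> x))) = \<theta> l + \<theta> (x \<otimes> inv coset_rep G L (L #> x))] (mod int p)"
    using additive_modD[OF \<theta> l coset_decomp(1)[OF L x]] .
  ultimately show "[coset_extension G L \<theta> \<beta> (l \<otimes> x) = coset_extension G L \<theta> \<beta> l + coset_extension G L \<theta> \<beta> x] (mod int p)"
    using l x lG coset_rep[OF L coset_in_rcosets[OF x]] coset_mult_left[OF L l x]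
    by (simp add: coset_extension_def m_assoc add.assoc[symmetric] cong_add_rcancel)
qed

lemma coset_extension_rep:
  assumes L: "subgroup L G" and X: "X \<in> rcosets L" and l: "l \<in> L"
  shows "coset_extension G L \<theta> \<beta> (l \<otimes> coset_rep G L X) = \<theta> l + \<beta> X"
proof -
  have r: "coset_rep G L X \<in> carrier G" "L #> coset_rep G L X = X" using coset_rep[OF L X] by auto
  have "l \<in> carrier G" using l L by (rule subgroup.mem_carrier[rotated])
  then show ?thesis using r coset_mult_left[OF L l r(1)] by (simp add: coset_extension_def m_assoc)
qed

lemma coset_extension_self:
  assumes L: "subgroup L G" and l: "l \<in> L" and \<beta>: "\<beta> L = 0"
  shows "coset_extension G L \<theta> \<beta> l = \<theta> l"
  using coset_extension_rep[OF L subgroup_in_rcosets'[OF L] l, of \<theta> \<beta>] \<beta> subgroup.mem_carrier[OF L l]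
  by (simp add: coset_rep_self)

lemma cong_zero_induct:
  assumes T: "generate G T = carrier G" and one: "int p dvd D \<one>"
    and step: "\<And>g t. g \<in> carrier G \<Longrightarrow> t \<in> T \<Longrightarrow> [D (g \<otimes> t) = D g] (mod int p)"
    and g: "g \<in> carrier G"
  shows "int p dvd D g"
proof -
  have TG: "T \<subseteq> carrier G" using generate.incl[of _ T G] T by auto
  have "[D (x \<otimes> h) = D x] (mod int p)" if "h \<in> generate G T" "x \<in> carrier G" for h x
    using that
  proof (induction arbitrary: x rule: generate.induct)
    case (inv t)
    then have "t \<in> carrier G" using TG by auto
    then have "[D x = D (x \<otimes> inv t)] (mod int p)"
      using step[of "x \<otimes> inv t" t] inv by (simp add: m_assoc)
    then show ?case by (rule cong_sym)
  next
    case (eng h1 h2)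
    have h: "h1 \<in> carrier G" "h2 \<in> carrier G" using eng generate_in_carrier[OF TG] by auto
    have "[D (x \<otimes> h1 \<otimes> h2) = D (x \<otimes> h1)] (mod int p)" using eng h by simp
    also have "[D (x \<otimes> h1) = D x] (mod int p)" using eng h by simp
    finally show ?case using h eng by (simp add: m_assoc)
  qed (use step in auto)
  from this[of g \<one>] show ?thesis using g T one by (simp add: cong_dvd_iff)
qed

lemma PiE_mod_eqI:
  assumes "a \<in> A \<rightarrow>\<^sub>E {0..<int p}" "b \<in> A \<rightarrow>\<^sub>E {0..<int p}"
    and "\<And>x. x \<in> A \<Longrightarrow> [a x = b x] (mod int p)"
  shows "a = b"
proof (rule PiE_ext[OF assms(1,2)])
  fix x assume x: "x \<in> A"
  have "a x \<in> {0..<int p}" "b x \<in> {0..<int p}" using assms(1,2) x by (auto simp: PiE_iff)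
  then show "a x = b x" using assms(3)[OF x] by (simp add: cong_def)
qed

text \<open>Schreier's bound in counting form, for index \<open>q\<close>: a character of
  \<open>L\<close> and free values at the \<open>q - 1\<close> nontrivial representatives give a
  function on \<open>G\<close> that is determined by its \<open>q * card T\<close> edge differences
  at the representatives. In logarithms, \<open>L\<close> has at most
  \<open>q * (card T - 1) + 1\<close> independent characters.\<close>

theorem card_characters_upper:
  assumes T: "finite T" "generate G T = carrier G" and L: "subgroup L G" and fin: "finite (rcosets L)"
    and p: "p > 0"
  shows "finite (characters p G L)"
    "card (characters p G L) * p ^ (card (rcosets L) - 1) \<le> p ^ (card (rcosets L) * card T)"
proof -
  have TG: "T \<subseteq> carrier G" using generate.incl[of _ T G] T by auto
  let ?q = "card (rcosets L)"
  let ?B = "(rcosets L - {L}) \<rightarrow>\<^sub>E {0..<int p}" and ?E = "((rcosets L) \<times> T) \<rightarrow>\<^sub>E {0..<int p}"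
  let ?r = "coset_rep G L"
  define ext where "ext = (\<lambda>(\<theta>, \<beta>). coset_extension G L \<theta> (\<beta>(L := 0)))"
  define \<Omega> where "\<Omega> y = restrict (\<lambda>(X, t). (ext y (?r X \<otimes> t) - ext y (?r X)) mod int p) ((rcosets L) \<times> T)" for y
  have quasi: "quasi_additive p G L (ext y)" if "y \<in> characters p G L \<times> ?B" for y
    using that by (auto simp: ext_def characters_def intro!: coset_extension_quasi[OF L])
  have inj: "inj_on \<Omega> (characters p G L \<times> ?B)"
  proof (rule inj_onI)
    fix y z assume y: "y \<in> characters p G L \<times> ?B" and z: "z \<in> characters p G L \<times> ?B" and eq: "\<Omega> y = \<Omega> z"
    \<comment> \<open>Equal labels at the representatives give equal labels everywhere, since any
      edge is an \<open>L\<close>-translate of one that starts at a representative.\<close>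
    have diff: "[ext y (g \<otimes> t) - ext y g = ext z (g \<otimes> t) - ext z g] (mod int p)"
      if g: "g \<in> carrier G" and t: "t \<in> T" for g t
    proof -
      let ?X = "L #> g"
      define l where "l = g \<otimes> inv ?r ?X"
      have X: "?X \<in> rcosets L" using g by (rule coset_in_rcosets)
      have l: "l \<in> L" "g = l \<otimes> ?r ?X" using coset_decomp[OF L g] by (simp_all add: l_def)
      have r: "?r ?X \<in> carrier G" using coset_rep[OF L X] by simp
      have tG: "t \<in> carrier G" using t TG by auto
      have lG: "l \<in> carrier G" using l(1) L by (rule subgroup.mem_carrier[rotated])
      have *: "[ext y' (g \<otimes> t) - ext y' g = ext y' (?r ?X \<otimes> t) - ext y' (?r ?X)] (mod int p)"
        if "y' \<in> characters p G L \<times> ?B" for y'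
      proof -
        have "[ext y' (l \<otimes> (?r ?X \<otimes> t)) - ext y' (l \<otimes> ?r ?X) =
          (ext y' l + ext y' (?r ?X \<otimes> t)) - (ext y' l + ext y' (?r ?X))] (mod int p)"
          using l(1) r tG by (intro cong_diff quasi_additiveD[OF quasi[OF that]]) auto
        moreover have "g \<otimes> t = l \<otimes> (?r ?X \<otimes> t)" using l(2) lG r tG m_assoc by metis
        ultimately show ?thesis using l(2) by simp
      qed
      have "[ext y (?r ?X \<otimes> t) - ext y (?r ?X) = ext z (?r ?X \<otimes> t) - ext z (?r ?X)] (mod int p)"
        using fun_cong[OF eq, of "(?X, t)"] X t by (simp add: \<Omega>_def cong_def)
      then show ?thesis using *[OF y] *[OF z] cong_trans cong_sym by blast
    qed
    have one: "int p dvd ext y' \<one>" if "y' \<in> characters p G L \<times> ?B" for y'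
      using additive_mod_one[OF L quasi_additive_imp_additive[OF quasi[OF that] subgroup.subset[OF L]]] .
    have dvd: "int p dvd ext y g - ext z g" if "g \<in> carrier G" for g
    proof (rule cong_zero_induct[OF T(2) _ _ that])
      show "int p dvd ext y \<one> - ext z \<one>" using one y z by (intro dvd_diff)
      fix g t assume "g \<in> carrier G" "t \<in> T"
      then have "int p dvd (ext y (g \<otimes> t) - ext y g) - (ext z (g \<otimes> t) - ext z g)"
        using diff by (simp add: cong_iff_dvd_diff)
      then show "[ext y (g \<otimes> t) - ext z (g \<otimes> t) = ext y g - ext z g] (mod int p)"
        by (simp add: cong_iff_dvd_diff algebra_simps)
    qed
    have yz: "fst y \<in> L \<rightarrow>\<^sub>E {0..<int p}" "fst z \<in> L \<rightarrow>\<^sub>E {0..<int p}" "snd y \<in> ?B" "snd z \<in> ?B"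
      using y z by (simp_all add: characters_def mem_Times_iff)
    have "fst y = fst z"
    proof (rule PiE_mod_eqI[OF yz(1,2)])
      fix l assume l: "l \<in> L"
      then have "int p dvd ext y l - ext z l" using dvd subgroup.mem_carrier[OF L] by blast
      then show "[fst y l = fst z l] (mod int p)"
        using coset_extension_self[OF L l] by (simp add: ext_def split_beta cong_iff_dvd_diff)
    qed
    moreover have "snd y = snd z"
    proof (rule PiE_mod_eqI[OF yz(3,4)])
      fix X assume X: "X \<in> rcosets L - {L}"
      then have "int p dvd ext y (?r X) - ext z (?r X)" using dvd coset_rep[OF L] by blast
      moreover have "ext y' (?r X) = fst y' \<one> + snd y' X" for y'
        using coset_extension_rep[OF L _ subgroup.one_closed[OF L], of X] X coset_rep[OF L, of X]
        by (simp add: ext_def split_beta)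
      ultimately show "[snd y X = snd z X] (mod int p)"
        using \<open>fst y = fst z\<close> by (simp add: cong_iff_dvd_diff)
    qed
    ultimately show "y = z" by (simp add: prod_eq_iff)
  qed
  have sub: "\<Omega> ` (characters p G L \<times> ?B) \<subseteq> ?E"
    by (rule image_subsetI) (simp add: \<Omega>_def p split_beta)
  have finE: "finite ?E" using fin T by (intro finite_PiE) auto
  have prod: "finite (characters p G L \<times> ?B)" by (rule inj_on_finite[OF inj sub finE])
  have "?B \<noteq> {}" using p by (auto simp: PiE_eq_empty_iff)
  then show "finite (characters p G L)" using finite_cartesian_productD1[OF prod] by blast
  have "card (characters p G L \<times> ?B) \<le> card ?E" using inj sub finE by (rule card_inj_on_le)
  then show "card (characters p G L) * p ^ (?q - 1) \<le> p ^ (?q * card T)"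
    using fin T subgroup_in_rcosets'[OF L] by (simp add: card_cartesian_product card_PiE)
qed

section \<open>The common kernel of the characters modulo p\<close>

lemma char_kernel_subset: "char_kernel p G L \<subseteq> L"
  by (auto simp: char_kernel_def)

lemma char_kernel_subgroup:
  assumes L: "subgroup L G" shows "subgroup (char_kernel p G L) G"
proof (rule subgroupI)
  show "char_kernel p G L \<subseteq> carrier G" using subgroup.subset[OF L] char_kernel_subset by blast
  show "char_kernel p G L \<noteq> {}"
    using subgroup.one_closed[OF L] additive_mod_one[OF L] by (auto simp: char_kernel_def)
  fix a assume a: "a \<in> char_kernel p G L"
  then have aL: "a \<in> L" by (simp add: char_kernel_def)
  show "inv a \<in> char_kernel p G L"
    using a subgroup.m_inv_closed[OF L aL] cong_dvd_iff[OF additive_mod_inv[OF L _ aL]]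
    by (simp add: char_kernel_def)
  fix b assume "b \<in> char_kernel p G L"
  with a show "a \<otimes> b \<in> char_kernel p G L"
    using subgroup.m_closed[OF L] by (auto simp: char_kernel_def cong_dvd_iff[OF additive_modD])
qed

text \<open>Conjugation by an element of \<open>K\<close> permutes the characters of
  \<open>L\<close>, so their common kernel is invariant.\<close>

lemma char_kernel_normal:
  assumes K: "subgroup K G" and L: "L \<lhd> G\<lparr>carrier := K\<rparr>" and LG: "subgroup L G"
  shows "char_kernel p G L \<lhd> G\<lparr>carrier := K\<rparr>"
proof -
  interpret K: group "G\<lparr>carrier := K\<rparr>" using K by (rule subgroup_imp_group)
  have LK: "L \<subseteq> K" using subgroup.subset[OF normal_imp_subgroup[OF L]] by simp
  show ?thesis
  proof (rule K.normal_invI)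
    show "subgroup (char_kernel p G L) (G\<lparr>carrier := K\<rparr>)"
      using char_kernel_subset[of p L] LK K char_kernel_subgroup[OF LG]
      by (auto intro!: subgroup_incl)
    fix k l assume k: "k \<in> carrier (G\<lparr>carrier := K\<rparr>)" and l: "l \<in> char_kernel p G L"
    have kK: "k \<in> K" and kG: "k \<in> carrier G" using k subgroup.mem_carrier[OF K] by auto
    have conj: "k \<otimes> x \<otimes> inv k \<in> L" if "x \<in> L" for x
      using normal.inv_op_closed2[OF L k that] kK K by (simp add: m_inv_consistent)
    have "int p dvd \<theta> (k \<otimes> l \<otimes> inv k)" if \<theta>: "additive_mod p G L \<theta>" for \<theta>
    proof -
      have "additive_mod p G L (\<lambda>x. \<theta> (k \<otimes> x \<otimes> inv k))" unfolding additive_mod_def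
      proof (intro ballI)
        fix x y assume xy: "x \<in> L" "y \<in> L"
        then have xyG: "x \<in> carrier G" "y \<in> carrier G" using subgroup.mem_carrier[OF LG] by auto
        have "inv k \<otimes> (k \<otimes> (y \<otimes> inv k)) = y \<otimes> inv k" using xyG kG by (simp flip: m_assoc)
        then have "k \<otimes> (x \<otimes> y) \<otimes> inv k = (k \<otimes> x \<otimes> inv k) \<otimes> (k \<otimes> y \<otimes> inv k)"
          using xyG kG by (simp add: m_assoc)
        then show "[\<theta> (k \<otimes> (x \<otimes> y) \<otimes> inv k) = \<theta> (k \<otimes> x \<otimes> inv k) + \<theta> (k \<otimes> y \<otimes> inv k)] (mod int p)"
          using additive_modD[OF \<theta> conj[OF xy(1)] conj[OF xy(2)]] by simp
      qed
      then show ?thesis using l by (auto simp: char_kernel_def)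
    qed
    then show "k \<otimes>\<^bsub>G\<lparr>carrier := K\<rparr>\<^esub> l \<otimes>\<^bsub>G\<lparr>carrier := K\<rparr>\<^esub> inv\<^bsub>G\<lparr>carrier := K\<rparr>\<^esub> k \<in> char_kernel p G L"
      using l conj kK K by (auto simp: char_kernel_def m_inv_consistent)
  qed
qed

lemma char_kernel_commutator:
  assumes L: "subgroup L G" and xy: "x \<in> L" "y \<in> L"
  shows "x \<otimes> y \<otimes> inv (y \<otimes> x) \<in> char_kernel p G L"
proof -
  have "int p dvd \<theta> (x \<otimes> y \<otimes> inv (y \<otimes> x))" if \<theta>: "additive_mod p G L \<theta>" for \<theta>
  proof -
    have yx: "x \<otimes> y \<in> L" "y \<otimes> x \<in> L" using xy L by (auto simp: subgroup.m_closed)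
    have "[\<theta> (x \<otimes> y \<otimes> inv (y \<otimes> x)) = \<theta> (x \<otimes> y) + \<theta> (inv (y \<otimes> x))] (mod int p)"
      using additive_modD[OF \<theta> yx(1) subgroup.m_inv_closed[OF L yx(2)]] .
    also have "[\<theta> (x \<otimes> y) + \<theta> (inv (y \<otimes> x)) = (\<theta> x + \<theta> y) + - (\<theta> y + \<theta> x)] (mod int p)"
    proof (rule cong_add)
      have "[- \<theta> (y \<otimes> x) = - (\<theta> y + \<theta> x)] (mod int p)"
        using additive_modD[OF \<theta> xy(2,1)] by (simp add: cong_minus_minus_iff del: minus_add_distrib)
      then show "[\<theta> (inv (y \<otimes> x)) = - (\<theta> y + \<theta> x)] (mod int p)"
        using additive_mod_inv[OF L \<theta> yx(2)] cong_trans by blast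
    qed (use additive_modD[OF \<theta> xy] in simp)
    finally show ?thesis by (simp add: cong_0_iff)
  qed
  then show ?thesis using xy L by (auto simp: char_kernel_def subgroup.m_closed subgroup.m_inv_closed)
qed

text \<open>Evaluating a maximal independent family identifies the quotient of \<open>L\<close> by
  the common kernel with the vectors of length \<open>n\<close> over the integers modulo
  \<open>p\<close>.\<close>

lemma index_char_kernel:
  assumes L: "subgroup L G" and p: "prime p" and fin: "finite (characters p G L)"
  obtains n where "card (rcosets\<^bsub>G\<lparr>carrier := L\<rparr>\<^esub> (char_kernel p G L)) = p ^ n"
    "finite (rcosets\<^bsub>G\<lparr>carrier := L\<rparr>\<^esub> (char_kernel p G L))" "card (characters p G L) \<le> p ^ n"
proof -
  let ?M = "char_kernel p G L"
  obtain n h where h: "\<And>k. k < n \<Longrightarrow> additive_mod p G L (h k)" "jointly_surj p L h n"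
    "card (characters p G L) \<le> p ^ n" "?M = {l \<in> L. \<forall>k<n. int p dvd h k l}"
    using maximal_characters[OF L p fin] by blast
  have M: "subgroup ?M G" using L by (rule char_kernel_subgroup)
  have p0: "p > 0" using p prime_gt_0_nat by simp
  have LG: "l \<in> carrier G" if "l \<in> L" for l using that L by (rule subgroup.mem_carrier[rotated])
  let ?f = "\<lambda>l. restrict (\<lambda>k. h k l mod int p) {..<n}"
  let ?V = "{..<n} \<rightarrow>\<^sub>E {0..<int p}"
  have eq_iff: "?M #> x = ?M #> y \<longleftrightarrow> ?f x = ?f y" if xy: "x \<in> L" "y \<in> L" for x y
  proof -
    have "[h k (x \<otimes> inv y) = h k x - h k y] (mod int p)" if k: "k < n" for k
    proof -
      have "[h k (x \<otimes> inv y) = h k x + h k (inv y)] (mod int p)"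
        using additive_modD[OF h(1)[OF k] xy(1) subgroup.m_inv_closed[OF L xy(2)]] .
      also have "[h k x + h k (inv y) = h k x + - h k y] (mod int p)"
        using additive_mod_inv[OF L h(1)[OF k] xy(2)] by (intro cong_add) auto
      finally show ?thesis by simp
    qed
    then have "int p dvd h k (x \<otimes> inv y) \<longleftrightarrow> int p dvd h k x - h k y" if "k < n" for k
      using cong_dvd_iff that by blast
    then have 1: "x \<otimes> inv y \<in> ?M \<longleftrightarrow> (\<forall>k<n. int p dvd h k x - h k y)"
      using xy L by (auto simp: h(4) subgroup.m_closed subgroup.m_inv_closed)
    have 2: "(\<forall>k<n. int p dvd h k x - h k y) \<longleftrightarrow> (\<forall>k<n. h k x mod int p = h k y mod int p)"
      by (simp add: cong_iff_dvd_diff[symmetric] cong_def)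
    have 3: "(\<forall>k<n. h k x mod int p = h k y mod int p) \<longleftrightarrow> ?f x = ?f y"
      by (auto simp: fun_eq_iff restrict_def)
    show ?thesis using 1 2 3 coset_eq_iff[OF M LG[OF xy(1)] LG[OF xy(2)]] by blast
  qed
  have "?V = ?f ` L"
  proof
    show "?V \<subseteq> ?f ` L"
    proof
      fix v assume v: "v \<in> ?V"
      obtain l where l: "l \<in> L" "\<And>k. k < n \<Longrightarrow> [h k l = v k] (mod int p)"
        using jointly_surjD[OF h(2), of v] by blast
      have "v = ?f l" using v p0 l by (intro PiE_mod_eqI[of v "{..<n}"]) (auto simp: cong_def)
      then show "v \<in> ?f ` L" using l by blast
    qed
    show "?f ` L \<subseteq> ?V" by (rule image_subsetI) (simp add: p0)
  qed
  let ?g = "\<lambda>X. ?f (SOME l. l \<in> L \<and> ?M #> l = X)"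
  have rep: "(SOME l. l \<in> L \<and> ?M #> l = ?M #> x) \<in> L \<and> ?M #> (SOME l. l \<in> L \<and> ?M #> l = ?M #> x) = ?M #> x"
    if "x \<in> L" for x
    by (rule someI_ex) (use that in blast)
  then have g: "?g (?M #> x) = ?f x" if "x \<in> L" for x using eq_iff that by blast
  have bij: "bij_betw ?g ((\<lambda>x. ?M #> x) ` L) ?V"
    unfolding bij_betw_def
  proof
    show "inj_on ?g ((\<lambda>x. ?M #> x) ` L)"
    proof (rule inj_onI)
      fix X Y assume "X \<in> (\<lambda>x. ?M #> x) ` L" "Y \<in> (\<lambda>x. ?M #> x) ` L" and eq: "?g X = ?g Y"
      then obtain x y where xy: "x \<in> L" "X = ?M #> x" "y \<in> L" "Y = ?M #> y" by blast
      have "?f x = ?f y" using eq unfolding xy(2,4) g[OF xy(1)] g[OF xy(3)] .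
      then show "X = Y" using eq_iff[OF xy(1,3)] xy(2,4) by blast
    qed
    show "?g ` ((\<lambda>x. ?M #> x) ` L) = ?V"
      unfolding \<open>?V = ?f ` L\<close> image_image by (intro image_cong refl) (use g in simp)
  qed
  have V: "finite ?V" "card ?V = p ^ n" by (auto intro!: finite_PiE simp: card_PiE)
  show ?thesis
  proof (rule that[OF _ _ h(3)])
    show "card (rcosets\<^bsub>G\<lparr>carrier := L\<rparr>\<^esub> ?M) = p ^ n"
      using bij_betw_same_card[OF bij] V by (simp add: rcosets_restrict_image)
    show "finite (rcosets\<^bsub>G\<lparr>carrier := L\<rparr>\<^esub> ?M)"
      using bij_betw_finite[OF bij] V by (simp add: rcosets_restrict_image)
  qed
qed

end

section \<open>Characters of finite index subgroups of a presented group\<close>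

context presented_group begin

lemma generate_generators: "generate G (\<pi> ` S) = carrier G"
proof
  have sub: "\<pi> ` S \<subseteq> carrier G" using S_carrier by auto
  then show "generate G (\<pi> ` S) \<subseteq> carrier G" using generate_in_carrier by blast
  have gen: "subgroup (generate G (\<pi> ` S)) G" using sub by (rule generate_is_subgroup)
  show "carrier G \<subseteq> generate G (\<pi> ` S)"
  proof
    fix g assume "g \<in> carrier G"
    then show "g \<in> generate G (\<pi> ` S)"
    proof (induction rule: generators_induct)
      case (gen g s)
      then show ?case using subgroup.m_closed[OF \<open>subgroup (generate G (\<pi> ` S)) G\<close>] generate.incl[of "\<pi> s" "\<pi> ` S" G] by blast
    next
      case (inv g s)
      then show ?case using subgroup.m_closed[OF gen] generate.inv[of "\<pi> s" "\<pi> ` S" G] by blast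
    qed (rule generate.one)
  qed
qed

text \<open>The additive form of \<open>walk\<close> with integer labels; exact integer arithmetic
  lets linear identities be proved before reduction modulo \<open>p\<close>.\<close>

primrec walk_sum :: "('g \<Rightarrow> 'a \<Rightarrow> int) \<Rightarrow> 'g \<Rightarrow> ('a \<times> bool) list \<Rightarrow> int" where
  "walk_sum c g [] = 0"
| "walk_sum c g (l # w) =
    (if snd l then c g (fst l) + walk_sum c (g \<otimes> \<pi> (fst l)) w
     else walk_sum c (g \<otimes> inv (\<pi> (fst l))) w - c (g \<otimes> inv (\<pi> (fst l))) (fst l))"

lemma walk_integer_mod:
  assumes "p > 0"
  shows "walk (integer_mod_group p) (\<lambda>g s. c g s mod int p) g w = walk_sum c g w mod int p"
  using assms
  by (induction w arbitrary: g) (auto simp: carrier_integer_mod_group mod_simps algebra_simps)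

lemma walk_sum_append: "walk_sum c g (v @ w) = walk_sum c g v + walk_sum c (walk_end g v) w"
  by (induction v arbitrary: g) auto

lemma walk_sum_cong:
  assumes "\<And>g s. g \<in> carrier G \<Longrightarrow> s \<in> S \<Longrightarrow> [c g s = c' g s] (mod m)" "fst ` set w \<subseteq> S" "g \<in> carrier G"
  shows "[walk_sum c g w = walk_sum c' g w] (mod m)"
  using assms(2,3) by (induction w arbitrary: g) (auto intro!: cong_add cong_diff assms(1))

lemma walk_sum_translate:
  assumes "l \<in> carrier G" "fst ` set w \<subseteq> S" "g \<in> carrier G"
  shows "walk_sum c (l \<otimes> g) w = walk_sum (\<lambda>x s. c (l \<otimes> x) s) g w"
  using assms(2,3) by (induction w arbitrary: g) (use assms(1) in \<open>auto simp: m_assoc\<close>)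

lemma walk_sum_eq:
  assumes "\<And>g s. g \<in> carrier G \<Longrightarrow> s \<in> S \<Longrightarrow> c g s = c' g s" "fst ` set w \<subseteq> S" "g \<in> carrier G"
  shows "walk_sum c g w = walk_sum c' g w"
  using assms(2,3) by (induction w arbitrary: g) (auto simp: assms(1))

lemma walk_sum_diff: "walk_sum (\<lambda>g s. c g s - c' g s) g w = walk_sum c g w - walk_sum c' g w"
  by (induction w arbitrary: g) auto

lemma walk_sum_add: "walk_sum (\<lambda>g s. c g s + c' g s) g w = walk_sum c g w + walk_sum c' g w"
  by (induction w arbitrary: g) auto

lemma walk_sum_zero: "walk_sum (\<lambda>g s. 0) g w = 0"
  by (induction w arbitrary: g) auto

lemma walk_sum_potential:
  "fst ` set w \<subseteq> S \<Longrightarrow> g \<in> carrier G \<Longrightarrow>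
     walk_sum (\<lambda>g s. h (g \<otimes> \<pi> s) - h g) g w = h (walk_end g w) - h g"
  by (induction w arbitrary: g) (auto simp: m_assoc)

lemma walk_sum_coset:
  assumes L: "subgroup L G" and w: "fst ` set w \<subseteq> S" and g: "g \<in> carrier G" and l: "l \<in> L"
  shows "walk_sum (\<lambda>g s. c (L #> g, s)) (l \<otimes> g) w = walk_sum (\<lambda>g s. c (L #> g, s)) g w"
proof -
  have lG: "l \<in> carrier G" using L l by (rule subgroup.mem_carrier)
  have "walk_sum (\<lambda>g s. c (L #> g, s)) (l \<otimes> g) w = walk_sum (\<lambda>x s. c (L #> (l \<otimes> x), s)) g w"
    using lG w g by (rule walk_sum_translate)
  also have "\<dots> = walk_sum (\<lambda>g s. c (L #> g, s)) g w"
    using w g by (intro walk_sum_eq) (simp_all add: coset_mult_left[OF L l])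
  finally show ?thesis .
qed

lemma labelling_extends_mod:
  assumes p: "p > 0" and rel: "\<And>r g. r \<in> R \<Longrightarrow> g \<in> carrier G \<Longrightarrow> int p dvd walk_sum c g (\<rho> r)"
  obtains \<Phi> where "\<Phi> \<one> = 0"
    "\<And>g s. g \<in> carrier G \<Longrightarrow> s \<in> S \<Longrightarrow> [\<Phi> (g \<otimes> \<pi> s) = \<Phi> g + c g s] (mod int p)"
proof -
  show ?thesis
  proof (rule labelling_extends[OF group_integer_mod_group[of p], of "\<lambda>g s. c g s mod int p"])
    show "c g s mod int p \<in> carrier (integer_mod_group p)" for g s
      using p by (simp add: carrier_integer_mod_group)
    show "walk (integer_mod_group p) (\<lambda>g s. c g s mod int p) g (\<rho> r) = \<one>\<^bsub>integer_mod_group p\<^esub>"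
      if "r \<in> R" "g \<in> carrier G" for r g
      using rel[OF that] p by (simp add: walk_integer_mod)
    fix \<Phi> assume "\<Phi> \<one> = \<one>\<^bsub>integer_mod_group p\<^esub>"
      "\<And>g s. g \<in> carrier G \<Longrightarrow> s \<in> S \<Longrightarrow> \<Phi> (g \<otimes> \<pi> s) = \<Phi> g \<otimes>\<^bsub>integer_mod_group p\<^esub> (c g s mod int p)"
    then show thesis using that[of \<Phi>] by (simp add: cong_def mod_simps)
  qed
qed

text \<open>The defect \<open>\<Phi> (l \<otimes> x) - (\<Phi> l + \<Phi> x)\<close> vanishes at the
  identity and does not change along edges, because an edge and its translate by \<open>l\<close>
  carry congruent labels.\<close>

lemma quasi_additive_if_labels_invariant:
  assumes L: "subgroup L G" and one: "\<Phi> \<one> = 0"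
    and step: "\<And>g s. g \<in> carrier G \<Longrightarrow> s \<in> S \<Longrightarrow> [\<Phi> (g \<otimes> \<pi> s) = \<Phi> g + c g s] (mod int p)"
    and inv: "\<And>l g s. l \<in> L \<Longrightarrow> g \<in> carrier G \<Longrightarrow> s \<in> S \<Longrightarrow> [c (l \<otimes> g) s = c g s] (mod int p)"
  shows "quasi_additive p G L \<Phi>"
  unfolding quasi_additive_def
proof (intro ballI)
  fix l x assume l: "l \<in> L" and x: "x \<in> carrier G"
  have lG: "l \<in> carrier G" using L l by (rule subgroup.mem_carrier)
  let ?D = "\<lambda>x. \<Phi> (l \<otimes> x) - (\<Phi> l + \<Phi> x)"
  have "int p dvd ?D x"
  proof (rule cong_zero_induct[OF generate_generators _ _ x, of p ?D])
    show "int p dvd \<Phi> (l \<otimes> \<one>) - (\<Phi> l + \<Phi> \<one>)" using one lG by simp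
    fix g t assume g: "g \<in> carrier G" and "t \<in> \<pi> ` S"
    then obtain s where s: "s \<in> S" "t = \<pi> s" by auto
    have "[\<Phi> (l \<otimes> g \<otimes> \<pi> s) - (\<Phi> l + \<Phi> (g \<otimes> \<pi> s)) = (\<Phi> (l \<otimes> g) + c g s) - (\<Phi> l + (\<Phi> g + c g s))] (mod int p)"
    proof (intro cong_diff cong_add cong_refl)
      have "[\<Phi> (l \<otimes> g \<otimes> \<pi> s) = \<Phi> (l \<otimes> g) + c (l \<otimes> g) s] (mod int p)" using g lG s by (intro step) auto
      also have "[\<Phi> (l \<otimes> g) + c (l \<otimes> g) s = \<Phi> (l \<otimes> g) + c g s] (mod int p)"
        using g l s by (intro cong_add cong_refl inv)
      finally show "[\<Phi> (l \<otimes> g \<otimes> \<pi> s) = \<Phi> (l \<otimes> g) + c g s] (mod int p)" .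
    qed (use g s step in auto)
    moreover have "(\<Phi> (l \<otimes> g) + c g s) - (\<Phi> l + (\<Phi> g + c g s)) = \<Phi> (l \<otimes> g) - (\<Phi> l + \<Phi> g)" by simp
    ultimately have "[\<Phi> (l \<otimes> g \<otimes> \<pi> s) - (\<Phi> l + \<Phi> (g \<otimes> \<pi> s)) = \<Phi> (l \<otimes> g) - (\<Phi> l + \<Phi> g)] (mod int p)"
      by (simp only:)
    then show "[?D (g \<otimes> t) = ?D g] (mod int p)" using s g lG by (simp add: m_assoc)
  qed
  then show "[\<Phi> (l \<otimes> x) = \<Phi> l + \<Phi> x] (mod int p)" by (simp add: cong_iff_dvd_diff)
qed

text \<open>\<open>n\<close> linear conditions on labellings of the Schreier graph of \<open>L\<close> suffice to make the relator \<open>r\<close> act trivially.\<close>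

definition relator_rank_le :: "nat \<Rightarrow> 'g set \<Rightarrow> 'a \<Rightarrow> nat \<Rightarrow> bool" where
  "relator_rank_le p L r n \<longleftrightarrow> (\<exists>DD. finite DD \<and> card DD \<le> n \<and>
     (\<forall>D\<in>DD. linear_mod p ((rcosets L) \<times> S) D) \<and>
     (\<forall>c. (\<forall>D\<in>DD. int p dvd D c) \<longrightarrow>
        (\<forall>g\<in>carrier G. int p dvd walk_sum (\<lambda>g s. c (L #> g, s)) g (\<rho> r))))"

text \<open>Every labelling that meets the conditions integrates to a function on \<open>G\<close>
  that is quasi-additive for \<open>L\<close>. The labelling is recovered from its character on
  \<open>L\<close> and its values at the representatives of the cosets other than \<open>L\<close>;
  these values account for the second power of \<open>p\<close> on the right.\<close>

theorem card_characters_lower: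
  assumes L: "subgroup L G" and fin: "finite (rcosets L)" and p: "p > 0"
    and ranks: "\<And>r. r \<in> R \<Longrightarrow> relator_rank_le p L r (n r)"
  shows "p ^ (card (rcosets L) * card S) \<le>
    p ^ (\<Sum>r\<in>R. n r) * (card (characters p G L) * p ^ (card (rcosets L) - 1))"
proof -
  let ?E = "(rcosets L) \<times> S"
  let ?r = "coset_rep G L"
  let ?Q = "\<lambda>r DD. finite DD \<and> card DD \<le> n r \<and> (\<forall>D\<in>DD. linear_mod p ?E D) \<and>
     (\<forall>c. (\<forall>D\<in>DD. int p dvd D c) \<longrightarrow>
        (\<forall>g\<in>carrier G. int p dvd walk_sum (\<lambda>g s. c (L #> g, s)) g (\<rho> r)))"
  have "\<forall>r\<in>R. \<exists>DD. ?Q r DD" using ranks unfolding relator_rank_le_def by (rule ballI)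
  then obtain DD where DD': "\<forall>r\<in>R. ?Q r (DD r)" by (rule bchoice[THEN exE])
  have DD: "\<And>r. r \<in> R \<Longrightarrow> finite (DD r)" "\<And>r. r \<in> R \<Longrightarrow> card (DD r) \<le> n r"
    "\<And>r D. r \<in> R \<Longrightarrow> D \<in> DD r \<Longrightarrow> linear_mod p ?E D"
    using DD' by simp_all
  have DD4: "int p dvd walk_sum (\<lambda>g s. c (L #> g, s)) g (\<rho> r)"
    if "r \<in> R" "\<forall>D\<in>DD r. int p dvd D c" "g \<in> carrier G" for r c g
    using bspec[OF DD' that(1)] that(2,3) by simp
  let ?DD = "\<Union>r\<in>R. DD r"
  let ?K = "{c \<in> ?E \<rightarrow>\<^sub>E {0..<int p}. \<forall>D\<in>?DD. int p dvd D c}"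
  have finE: "finite ?E" using fin finite_S by simp
  have "card ?DD \<le> (\<Sum>r\<in>R. card (DD r))" using finite_R by (rule card_UN_le)
  also have "\<dots> \<le> (\<Sum>r\<in>R. n r)" using DD(2) by (rule sum_mono)
  finally have card_DD: "card ?DD \<le> (\<Sum>r\<in>R. n r)" .
  have "p ^ card ?E \<le> p ^ card ?DD * card ?K"
    by (rule card_solutions) (use finE finite_R DD p in auto)
  also have "\<dots> \<le> p ^ (\<Sum>r\<in>R. n r) * card ?K"
    using card_DD p by (intro mult_right_mono power_increasing) auto
  finally have 1: "p ^ card ?E \<le> p ^ (\<Sum>r\<in>R. n r) * card ?K" .
  define good where "good c \<Phi> \<longleftrightarrow> \<Phi> \<one> = (0::int) \<and>
    (\<forall>g\<in>carrier G. \<forall>s\<in>S. [\<Phi> (g \<otimes> \<pi> s) = \<Phi> g + c (L #> g, s)] (mod int p))" for c \<Phi>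
  have "\<exists>\<Phi>. good c \<Phi>" if "c \<in> ?K" for c
  proof (rule labelling_extends_mod[OF p, of "\<lambda>g s. c (L #> g, s)"])
    show "int p dvd walk_sum (\<lambda>g s. c (L #> g, s)) g (\<rho> r)" if "r \<in> R" "g \<in> carrier G" for r g
      by (rule DD4[OF that(1) _ that(2)]) (use that(1) \<open>c \<in> ?K\<close> in blast)
  qed (auto simp: good_def)
  then have "\<forall>c\<in>?K. \<exists>\<Phi>. good c \<Phi>" by blast
  then obtain \<Phi> where \<Phi>: "\<And>c. c \<in> ?K \<Longrightarrow> good c (\<Phi> c)" unfolding bchoice_iff by blast
  have quasi: "quasi_additive p G L (\<Phi> c)" if "c \<in> ?K" for c
    by (rule quasi_additive_if_labels_invariant[OF L, of _ "\<lambda>g s. c (L #> g, s)"])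
      (use \<Phi>[OF that] in \<open>auto simp: good_def coset_mult_left[OF L]\<close>)
  let ?B = "(rcosets L - {L}) \<rightarrow>\<^sub>E {0..<int p}"
  let ?f = "\<lambda>c. (restrict (\<lambda>l. \<Phi> c l mod int p) L, restrict (\<lambda>X. \<Phi> c (?r X) mod int p) (rcosets L - {L}))"
  have inj: "inj_on ?f ?K"
  proof (rule inj_onI)
    fix c d assume c: "c \<in> ?K" and d: "d \<in> ?K" and eq: "?f c = ?f d"
    have eq_L: "[\<Phi> c l = \<Phi> d l] (mod int p)" if "l \<in> L" for l
      using fun_cong[OF arg_cong[OF eq, of fst], of l] that by (simp add: cong_def)
    have eq_rep: "[\<Phi> c (?r X) = \<Phi> d (?r X)] (mod int p)" if "X \<in> rcosets L" for X
    proof (cases "X = L")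
      case True
      then show ?thesis using \<Phi>[OF c] \<Phi>[OF d] by (simp add: coset_rep_self good_def)
    next
      case False
      then show ?thesis
        using fun_cong[OF arg_cong[OF eq, of snd], of X] that by (simp add: cong_def)
    qed
    have eq_G: "[\<Phi> c g = \<Phi> d g] (mod int p)" if g: "g \<in> carrier G" for g
    proof -
      let ?X = "L #> g"
      define l where "l = g \<otimes> inv ?r ?X"
      have l: "l \<in> L" "g = l \<otimes> ?r ?X" using coset_decomp[OF L g] by (simp_all add: l_def)
      have X: "?X \<in> rcosets L" using g by (rule coset_in_rcosets)
      have rX: "?r ?X \<in> carrier G" using coset_rep[OF L X] by simp
      have "[\<Phi> c (l \<otimes> ?r ?X) = \<Phi> c l + \<Phi> c (?r ?X)] (mod int p)"
        using quasi_additiveD[OF quasi[OF c] l(1) rX] .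
      also have "[\<Phi> c l + \<Phi> c (?r ?X) = \<Phi> d l + \<Phi> d (?r ?X)] (mod int p)"
        using eq_L[OF l(1)] eq_rep[OF X] by (rule cong_add)
      also have "[\<Phi> d l + \<Phi> d (?r ?X) = \<Phi> d (l \<otimes> ?r ?X)] (mod int p)"
        using quasi_additiveD[OF quasi[OF d] l(1) rX] by (rule cong_sym)
      finally show ?thesis using l(2) by simp
    qed
    show "c = d"
    proof (rule PiE_mod_eqI[of c ?E p d])
      fix e assume "e \<in> ?E"
      then obtain X s where e: "e = (X, s)" "X \<in> rcosets L" "s \<in> S" by auto
      let ?g = "?r X"
      have g: "?g \<in> carrier G" "L #> ?g = X" using coset_rep[OF L e(2)] by auto
      have *: "[\<Phi> c (?g \<otimes> \<pi> s) - \<Phi> c ?g = c (X, s)] (mod int p)" if "good c (\<Phi> c)" for c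
      proof -
        have "[\<Phi> c (?g \<otimes> \<pi> s) - \<Phi> c ?g = \<Phi> c ?g + c (L #> ?g, s) - \<Phi> c ?g] (mod int p)"
          using that g e by (intro cong_diff cong_refl) (auto simp: good_def)
        then show ?thesis using g by simp
      qed
      have "[\<Phi> c (?g \<otimes> \<pi> s) - \<Phi> c ?g = \<Phi> d (?g \<otimes> \<pi> s) - \<Phi> d ?g] (mod int p)"
        using g e by (intro cong_diff eq_G) auto
      then show "[c e = d e] (mod int p)"
        using *[OF \<Phi>[OF c]] *[OF \<Phi>[OF d]] e(1) cong_trans cong_sym by metis
    qed (use c d in auto)
  qed
  have sub: "?f ` ?K \<subseteq> characters p G L \<times> ?B"
  proof (rule image_subsetI)
    fix c assume c: "c \<in> ?K"
    have "additive_mod p G L (\<Phi> c)"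
      using quasi_additive_imp_additive[OF quasi[OF c] subgroup.subset[OF L]] .
    then have "additive_mod p G L (restrict (\<lambda>l. \<Phi> c l mod int p) L)"
      using subgroup.m_closed[OF L] by (simp add: additive_mod_def cong_def mod_simps)
    then show "?f c \<in> characters p G L \<times> ?B" using p by (simp add: characters_def)
  qed
  have finC: "finite (characters p G L)"
    using card_characters_upper(1)[OF _ generate_generators L fin p] finite_S by blast
  have "finite (characters p G L \<times> ?B)" using finC fin by (intro finite_cartesian_product finite_PiE) auto
  then have "card ?K \<le> card (characters p G L \<times> ?B)" by (rule card_inj_on_le[OF inj sub])
  then have "card ?K \<le> card (characters p G L) * p ^ (card (rcosets L) - 1)"
    using fin subgroup_in_rcosets'[OF L] by (simp add: card_cartesian_product card_PiE)
  then have "p ^ card ?E \<le> p ^ (\<Sum>r\<in>R. n r) * (card (characters p G L) * p ^ (card (rcosets L) - 1))"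
    by (rule order_trans[OF 1 mult_le_mono2])
  then show ?thesis by (simp add: card_cartesian_product)
qed

lemma finite_characters:
  "subgroup L G \<Longrightarrow> finite (rcosets L) \<Longrightarrow> p > 0 \<Longrightarrow> finite (characters p G L)"
  using card_characters_upper(1)[OF _ generate_generators] finite_S by blast

subsection \<open>Conditions imposed by relators that are proper powers\<close>

context
  fixes L W x P and p :: nat
  assumes L: "subgroup L G" and fin: "finite (rcosets L)" and W: "fst ` set W \<subseteq> S"
    and x: "x = \<pi> (word_value F W)" and xP: "x [^] (P::nat) = \<one>" and p0: "p > 0"
begin

abbreviation (input) coset_sum :: "('g set \<times> 'a \<Rightarrow> int) \<Rightarrow> 'g \<Rightarrow> nat \<Rightarrow> int" where
  "coset_sum c g n \<equiv> walk_sum (\<lambda>g s. c (L #> g, s)) g (concat (replicate n W))"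

lemma x_closed: "x \<in> carrier G"
  using W by (simp add: x F.word_value_closed over_carrier)

lemma power_word_over: "fst ` set (concat (replicate n W)) \<subseteq> S"
proof -
  have "set (concat (replicate n W)) \<subseteq> set W" by (induction n) auto
  then show ?thesis using W image_mono by blast
qed

lemma walk_end_power: "g \<in> carrier G \<Longrightarrow> walk_end g (concat (replicate n W)) = g \<otimes> x [^] n"
  using power_word_over[of n] W
  by (simp add: walk_end_eq F.word_value_concat_replicate over_carrier x \<pi>.hom_nat_pow F.word_value_closed)

lemma coset_sum_add:
  "g \<in> carrier G \<Longrightarrow> coset_sum c g (m + n) = coset_sum c g m + coset_sum c (g \<otimes> x [^] m) n"
  by (simp add: replicate_add walk_sum_append walk_end_power)

text \<open>Starting one period later only rotates the closed loop \<open>W^P\<close>: splitting one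
  copy of \<open>W\<close> off either end of \<open>W^(P+1)\<close> leaves the two sides.\<close>

lemma coset_sum_shift: "g \<in> carrier G \<Longrightarrow> coset_sum c (g \<otimes> x) P = coset_sum c g P"
proof -
  assume g: "g \<in> carrier G"
  have "coset_sum c g (1 + P) = coset_sum c g (P + 1)" by (simp add: add.commute)
  then show ?thesis using g x_closed xP unfolding coset_sum_add[OF g] by simp
qed

text \<open>When \<open>x^t\<close> fixes the coset of \<open>g\<close>, the path \<open>W^t\<close>
  is a closed loop of the Schreier graph and is run through \<open>m\<close> times.\<close>

lemma coset_sum_period:
  assumes g: "g \<in> carrier G" and t: "L #> (g \<otimes> x [^] t) = L #> g"
  shows "coset_sum c g (t * m) = int m * coset_sum c g t"
proof (induction m)
  case (Suc m)
  have gt: "g \<otimes> x [^] t \<in> carrier G" using g x_closed by simp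
  define l where "l = g \<otimes> x [^] t \<otimes> inv g"
  have l: "l \<in> L" using t g gt coset_eq_iff[OF L gt g] by (simp add: l_def)
  have "g \<otimes> x [^] t = l \<otimes> g" using g gt by (simp add: l_def m_assoc)
  then have "coset_sum c (g \<otimes> x [^] t) (t * m) = coset_sum c g (t * m)"
    using walk_sum_coset[OF L power_word_over g l] by simp
  then show ?case using coset_sum_add[OF g, of c t "t * m"] Suc by (simp add: algebra_simps)
qed simp

text \<open>The form attached to a coset \<open>X\<close> is unchanged when \<open>X\<close> is
  multiplied by \<open>x\<close>, and for \<open>X\<close> in \<open>V\<close> the first
  \<open>k\<close> translates, beginning with \<open>X\<close>, are distinct members of
  \<open>V\<close>. Hence each form is shared by at least \<open>k\<close> cosets.\<close>

lemma full_orbit_conditions: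
  assumes k: "k > 0" and V: "V = {X \<in> rcosets L. \<forall>t. 0 < t \<longrightarrow> t < k \<longrightarrow> X #> x [^] t \<noteq> X}"
  shows "card ((\<lambda>X c. coset_sum c (coset_rep G L X) P) ` V) * k \<le> card V"
proof (rule card_image_mult_le_fibres)
  show finV: "finite V" using fin V by simp
  let ?D = "\<lambda>X c. coset_sum c (coset_rep G L X) P"
  have LG: "L \<subseteq> carrier G" using L by (rule subgroup.subset)
  fix X assume X: "X \<in> V"
  then have XR: "X \<in> rcosets L" using V by simp
  let ?g = "coset_rep G L X"
  have g: "?g \<in> carrier G" "L #> ?g = X" using coset_rep[OF L XR] by auto
  have Xn: "X #> x [^] n = L #> (?g \<otimes> x [^] n)" for n :: nat
    using g x_closed LG coset_mult_assoc by (metis nat_pow_closed)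
  have cancel: "X #> x [^] t = X" if "X #> x [^] (i + t) = X #> x [^] i" for i t :: nat
  proof -
    have "L #> (?g \<otimes> x [^] t \<otimes> x [^] i) = L #> (?g \<otimes> x [^] i)"
      using that g x_closed by (simp add: Xn m_assoc nat_pow_mult add.commute)
    from coset_mult_right[OF L _ _ _ this, of "inv (x [^] i)"]
    have "L #> (?g \<otimes> x [^] t \<otimes> x [^] i \<otimes> inv (x [^] i)) = L #> (?g \<otimes> x [^] i \<otimes> inv (x [^] i))"
      using g x_closed by blast
    moreover have "?g \<otimes> x [^] t \<otimes> x [^] i \<otimes> inv (x [^] i) = ?g \<otimes> x [^] t"
      "?g \<otimes> x [^] i \<otimes> inv (x [^] i) = ?g" using g x_closed by (simp_all add: m_assoc)
    ultimately have "L #> (?g \<otimes> x [^] t) = L #> ?g" by (simp only:)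
    then show ?thesis unfolding Xn using g(2) by (rule trans)
  qed
  have D: "?D (X #> x [^] n) = ?D X" for n :: nat
  proof -
    have gn: "?g \<otimes> x [^] n \<in> carrier G" using g x_closed by simp
    have "coset_sum c (?g \<otimes> x [^] n) P = coset_sum c ?g P" for c
    proof (induction n)
      case (Suc n)
      then show ?case using coset_sum_shift[of "?g \<otimes> x [^] n" c] g x_closed by (simp add: m_assoc)
    qed (use g in simp)
    moreover have "coset_sum c (coset_rep G L (L #> y)) P = coset_sum c y P" if y: "y \<in> carrier G" for y c
    proof -
      let ?z = "coset_rep G L (L #> y)"
      have z: "?z \<in> carrier G" using coset_rep[OF L coset_in_rcosets[OF y]] by simp
      have "coset_sum c (y \<otimes> inv ?z \<otimes> ?z) P = coset_sum c ?z P"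
        by (rule walk_sum_coset[OF L power_word_over z coset_decomp(1)[OF L y]])
      then show ?thesis using coset_decomp(2)[OF L y] by simp
    qed
    ultimately show ?thesis unfolding Xn using gn by simp
  qed
  have inj: "inj_on (\<lambda>i. X #> x [^] i) {..<k}"
  proof (rule linorder_inj_onI')
    fix i j assume ij: "i \<in> {..<k}" "j \<in> {..<k}" "i < j"
    show "X #> x [^] i \<noteq> X #> x [^] j"
    proof
      assume "X #> x [^] i = X #> x [^] j"
      then have "X #> x [^] (j - i) = X" using cancel[of i "j - i"] ij by simp
      moreover have "0 < j - i" "j - i < k" using ij by auto
      ultimately show False using X V by blast
    qed
  qed
  have "(\<lambda>i. X #> x [^] i) ` {..<k} \<subseteq> {Y \<in> V. ?D Y = ?D X}"
  proof (intro image_subsetI CollectI conjI)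
    fix i :: nat
    have "X #> x [^] i \<in> rcosets L" unfolding Xn using g x_closed by (intro coset_in_rcosets) auto
    moreover have "(X #> x [^] i) #> x [^] t \<noteq> X #> x [^] i" if "0 < t" "t < k" for t
    proof
      assume "(X #> x [^] i) #> x [^] t = X #> x [^] i"
      moreover have "(X #> x [^] i) #> x [^] t = X #> x [^] (i + t)"
        using coset_mult_assoc[of X "x [^] i" "x [^] t"] x_closed r_coset_subset_G[OF LG g(1)]
        unfolding g(2) by (simp only: nat_pow_mult nat_pow_closed)
      ultimately have "X #> x [^] (i + t) = X #> x [^] i" by (simp only:)
      then show False using cancel[of i t] X V that by blast
    qed
    ultimately show "X #> x [^] i \<in> V" using V by blast
    show "?D (X #> x [^] i) = ?D X" by (rule D)
  qed
  then have "card ((\<lambda>i. X #> x [^] i) ` {..<k}) \<le> card {Y \<in> V. ?D Y = ?D X}"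
    using finV by (intro card_mono) auto
  then show "k \<le> card {Y \<in> V. ?D Y = ?D X}" using card_image[OF inj] by simp
qed

text \<open>The conditions are the distinct loop sums over \<open>V\<close>. Loops based outside
  \<open>V\<close> are harmless by \<open>nonfull\<close>, and moving the base point inside its
  \<open>L\<close>-coset does not change a sum.\<close>

lemma relator_rank_le_orbits:
  assumes k: "k > 0" and V: "V = {X \<in> rcosets L. \<forall>t. 0 < t \<longrightarrow> t < k \<longrightarrow> X #> x [^] t \<noteq> X}"
    and nonfull: "\<And>g c. g \<in> carrier G \<Longrightarrow> L #> g \<notin> V \<Longrightarrow> int p dvd coset_sum c g P"
    and r: "\<rho> r = concat (replicate P W)"
  shows "\<exists>n. relator_rank_le p L r n \<and> n * k \<le> card V"
proof (intro exI conjI)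
  let ?D = "\<lambda>X c. coset_sum c (coset_rep G L X) P"
  show "card (?D ` V) * k \<le> card V" using k V by (rule full_orbit_conditions)
  have Vr: "V \<subseteq> rcosets L" using V by auto
  show "relator_rank_le p L r (card (?D ` V))" unfolding relator_rank_le_def
  proof (intro exI[of _ "?D ` V"] conjI ballI allI impI)
    show "finite (?D ` V)" using fin V by simp
    fix D assume "D \<in> ?D ` V"
    then obtain X where X: "X \<in> V" "D = ?D X" by auto
    have gX: "coset_rep G L X \<in> carrier G" using X Vr coset_rep[OF L] by auto
    show "linear_mod p ((rcosets L) \<times> S) D" unfolding linear_mod_def X(2)
    proof (intro conjI allI impI)
      fix c :: "'g set \<times> 'a \<Rightarrow> int" assume c: "\<forall>j\<in>(rcosets L) \<times> S. int p dvd c j"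
      have "[?D X c = walk_sum (\<lambda>g s. 0) (coset_rep G L X) (concat (replicate P W))] (mod int p)"
        by (rule walk_sum_cong[OF _ power_word_over gX])
          (use c in \<open>auto simp: cong_0_iff coset_in_rcosets\<close>)
      then show "int p dvd ?D X c" by (simp add: walk_sum_zero cong_0_iff)
    qed (simp add: walk_sum_diff)
  next
    fix c g assume c: "\<forall>D\<in>?D ` V. int p dvd D c" and g: "g \<in> carrier G"
    show "int p dvd walk_sum (\<lambda>g s. c (L #> g, s)) g (\<rho> r)"
    proof (cases "L #> g \<in> V")
      case True
      let ?z = "coset_rep G L (L #> g)"
      have z: "?z \<in> carrier G" using coset_rep[OF L coset_in_rcosets[OF g]] by simp
      have "coset_sum c (g \<otimes> inv ?z \<otimes> ?z) P = coset_sum c ?z P"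
        by (rule walk_sum_coset[OF L power_word_over z coset_decomp(1)[OF L g]])
      moreover have "int p dvd coset_sum c ?z P" using bspec[OF c imageI[OF True]] by simp
      ultimately show ?thesis using coset_decomp(2)[OF L g] r by simp
    next
      case False
      then show ?thesis using nonfull[OF g] r by simp
    qed
  qed simp
qed

text \<open>No positive power of \<open>x\<close> below \<open>k\<close> fixes a coset, so
  \<open>V\<close> is everything and the relator costs at most one condition per \<open>k\<close>
  cosets. This serves for the minimal root of a relator, with \<open>k\<close> the order of its
  image modulo the finite residual.\<close>

lemma relator_rank_le_power:
  assumes k: "k > 0" and full: "\<And>g t. g \<in> carrier G \<Longrightarrow> 0 < t \<Longrightarrow> t < k \<Longrightarrow> L #> (g \<otimes> x [^] t) \<noteq> L #> g"
    and r: "\<rho> r = concat (replicate P W)"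
  shows "\<exists>n. relator_rank_le p L r n \<and> n * k \<le> card (rcosets L)"
proof -
  let ?V = "{X \<in> rcosets L. \<forall>t. 0 < t \<longrightarrow> t < k \<longrightarrow> X #> x [^] t \<noteq> X}"
  have "L #> g #> x [^] t \<noteq> L #> g" if "g \<in> carrier G" "0 < t" "t < k" for g t
    using full[OF that] that x_closed subgroup.subset[OF L] by (simp add: coset_mult_assoc)
  then have V: "?V = rcosets L" by (auto simp: rcosets_image)
  have "\<exists>n. relator_rank_le p L r n \<and> n * k \<le> card ?V"
  proof (rule relator_rank_le_orbits[OF k refl _ r])
    show "int p dvd coset_sum c g P" if "g \<in> carrier G" "L #> g \<notin> ?V" for g c
      using that coset_in_rcosets unfolding V by blast
  qed
  then show ?thesis using V by simp
qed

text \<open>On a \<open>w\<close>-orbit of length \<open>p^b\<close> with \<open>b < a\<close> the relator \<open>w^(p^a)\<close> contributes a multiple of \<open>p\<close>.\<close>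

lemma relator_rank_le_prime_power:
  assumes p: "prime p" and P: "P = p ^ a" and r: "\<rho> r = concat (replicate P W)"
  shows "\<exists>n. relator_rank_le p L r n \<and> n * p ^ a \<le> card (rcosets L)"
    and "(\<And>g. g \<in> carrier G \<Longrightarrow> \<exists>t. 0 < t \<and> t < p ^ a \<and> L #> (g \<otimes> x [^] t) = L #> g) \<Longrightarrow>
      relator_rank_le p L r 0"
proof -
  let ?V = "{X \<in> rcosets L. \<forall>t. 0 < t \<longrightarrow> t < p ^ a \<longrightarrow> X #> x [^] t \<noteq> X}"
  have k: "p ^ a > 0" using p0 by simp
  have assoc: "L #> g #> x [^] t = L #> (g \<otimes> x [^] t)" if "g \<in> carrier G" for g and t :: nat
    using that x_closed subgroup.subset[OF L] by (simp add: coset_mult_assoc)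
  have iter: "L #> (g \<otimes> x [^] (t * n)) = L #> g" if "g \<in> carrier G" "L #> (g \<otimes> x [^] t) = L #> g" for g and t n :: nat
  proof (induction n)
    case (Suc n)
    have "L #> (g \<otimes> x [^] (t * n) \<otimes> x [^] t) = L #> (g \<otimes> x [^] t)"
      using that x_closed Suc by (intro coset_mult_right[OF L]) auto
    then show ?case using that x_closed by (simp add: m_assoc nat_pow_mult add.commute)
  qed (use that in simp)
  have dvd: "int p dvd coset_sum c g P" if g: "g \<in> carrier G" and V: "L #> g \<notin> ?V" for g c
  proof -
    obtain t where t: "0 < t" "t < p ^ a" "L #> (g \<otimes> x [^] t) = L #> g"
      using V coset_in_rcosets[OF g] assoc[OF g] by auto
    \<comment> \<open>Since \<open>x^(p^a)\<close> is trivial, Bezout shows that \<open>x^e\<close>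
      also fixes the coset. As a proper divisor of \<open>p^a\<close>, \<open>e\<close> is some
      \<open>p^b\<close> with \<open>b < a\<close>; the loop is a \<open>p^(a-b)\<close>-fold
      repetition and its sum is divisible by \<open>p\<close>.\<close>
    define e where "e = gcd t (p ^ a)"
    obtain u v where uv: "t * u = p ^ a * v + e" using bezout_nat[of t "p ^ a"] t by (auto simp: e_def)
    have "x [^] (p ^ a * v) = \<one>" using xP P x_closed by (simp flip: nat_pow_pow)
    then have "x [^] (t * u) = x [^] e" using uv x_closed by (simp flip: nat_pow_mult)
    then have e: "L #> (g \<otimes> x [^] e) = L #> g" using iter[OF g t(3), of u] by simp
    have "e dvd p ^ a" "e \<le> t" using t by (auto simp: e_def intro: dvd_imp_le)
    then obtain b where b: "e = p ^ b" using divides_primepow_nat[OF p] by blast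
    have "b < a" using b \<open>e \<le> t\<close> t(2) p prime_gt_1_nat
      by (metis leD le_less_trans linorder_not_le power_increasing less_imp_le)
    then have "P = e * p ^ (a - b)" using P b by (simp flip: power_add)
    then have "coset_sum c g P = int (p ^ (a - b)) * coset_sum c g e" using coset_sum_period[OF g e] by simp
    moreover have "int p dvd int (p ^ (a - b))" using \<open>b < a\<close> by simp
    ultimately show ?thesis by simp
  qed
  have main: "\<exists>n. relator_rank_le p L r n \<and> n * p ^ a \<le> card ?V"
    using dvd by (intro relator_rank_le_orbits[OF k refl _ r])
  moreover have "card ?V \<le> card (rcosets L)" using fin by (intro card_mono) auto
  ultimately show "\<exists>n. relator_rank_le p L r n \<and> n * p ^ a \<le> card (rcosets L)" using order_trans by blast
  assume "\<And>g. g \<in> carrier G \<Longrightarrow> \<exists>t. 0 < t \<and> t < p ^ a \<and> L #> (g \<otimes> x [^] t) = L #> g"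
  then have empty: "?V = {}" using assoc by (auto simp: rcosets_image)
  obtain n where n: "relator_rank_le p L r n" "n * p ^ a \<le> card ?V" using main by blast
  have "card ?V = 0" unfolding empty by simp
  with n show "relator_rank_le p L r 0" using k by (cases n) auto
qed

end

end

section \<open>Shrinking the support of cocycles along a tower\<close>

context group begin

lemma additive_mod_diff:
  assumes L: "subgroup L G" and h: "additive_mod p G L h" and xy: "x \<in> L" "y \<in> L"
  shows "[h (x \<otimes> inv y) = h x - h y] (mod int p)"
proof -
  have "[h (x \<otimes> inv y) = h x + h (inv y)] (mod int p)"
    using additive_modD[OF h xy(1) subgroup.m_inv_closed[OF L xy(2)]] .
  also have "[h x + h (inv y) = h x + - h y] (mod int p)"
    using additive_mod_inv[OF L h xy(2)] by (intro cong_add) auto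
  finally show ?thesis by simp
qed

lemma quasi_additive_difference:
  assumes L: "subgroup L G" and h: "quasi_additive p G L h"
    and l: "l \<in> L" and g: "g \<in> carrier G" and y: "y \<in> carrier G"
  shows "[h (l \<otimes> g \<otimes> y) - h (l \<otimes> g) = h (g \<otimes> y) - h g] (mod int p)"
proof -
  have lG: "l \<in> carrier G" using L l by (rule subgroup.mem_carrier)
  have "[h (l \<otimes> (g \<otimes> y)) - h (l \<otimes> g) = (h l + h (g \<otimes> y)) - (h l + h g)] (mod int p)"
    using l g y by (intro cong_diff quasi_additiveD[OF h]) auto
  then show ?thesis using lG g y by (simp add: m_assoc)
qed

text \<open>\<open>k\<close> characters cut out a subgroup of the quotient of \<open>L\<close> by
  \<open>M\<close> of index at most \<open>p ^ k\<close>: quotients of two elements with the same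
  character values lie in it.\<close>

lemma card_common_zeros:
  assumes L: "subgroup L G" and M: "M = char_kernel p G L"
    and fin: "finite (rcosets\<^bsub>G\<lparr>carrier := L\<rparr>\<^esub> M)" and p: "p > 0"
    and v: "\<And>m. m < k \<Longrightarrow> additive_mod p G L (v m)"
  shows "card (rcosets\<^bsub>G\<lparr>carrier := L\<rparr>\<^esub> M) \<le>
    p ^ k * card ((\<lambda>l. M #> l) ` {l \<in> L. \<forall>m<k. int p dvd v m l})"
proof -
  let ?A = "rcosets\<^bsub>G\<lparr>carrier := L\<rparr>\<^esub> M" and ?Z = "(\<lambda>l. M #> l) ` {l \<in> L. \<forall>m<k. int p dvd v m l}"
  let ?B = "{..<k} \<rightarrow>\<^sub>E {0..<int p}"
  have MG: "subgroup M G" unfolding M using L by (rule char_kernel_subgroup)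
  have LG: "l \<in> carrier G" if "l \<in> L" for l using that L by (rule subgroup.mem_carrier[rotated])
  define y where "y Y = (SOME l. l \<in> L \<and> M #> l = Y)" for Y
  have y: "y Y \<in> L" "M #> y Y = Y" if "Y \<in> ?A" for Y
  proof -
    have "\<exists>l. l \<in> L \<and> M #> l = Y" using that by (auto simp: rcosets_restrict_image)
    from someI_ex[OF this] show "y Y \<in> L" "M #> y Y = Y" by (auto simp: y_def)
  qed
  let ?f = "\<lambda>Y. restrict (\<lambda>m. v m (y Y) mod int p) {..<k}"
  have "?Z \<subseteq> ?A" by (auto simp: rcosets_restrict_image)
  then have finZ: "finite ?Z" using fin by (rule finite_subset)
  have fibre: "card {Y \<in> ?A. ?f Y = b} \<le> card ?Z" for b
  proof (cases "{Y \<in> ?A. ?f Y = b} = {}")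
    case True
    show ?thesis unfolding True by simp
  next
    case False
    then obtain Y0 where Y0: "Y0 \<in> ?A" "?f Y0 = b" by auto
    let ?g = "\<lambda>Y. M #> (y Y \<otimes> inv (y Y0))"
    show ?thesis
    proof (rule card_inj_on_le[of ?g])
      show "inj_on ?g {Y \<in> ?A. ?f Y = b}"
      proof (rule inj_onI)
        fix X Y assume X: "X \<in> {Y \<in> ?A. ?f Y = b}" and Y: "Y \<in> {Y \<in> ?A. ?f Y = b}" and eq: "?g X = ?g Y"
        have c: "y X \<in> carrier G" "y Y \<in> carrier G" "y Y0 \<in> carrier G" using X Y Y0 y LG by auto
        have "M #> (y X \<otimes> inv (y Y0) \<otimes> y Y0) = M #> (y Y \<otimes> inv (y Y0) \<otimes> y Y0)"
          using coset_mult_right[OF MG _ _ c(3) eq] c by simp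
        then have "M #> y X = M #> y Y" using c by (simp add: m_assoc)
        then show "X = Y" using y X Y by simp
      qed
      show "?g ` {Y \<in> ?A. ?f Y = b} \<subseteq> ?Z"
      proof (intro image_subsetI imageI CollectI conjI allI impI)
        fix Y assume Y: "Y \<in> {Y \<in> ?A. ?f Y = b}"
        then have YL: "y Y \<in> L" and Y0L: "y Y0 \<in> L" using y Y0 by auto
        then show "y Y \<otimes> inv (y Y0) \<in> L" using L by (simp add: subgroup.m_closed subgroup.m_inv_closed)
        fix m assume m: "m < k"
        have "?f Y = ?f Y0" using Y Y0 by simp
        from fun_cong[OF this, of m] have "[v m (y Y) = v m (y Y0)] (mod int p)" using m by (simp add: cong_def)
        then have "int p dvd v m (y Y) - v m (y Y0)" by (simp add: cong_iff_dvd_diff)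
        then show "int p dvd v m (y Y \<otimes> inv (y Y0))"
          using cong_dvd_iff[OF additive_mod_diff[OF L v[OF m] YL Y0L]] by simp
      qed
    qed (rule finZ)
  qed
  have "card ?A \<le> card ?B * card ?Z"
  proof (rule card_le_fibres[where f = ?f])
    show "?f ` ?A \<subseteq> ?B" by (rule image_subsetI) (simp add: p)
    show "finite ?B" by (intro finite_PiE) auto
  qed (use fin fibre in auto)
  then show ?thesis by (simp add: card_PiE)
qed

end

context presented_group begin

text \<open>The union of the supports of \<open>n\<close> cocycles on the Schreier graph. For
  quasi-additive functions any other point of the coset gives the same test.\<close>

definition edge_support :: "nat \<Rightarrow> 'g set \<Rightarrow> (nat \<Rightarrow> 'g \<Rightarrow> int) \<Rightarrow> nat \<Rightarrow> ('g set \<times> 'a) set" where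
  "edge_support p L h n = {(X, s) \<in> (rcosets L) \<times> S.
     \<exists>k<n. \<not> int p dvd h k (coset_rep G L X \<otimes> \<pi> s) - h k (coset_rep G L X)}"

lemma edge_support_subset: "edge_support p L h n \<subseteq> (rcosets L) \<times> S"
  by (auto simp: edge_support_def)

lemma finite_edge_support: "finite (rcosets L) \<Longrightarrow> finite (edge_support p L h n)"
  by (rule finite_subset[OF edge_support_subset]) (simp add: finite_S)

lemma edge_support_iff:
  assumes L: "subgroup L G" and h: "\<And>k. k < n \<Longrightarrow> quasi_additive p G L (h k)"
    and g: "g \<in> carrier G" and s: "s \<in> S"
  shows "(L #> g, s) \<in> edge_support p L h n \<longleftrightarrow> (\<exists>k<n. \<not> int p dvd h k (g \<otimes> \<pi> s) - h k g)"
proof -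
  let ?z = "coset_rep G L (L #> g)"
  have z: "?z \<in> carrier G" using coset_rep[OF L coset_in_rcosets[OF g]] by simp
  have "int p dvd h k (g \<otimes> \<pi> s) - h k g \<longleftrightarrow> int p dvd h k (?z \<otimes> \<pi> s) - h k ?z" if "k < n" for k
    using cong_dvd_iff[OF quasi_additive_difference[OF L h[OF that] coset_decomp(1)[OF L g] z, of "\<pi> s"]] s
      coset_decomp(2)[OF L g] by simp
  then show ?thesis using coset_in_rcosets[OF g] s by (auto simp: edge_support_def)
qed

text \<open>The factors \<open>f j\<close> come from characters independent of the
  \<open>\<phi> i\<close>. There are \<open>(u - k) * k\<close> coefficients, and
  \<open>room\<close> leaves \<open>k\<close> dimensions after one condition for each pair of a
  coset and a relator. Above an edge outside the old support all products vanish; on the lifts of a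
  support edge the \<open>k\<close> new labels are characters of \<open>L\<close> trivial on
  \<open>M\<close>, so at least a fraction \<open>p ^ -k\<close> of the lifts drops out.\<close>

theorem tower_step:
  assumes L: "subgroup L G" and fin: "finite (rcosets L)" and p: "prime p"
    and chars: "p ^ u \<le> card (characters p G L)" and ku: "k \<le> u"
    and \<phi>: "\<And>i. i < k \<Longrightarrow> quasi_additive p G L (\<phi> i)" and surj: "jointly_surj p L \<phi> k"
    and room: "card (rcosets L) * card R + k \<le> (u - k) * k"
    and M: "M = char_kernel p G L"
  shows "\<exists>\<phi>'. (\<forall>i<k. quasi_additive p G M (\<phi>' i)) \<and> jointly_surj p M \<phi>' k \<and>
    card (edge_support p M \<phi>' k) * p ^ k \<le>
      card (edge_support p L \<phi> k) * card (rcosets\<^bsub>G\<lparr>carrier := L\<rparr>\<^esub> M) * (p ^ k - 1)"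
proof -
  have p0: "p > 0" using p prime_gt_0_nat by blast
  have LG: "l \<in> carrier G" if "l \<in> L" for l using that L by (rule subgroup.mem_carrier[rotated])
  have MG: "subgroup M G" unfolding M using L by (rule char_kernel_subgroup)
  have M_sub: "M \<subseteq> L" unfolding M by (rule char_kernel_subset)
  have finC: "finite (characters p G L)" using L fin p0 by (rule finite_characters)
  have \<phi>add: "additive_mod p G L (\<phi> i)" if "i < k" for i
    using quasi_additive_imp_additive[OF \<phi>[OF that] subgroup.subset[OF L]] .
  obtain \<theta> where \<theta>: "\<And>i. i < k \<Longrightarrow> \<theta> i = \<phi> i" "\<And>i. i < u \<Longrightarrow> additive_mod p G L (\<theta> i)"
    "jointly_surj p L \<theta> u"
    using jointly_surj_extend[OF L p finC \<phi>add surj ku chars] by blast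
  \<comment> \<open>With zero values at the representatives, \<open>f j\<close> at
    \<open>l \<otimes> coset_rep G L X\<close> is exactly \<open>\<theta> j l\<close>, so that
    labels above a fixed edge become linear in \<open>l\<close>.\<close>
  define f where "f j = coset_extension G L (\<theta> j) (\<lambda>_. 0)" for j
  have f: "quasi_additive p G L (f j)" "\<And>l. l \<in> L \<Longrightarrow> f j l = \<theta> j l" if "j < u" for j
    using coset_extension_quasi[OF L \<theta>(2)[OF that], of "\<lambda>_. 0"] coset_extension_self[OF L]
    by (simp_all add: f_def)
  have f_rep: "f j (l \<otimes> coset_rep G L X) = \<theta> j l" if "X \<in> rcosets L" "l \<in> L" for j l X
    using coset_extension_rep[OF L that] by (simp add: f_def)
  \<comment> \<open>Left indices are at least \<open>k\<close> and right indices are below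
    \<open>k\<close>. This separation means that the bilinear form defined below can be symmetric
    modulo \<open>p\<close> only if its coefficients vanish, which gives independence.\<close>
  define J where "J = {k..<u} \<times> {..<k}"
  have J: "finite J" "card J = (u - k) * k" "\<And>i. i \<in> J \<Longrightarrow> fst i < u \<and> k \<le> fst i \<and> snd i < k"
    by (auto simp: J_def card_cartesian_product)
  define lab where "lab c g s = (\<Sum>i\<in>J. c i * (f (fst i) g * (\<phi> (snd i) (g \<otimes> \<pi> s) - \<phi> (snd i) g)))"
    for c :: "nat \<times> nat \<Rightarrow> int" and g s
  \<comment> \<open>Translating by \<open>l\<close> changes the labelling by the coboundary of
    \<open>B c l\<close>, and coboundaries sum to zero along relator loops. So a relator condition
    depends only on the coset of its base point.\<close>
  define B where "B c l x = (\<Sum>i\<in>J. c i * (\<theta> (fst i) l * \<phi> (snd i) x))" for c :: "nat \<times> nat \<Rightarrow> int" and l x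
  have lab_translate: "[lab c (l \<otimes> g) s = lab c g s + (B c l (g \<otimes> \<pi> s) - B c l g)] (mod int p)"
    if l: "l \<in> L" and g: "g \<in> carrier G" and s: "s \<in> S" for c l g s
  proof -
    have "[c i * (f (fst i) (l \<otimes> g) * (\<phi> (snd i) (l \<otimes> g \<otimes> \<pi> s) - \<phi> (snd i) (l \<otimes> g))) =
      c i * ((\<theta> (fst i) l + f (fst i) g) * (\<phi> (snd i) (g \<otimes> \<pi> s) - \<phi> (snd i) g))] (mod int p)"
      if i: "i \<in> J" for i
    proof (intro cong_mult cong_refl)
      show "[f (fst i) (l \<otimes> g) = \<theta> (fst i) l + f (fst i) g] (mod int p)"
        using quasi_additiveD[OF f(1) l g, of "fst i"] f(2)[of "fst i" l] J(3)[OF i] l by simp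
      show "[\<phi> (snd i) (l \<otimes> g \<otimes> \<pi> s) - \<phi> (snd i) (l \<otimes> g) = \<phi> (snd i) (g \<otimes> \<pi> s) - \<phi> (snd i) g] (mod int p)"
        using quasi_additive_difference[OF L \<phi> l g, of "snd i" "\<pi> s"] J(3)[OF i] s by simp
    qed
    then have "[lab c (l \<otimes> g) s = (\<Sum>i\<in>J. c i * ((\<theta> (fst i) l + f (fst i) g) *
       (\<phi> (snd i) (g \<otimes> \<pi> s) - \<phi> (snd i) g)))] (mod int p)"
      unfolding lab_def by (rule cong_sum)
    also have "(\<Sum>i\<in>J. c i * ((\<theta> (fst i) l + f (fst i) g) * (\<phi> (snd i) (g \<otimes> \<pi> s) - \<phi> (snd i) g))) =
      lab c g s + (B c l (g \<otimes> \<pi> s) - B c l g)"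
      unfolding lab_def B_def sum_subtractf[symmetric] sum.distrib[symmetric]
      by (intro sum.cong refl) (simp add: algebra_simps)
    finally show ?thesis .
  qed
  have walk_translate: "[walk_sum (lab c) (l \<otimes> g) (\<rho> r) = walk_sum (lab c) g (\<rho> r)] (mod int p)"
    if l: "l \<in> L" and g: "g \<in> carrier G" and r: "r \<in> R" for c l g r
  proof -
    have "walk_sum (lab c) (l \<otimes> g) (\<rho> r) = walk_sum (\<lambda>x s. lab c (l \<otimes> x) s) g (\<rho> r)"
      by (rule walk_sum_translate[OF LG[OF l] rel_over[OF r] g])
    also have "[walk_sum (\<lambda>x s. lab c (l \<otimes> x) s) g (\<rho> r) =
      walk_sum (\<lambda>x s. lab c x s + (B c l (x \<otimes> \<pi> s) - B c l x)) g (\<rho> r)] (mod int p)"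
      by (rule walk_sum_cong[OF lab_translate[OF l] rel_over[OF r] g])
    also have "walk_sum (\<lambda>x s. lab c x s + (B c l (x \<otimes> \<pi> s) - B c l x)) g (\<rho> r) = walk_sum (lab c) g (\<rho> r)"
      using walk_sum_potential[OF rel_over[OF r] g, of "B c l"] walk_end_relator[OF r g]
      by (simp add: walk_sum_add)
    finally show ?thesis .
  qed
  let ?D = "\<lambda>y c. walk_sum (lab c) (coset_rep G L (fst y)) (\<rho> (snd y))"
  let ?DD = "?D ` ((rcosets L) \<times> R)"
  have "\<exists>c :: nat \<Rightarrow> nat \<times> nat \<Rightarrow> int. (\<forall>m<k. \<forall>D\<in>?DD. int p dvd D (c m)) \<and>
    (\<forall>b. (\<forall>i\<in>J. int p dvd (\<Sum>m<k. b m * c m i)) \<longrightarrow> (\<forall>m<k. int p dvd b m))"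
  proof (rule independent_solutions[OF J(1) p])
    show "finite ?DD" using fin finite_R by simp
    have "card ?DD \<le> card ((rcosets L) \<times> R)" using fin finite_R by (intro card_image_le) simp
    then show "card ?DD + k \<le> card J" using room J(2) by (simp add: card_cartesian_product)
    fix D assume "D \<in> ?DD"
    then obtain X r where X: "X \<in> rcosets L" "r \<in> R" "D = ?D (X, r)" by auto
    have z: "coset_rep G L X \<in> carrier G" using coset_rep[OF L X(1)] by simp
    show "linear_mod p J D" unfolding linear_mod_def X(3)
    proof (intro conjI allI impI)
      fix c c' :: "nat \<times> nat \<Rightarrow> int"
      have "lab (\<lambda>i. c i - c' i) = (\<lambda>g s. lab c g s - lab c' g s)"
        by (simp add: lab_def fun_eq_iff left_diff_distrib sum_subtractf)
      then show "?D (X, r) (\<lambda>i. c i - c' i) = ?D (X, r) c - ?D (X, r) c'" by (simp add: walk_sum_diff)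
    next
      fix c :: "nat \<times> nat \<Rightarrow> int" assume c: "\<forall>i\<in>J. int p dvd c i"
      have "int p dvd lab c g s" for g s unfolding lab_def by (intro dvd_sum dvd_mult2) (use c in blast)
      then have "[?D (X, r) c = walk_sum (\<lambda>g s. 0) (coset_rep G L X) (\<rho> r)] (mod int p)"
        using rel_over[OF X(2)] z by (simp only: fst_conv snd_conv) (intro walk_sum_cong, auto simp: cong_0_iff)
      then show "int p dvd ?D (X, r) c" by (simp add: walk_sum_zero cong_0_iff)
    qed
  qed
  then obtain c :: "nat \<Rightarrow> nat \<times> nat \<Rightarrow> int" where c: "\<forall>m<k. \<forall>D\<in>?DD. int p dvd D (c m)"
    and indep: "\<forall>b. (\<forall>i\<in>J. int p dvd (\<Sum>m<k. b m * c m i)) \<longrightarrow> (\<forall>m<k. int p dvd b m)" by blast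
  have rel: "int p dvd walk_sum (lab (c m)) g (\<rho> r)" if m: "m < k" and r: "r \<in> R" and g: "g \<in> carrier G" for m r g
  proof -
    let ?z = "coset_rep G L (L #> g)"
    have z: "?z \<in> carrier G" using coset_rep[OF L coset_in_rcosets[OF g]] by simp
    have DD: "\<forall>D\<in>?DD. int p dvd D (c m)" by (rule mp[OF spec[OF c] m])
    have "(L #> g, r) \<in> (rcosets L) \<times> R" using coset_in_rcosets[OF g] r by blast
    from bspec[OF DD imageI[OF this]] have "int p dvd walk_sum (lab (c m)) ?z (\<rho> r)" by simp
    then show ?thesis
      using cong_dvd_iff[OF walk_translate[OF coset_decomp(1)[OF L g] z r, of "c m"]] coset_decomp(2)[OF L g]
      by simp
  qed
  have "\<exists>\<Phi>. \<Phi> \<one> = 0 \<and> (\<forall>g\<in>carrier G. \<forall>s\<in>S. [\<Phi> (g \<otimes> \<pi> s) = \<Phi> g + lab (c m) g s] (mod int p))"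
    if "m < k" for m
    by (rule labelling_extends_mod[OF p0 rel[OF that]]) auto
  then have "\<forall>m. \<exists>\<Phi>. m < k \<longrightarrow> \<Phi> \<one> = 0 \<and> (\<forall>g\<in>carrier G. \<forall>s\<in>S. [\<Phi> (g \<otimes> \<pi> s) = \<Phi> g + lab (c m) g s] (mod int p))"
    by blast
  from choice[OF this] obtain h where
    h': "\<forall>m. m < k \<longrightarrow> h m \<one> = 0 \<and> (\<forall>g\<in>carrier G. \<forall>s\<in>S. [h m (g \<otimes> \<pi> s) = h m g + lab (c m) g s] (mod int p))"
    by (rule exE)
  have h: "h m \<one> = 0" "\<And>g s. g \<in> carrier G \<Longrightarrow> s \<in> S \<Longrightarrow> [h m (g \<otimes> \<pi> s) = h m g + lab (c m) g s] (mod int p)"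
    if "m < k" for m using h' that by auto
  have B_zero: "int p dvd B c l x" if l: "l \<in> M" for c l x
  proof -
    have "int p dvd \<theta> j l" if "j < u" for j using l \<theta>(2)[OF that] by (simp add: M char_kernel_def)
    then have "int p dvd \<theta> (fst i) l" if "i \<in> J" for i using J(3)[OF that] by simp
    then show ?thesis unfolding B_def by (intro dvd_sum dvd_mult[OF dvd_mult2])
  qed
  have lab_M: "[lab c (l \<otimes> g) s = lab c g s] (mod int p)" if "l \<in> M" "g \<in> carrier G" "s \<in> S" for c l g s
  proof -
    have "[lab c (l \<otimes> g) s = lab c g s + (B c l (g \<otimes> \<pi> s) - B c l g)] (mod int p)"
      using that M_sub by (intro lab_translate) auto
    also have "[lab c g s + (B c l (g \<otimes> \<pi> s) - B c l g) = lab c g s + 0] (mod int p)"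
      using B_zero[OF that(1)] by (intro cong_add cong_refl) (simp add: cong_0_iff)
    finally show ?thesis by simp
  qed
  have quasi: "quasi_additive p G M (h m)" if "m < k" for m
    by (rule quasi_additive_if_labels_invariant[OF MG h(1)[OF that] h(2)[OF that] lab_M])
  have additive: "additive_mod p G M (h m)" if "m < k" for m
    using quasi_additive_imp_additive[OF quasi[OF that] subgroup.subset[OF MG]] .
  have jsurj: "jointly_surj p M h k"
  proof (rule jointly_surj_independent[OF MG p additive])
    fix b m assume b: "\<And>l. l \<in> M \<Longrightarrow> int p dvd (\<Sum>m<k. b m * h m l)" and m: "m < k"
    define H where "H x = (\<Sum>m<k. b m * h m x)" for x
    define C where "C i = (\<Sum>m<k. b m * c m i)" for i
    have H1: "H \<one> = 0" using h(1) by (simp add: H_def)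
    have labC: "lab C g s = (\<Sum>m<k. b m * lab (c m) g s)" for g s
      unfolding lab_def C_def sum_distrib_left sum_distrib_right
      by (subst sum.swap) (simp add: mult.assoc)
    have H_step: "[H (g \<otimes> \<pi> s) = H g + lab C g s] (mod int p)" if "g \<in> carrier G" "s \<in> S" for g s
    proof -
      have "[H (g \<otimes> \<pi> s) = (\<Sum>m<k. b m * (h m g + lab (c m) g s))] (mod int p)"
        unfolding H_def by (intro cong_sum cong_mult cong_refl h(2)) (use that in auto)
      then show ?thesis by (simp add: H_def labC distrib_left sum.distrib)
    qed
    have H_quasi: "quasi_additive p G M H"
      by (rule quasi_additive_if_labels_invariant[OF MG H1 H_step lab_M])
    \<comment> \<open>\<open>H\<close> fails to be additive on \<open>L\<close> exactly by the
      bilinear form \<open>B C\<close>: the defect vanishes at the identity and is constant along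
      edges modulo \<open>p\<close>.\<close>
    have bilinear: "[H (l \<otimes> x) = H l + H x + B C l x] (mod int p)" if l: "l \<in> L" and x: "x \<in> carrier G" for l x
    proof -
      let ?E = "\<lambda>x. H (l \<otimes> x) - (H l + H x + B C l x)"
      have "int p dvd ?E x"
      proof (rule cong_zero_induct[OF generate_generators _ _ x, of p ?E])
        have "int p dvd \<phi> i \<one>" if "i < k" for i using additive_mod_one[OF L \<phi>add[OF that]] .
        then have "int p dvd B C l \<one>" unfolding B_def by (intro dvd_sum dvd_mult) (use J in auto)
        then show "int p dvd H (l \<otimes> \<one>) - (H l + H \<one> + B C l \<one>)" using H1 LG[OF l] by simp
        fix g t assume g: "g \<in> carrier G" and "t \<in> \<pi> ` S"
        then obtain s where s: "s \<in> S" "t = \<pi> s" by auto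
        have "[H (l \<otimes> g \<otimes> \<pi> s) = H (l \<otimes> g) + lab C (l \<otimes> g) s] (mod int p)"
          using g s LG[OF l] by (intro H_step) auto
        also have "[H (l \<otimes> g) + lab C (l \<otimes> g) s =
          H (l \<otimes> g) + (lab C g s + (B C l (g \<otimes> \<pi> s) - B C l g))] (mod int p)"
          using l g s by (intro cong_add cong_refl lab_translate)
        finally have 1: "[H (l \<otimes> g \<otimes> \<pi> s) - (H l + H (g \<otimes> \<pi> s) + B C l (g \<otimes> \<pi> s)) =
          H (l \<otimes> g) + (lab C g s + (B C l (g \<otimes> \<pi> s) - B C l g)) -
            (H l + (H g + lab C g s) + B C l (g \<otimes> \<pi> s))] (mod int p)"
          by (intro cong_diff cong_add cong_refl H_step g s)
        have "H (l \<otimes> g) + (lab C g s + (B C l (g \<otimes> \<pi> s) - B C l g)) -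
            (H l + (H g + lab C g s) + B C l (g \<otimes> \<pi> s)) = ?E g" by simp
        with 1 show "[?E (g \<otimes> t) = ?E g] (mod int p)" using s g LG[OF l] by (simp only: m_assoc \<pi>_closed S_closed)
      qed
      then show ?thesis by (simp add: cong_iff_dvd_diff)
    qed
    text \<open>Commutators of \<open>L\<close> lie in the subgroup on which \<open>H\<close> vanishes, so the bilinear form is symmetric.\<close>
    have symmetric: "[B C x y = B C y x] (mod int p)" if xy: "x \<in> L" "y \<in> L" for x y
    proof -
      let ?z = "x \<otimes> y \<otimes> inv (y \<otimes> x)"
      have z: "?z \<in> M" unfolding M using L xy by (rule char_kernel_commutator)
      have xyG: "x \<in> carrier G" "y \<in> carrier G" using xy LG by auto
      have "[H (?z \<otimes> (y \<otimes> x)) = H ?z + H (y \<otimes> x)] (mod int p)"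
        using quasi_additiveD[OF H_quasi z] xyG by simp
      moreover have "?z \<otimes> (y \<otimes> x) = x \<otimes> y" using xyG by (simp add: m_assoc)
      moreover have "[H ?z + H (y \<otimes> x) = 0 + H (y \<otimes> x)] (mod int p)"
        using b[OF z] by (intro cong_add cong_refl) (simp add: H_def cong_0_iff)
      ultimately have "[H (x \<otimes> y) = H (y \<otimes> x)] (mod int p)" using cong_trans by fastforce
      then have "[H x + H y + B C x y = H y + H x + B C y x] (mod int p)"
        using bilinear[OF xy(1) xyG(2)] bilinear[OF xy(2) xyG(1)] cong_trans cong_sym by blast
      then have "[H x + H y + B C x y = H x + H y + B C y x] (mod int p)" by (simp add: add.commute)
      then show ?thesis unfolding cong_add_lcancel .
    qed
    have "int p dvd C i" if i: "i \<in> J" for i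
    proof -
      \<comment> \<open>\<open>x\<close> and \<open>y\<close> are dual to the two indices of
        \<open>i\<close>. Then \<open>B C x y\<close> isolates \<open>C i\<close>, whereas
        \<open>B C y x\<close> vanishes because left indices are at least \<open>k\<close> and
        \<open>snd i\<close> is below \<open>k\<close>.\<close>
      obtain x where x: "x \<in> L" "\<And>j. j < u \<Longrightarrow> [\<theta> j x = of_bool (j = fst i)] (mod int p)"
        using jointly_surjD[OF \<theta>(3), of "\<lambda>j. of_bool (j = fst i)"] by blast
      obtain y where y: "y \<in> L" "\<And>j. j < u \<Longrightarrow> [\<theta> j y = of_bool (j = snd i)] (mod int p)"
        using jointly_surjD[OF \<theta>(3), of "\<lambda>j. of_bool (j = snd i)"] by blast
      have "[B C x y = (\<Sum>i'\<in>J. C i' * (of_bool (fst i' = fst i) * of_bool (snd i' = snd i)))] (mod int p)"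
        unfolding B_def
      proof (intro cong_sum cong_mult cong_refl)
        fix i' assume i': "i' \<in> J"
        show "[\<theta> (fst i') x = of_bool (fst i' = fst i)] (mod int p)" using x(2) J(3)[OF i'] by simp
        show "[\<phi> (snd i') y = of_bool (snd i' = snd i)] (mod int p)"
          using y(2)[of "snd i'"] \<theta>(1)[of "snd i'"] J(3)[OF i'] ku by simp
      qed
      also have "(\<Sum>i'\<in>J. C i' * (of_bool (fst i' = fst i) * of_bool (snd i' = snd i))) =
        (\<Sum>i'\<in>J. if i' = i then C i else 0)"
        by (intro sum.cong refl) (auto simp: prod_eq_iff)
      also have "\<dots> = C i" using i J(1) by simp
      finally have 1: "[B C x y = C i] (mod int p)" .
      have "[B C y x = (\<Sum>i'\<in>J. C i' * (0 * \<phi> (snd i') x))] (mod int p)" unfolding B_def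
      proof (intro cong_sum cong_mult cong_refl)
        fix i' assume i': "i' \<in> J"
        have "fst i' \<noteq> snd i" using J(3)[OF i'] J(3)[OF i] by auto
        then show "[\<theta> (fst i') y = 0] (mod int p)" using y(2)[of "fst i'"] J(3)[OF i'] by simp
      qed
      then have "[B C y x = 0] (mod int p)" by simp
      from cong_trans[OF cong_trans[OF cong_sym[OF 1] symmetric[OF x(1) y(1)]] this]
      show ?thesis by (simp only: cong_0_iff)
    qed
    then show "int p dvd b m" using spec[OF indep, of b] m by (simp add: C_def)
  qed
  let ?A = "rcosets\<^bsub>G\<lparr>carrier := L\<rparr>\<^esub> M"
  have finA: "finite ?A" using index_char_kernel[OF L p finC] M by metis
  have MgL: "?A = (\<lambda>l. M #> l) ` L" by (rule rcosets_restrict_image)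
  \<comment> \<open>Bounds the number of surviving lifts of one support edge. The division is exact,
    since the order of the quotient of \<open>L\<close> by \<open>M\<close> is a power of
    \<open>p\<close> with exponent at least \<open>k\<close>.\<close>
  define N where "N = card ?A - card ?A div p ^ k"
  let ?E' = "edge_support p M h k" and ?E = "edge_support p L \<phi> k"
  let ?proj = "\<lambda>(X, s). (L #> coset_rep G M X, s)"
  have M_rep: "coset_rep G M X \<in> carrier G" "M #> coset_rep G M X = X" if "X \<in> rcosets M" for X
    using coset_rep[OF MG that] by auto
  have E'_iff: "(M #> g, s) \<in> ?E' \<longleftrightarrow> (\<exists>m<k. \<not> int p dvd lab (c m) g s)" if "g \<in> carrier G" "s \<in> S" for g s
  proof -
    have "int p dvd h m (g \<otimes> \<pi> s) - h m g \<longleftrightarrow> int p dvd lab (c m) g s" if m: "m < k" for m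
    proof (rule cong_dvd_iff)
      have "[h m (g \<otimes> \<pi> s) - h m g = h m g + lab (c m) g s - h m g] (mod int p)"
        using h(2)[OF m \<open>g \<in> carrier G\<close> \<open>s \<in> S\<close>] by (intro cong_diff cong_refl)
      then show "[h m (g \<otimes> \<pi> s) - h m g = lab (c m) g s] (mod int p)" by simp
    qed
    moreover have "(M #> g, s) \<in> ?E' \<longleftrightarrow> (\<exists>m<k. \<not> int p dvd h m (g \<otimes> \<pi> s) - h m g)"
      by (rule edge_support_iff[OF MG quasi that])
    ultimately show ?thesis by auto
  qed
  have proj_E: "?proj e \<in> ?E" if e: "e \<in> ?E'" for e
  proof -
    obtain X s where Xs: "e = (X, s)" "X \<in> rcosets M" "s \<in> S"
      using e edge_support_subset[of p M h k] by auto
    let ?g = "coset_rep G M X"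
    have g: "?g \<in> carrier G" "M #> ?g = X" using M_rep[OF Xs(2)] by auto
    obtain m where "m < k" and m: "\<not> int p dvd lab (c m) ?g s" using E'_iff[OF g(1) Xs(3)] e Xs(1) g(2) by auto
    have "\<not> (\<forall>i<k. int p dvd \<phi> i (?g \<otimes> \<pi> s) - \<phi> i ?g)"
    proof
      assume "\<forall>i<k. int p dvd \<phi> i (?g \<otimes> \<pi> s) - \<phi> i ?g"
      then have "int p dvd lab (c m) ?g s" unfolding lab_def
        by (intro dvd_sum dvd_mult) (use J in auto)
      then show False using m by simp
    qed
    then show ?thesis using edge_support_iff[OF L \<phi> g(1) Xs(3)] Xs(1) by auto
  qed
  have fibre: "card {e' \<in> ?E'. ?proj e' = e} \<le> N" if e: "e \<in> ?E" for e
  proof -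
    obtain X s where Xs: "e = (X, s)" "X \<in> rcosets L" "s \<in> S"
      using e edge_support_subset[of p L \<phi> k] by auto
    let ?g = "coset_rep G L X"
    have g: "?g \<in> carrier G" "L #> ?g = X" using coset_rep[OF L Xs(2)] by auto
    \<comment> \<open>The label of the lift indexed by \<open>l\<close>, as a character of
      \<open>L\<close>: the factor from \<open>\<phi>\<close> is constant on the lifts and the
      factor from \<open>\<theta>\<close> is linear.\<close>
    define v where "v m l = (\<Sum>i\<in>J. c m i * (\<phi> (snd i) (?g \<otimes> \<pi> s) - \<phi> (snd i) ?g) * \<theta> (fst i) l)" for m l
    have v_add: "additive_mod p G L (v m)" for m unfolding additive_mod_def
    proof (intro ballI)
      fix x y assume xy: "x \<in> L" "y \<in> L"
      have "[v m (x \<otimes> y) = (\<Sum>i\<in>J. c m i * (\<phi> (snd i) (?g \<otimes> \<pi> s) - \<phi> (snd i) ?g) *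
        (\<theta> (fst i) x + \<theta> (fst i) y))] (mod int p)"
        unfolding v_def
        by (intro cong_sum cong_mult cong_refl additive_modD[OF \<theta>(2)]) (use J xy in auto)
      then show "[v m (x \<otimes> y) = v m x + v m y] (mod int p)"
        by (simp add: v_def distrib_left sum.distrib)
    qed
    let ?Z = "(\<lambda>l. M #> l) ` {l \<in> L. \<forall>m<k. int p dvd v m l}"
    have "card ?A \<le> p ^ k * card ?Z" by (rule card_common_zeros[OF L M finA p0 v_add])
    from div_le_mono[OF this, of "p ^ k"] have Z: "card ?A div p ^ k \<le> card ?Z" using p0 by simp
    have ZA: "?Z \<subseteq> ?A" by (auto simp: MgL)
    have lab_v: "lab (c m) (l \<otimes> ?g) s = (\<Sum>i\<in>J. c m i * (\<theta> (fst i) l * (\<phi> (snd i) (l \<otimes> ?g \<otimes> \<pi> s) - \<phi> (snd i) (l \<otimes> ?g))))"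
      if "l \<in> L" for m l
      unfolding lab_def by (simp add: f_rep[OF Xs(2) that])
    have lab_v': "[lab (c m) (l \<otimes> ?g) s = v m l] (mod int p)" if l: "l \<in> L" for m l
    proof -
      have "[lab (c m) (l \<otimes> ?g) s = (\<Sum>i\<in>J. c m i * (\<theta> (fst i) l * (\<phi> (snd i) (?g \<otimes> \<pi> s) - \<phi> (snd i) ?g)))] (mod int p)"
        unfolding lab_v[OF l]
        by (intro cong_sum cong_mult cong_refl quasi_additive_difference[OF L \<phi> l g(1)]) (use J Xs in auto)
      also have "(\<Sum>i\<in>J. c m i * (\<theta> (fst i) l * (\<phi> (snd i) (?g \<otimes> \<pi> s) - \<phi> (snd i) ?g))) = v m l"
        unfolding v_def by (intro sum.cong refl) (simp add: mult.commute mult.left_commute)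
      finally show ?thesis .
    qed
    let ?T = "{e' \<in> ?E'. ?proj e' = e}"
    let ?\<psi> = "\<lambda>e'. M #> (coset_rep G M (fst e') \<otimes> inv ?g)"
    have T: "\<exists>X' l. e' = (X', s) \<and> X' \<in> rcosets M \<and> l \<in> L \<and> coset_rep G M X' = l \<otimes> ?g \<and>
      coset_rep G M X' \<otimes> inv ?g = l \<and> (\<exists>m<k. \<not> int p dvd v m l)"
      if e': "e' \<in> ?T" for e'
    proof -
      obtain X' where X': "e' = (X', s)" "X' \<in> rcosets M" "L #> coset_rep G M X' = X"
        using e' Xs(1) edge_support_subset[of p M h k] by auto
      let ?g' = "coset_rep G M X'"
      have g': "?g' \<in> carrier G" "M #> ?g' = X'" using M_rep[OF X'(2)] by auto
      define l where "l = ?g' \<otimes> inv ?g"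
      have l: "l \<in> L" using X'(3) g g' coset_eq_iff[OF L g'(1) g(1)] by (simp add: l_def)
      have g'l: "?g' = l \<otimes> ?g" using g g' by (simp add: l_def m_assoc)
      obtain m where "m < k" "\<not> int p dvd lab (c m) ?g' s"
        using E'_iff[OF g'(1) Xs(3)] e' X'(1) g'(2) by auto
      then have "\<exists>m<k. \<not> int p dvd v m l" using cong_dvd_iff[OF lab_v'[OF l, of m]] g'l by auto
      then show ?thesis using X' l g'l l_def by blast
    qed
    have "inj_on ?\<psi> ?T"
    proof (rule inj_onI)
      fix d e assume d: "d \<in> ?T" and e: "e \<in> ?T" and eq: "?\<psi> d = ?\<psi> e"
      obtain X1 l1 where 1: "d = (X1, s)" "X1 \<in> rcosets M" "l1 \<in> L" "coset_rep G M X1 = l1 \<otimes> ?g"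
        "coset_rep G M X1 \<otimes> inv ?g = l1" using T[OF d] by blast
      obtain X2 l2 where 2: "e = (X2, s)" "X2 \<in> rcosets M" "l2 \<in> L" "coset_rep G M X2 = l2 \<otimes> ?g"
        "coset_rep G M X2 \<otimes> inv ?g = l2" using T[OF e] by blast
      have "M #> l1 = M #> l2" using eq 1 2 by simp
      then have "M #> (l1 \<otimes> ?g) = M #> (l2 \<otimes> ?g)"
        by (rule coset_mult_right[OF MG LG[OF 1(3)] LG[OF 2(3)] g(1)])
      then have "X1 = X2" using M_rep[OF 1(2)] M_rep[OF 2(2)] 1(4) 2(4) by simp
      then show "d = e" using 1 2 by simp
    qed
    moreover have "?\<psi> ` ?T \<subseteq> ?A - ?Z"
    proof (rule image_subsetI)
      fix e' assume e': "e' \<in> ?T"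
      obtain X' l m where l: "e' = (X', s)" "l \<in> L" "coset_rep G M X' \<otimes> inv ?g = l" "m < k" "\<not> int p dvd v m l"
        using T[OF e'] by blast
      have "M #> l \<notin> ?Z"
      proof
        assume "M #> l \<in> ?Z"
        then obtain l' where l': "l' \<in> L" "\<forall>m<k. int p dvd v m l'" "M #> l = M #> l'" by auto
        have "l \<otimes> inv l' \<in> M" using coset_eq_iff[OF MG LG[OF l(2)] LG[OF l'(1)]] l'(3) by simp
        then have "int p dvd v m (l \<otimes> inv l')" using v_add[of m] by (simp add: M char_kernel_def)
        then have "int p dvd v m l - v m l'" using cong_dvd_iff[OF additive_mod_diff[OF L v_add l(2) l'(1)]] by simp
        then have "int p dvd v m l" using l'(2) l(4) by (metis diff_add_cancel dvd_add)
        then show False using l(5) by simp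
      qed
      then show "?\<psi> e' \<in> ?A - ?Z" using l by (simp add: MgL)
    qed
    moreover have "finite (?A - ?Z)" using finA by simp
    ultimately have "card ?T \<le> card (?A - ?Z)" by (rule card_inj_on_le)
    also have "\<dots> = card ?A - card ?Z" by (rule card_Diff_subset[OF finite_subset[OF ZA finA] ZA])
    also have "\<dots> \<le> N" using Z by (simp add: N_def)
    finally show ?thesis .
  qed
  have finM: "finite (rcosets M)" by (rule finite_rcosets_trans[OF MG L M_sub fin finA])
  have "card ?E' \<le> card ?E * N"
    by (rule card_le_fibres[where f = ?proj])
      (use finite_edge_support fin finM proj_E fibre in auto)
  then have "card ?E' * p ^ k \<le> card ?E * (N * p ^ k)" by (simp add: mult.assoc)
  moreover have "N * p ^ k \<le> card ?A * (p ^ k - 1)"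
  proof -
    obtain n where n: "card ?A = p ^ n" "card (characters p G L) \<le> p ^ n"
      using index_char_kernel[OF L p finC] M by metis
    have "p ^ k \<le> p ^ u" using ku p0 by (intro power_increasing) auto
    then have "p ^ k \<le> card (characters p G L)" using chars by simp
    then have "p ^ k \<le> p ^ n" using n by simp
    then have "k \<le> n" using power_le_imp_le_exp[OF prime_gt_1_nat[OF p]] by blast
    then have "card ?A = (card ?A div p ^ k) * p ^ k" using n(1) by (simp add: le_imp_power_dvd)
    then have "N * p ^ k = card ?A * p ^ k - card ?A" by (metis N_def diff_mult_distrib)
    then show ?thesis by (simp add: diff_mult_distrib2)
  qed
  ultimately have "card ?E' * p ^ k \<le> card ?E * (card ?A * (p ^ k - 1))"
    by (meson le_trans mult_le_mono2)
  then show ?thesis using quasi jsurj by (intro exI[of _ h]) (simp add: mult.assoc)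
qed

end

section \<open>Quotients of finite index subgroups of free groups\<close>

context presented_group begin

text \<open>The multiplicative counterpart for labels in any group: both sides agree at the identity
  and obey the same recursion along edges, since translation by \<open>l\<close> preserves
  labels.\<close>

lemma hom_if_labels_invariant:
  assumes E: "group E" and L: "subgroup L G" and \<Phi>: "\<Phi> \<in> carrier G \<rightarrow> carrier E" "\<Phi> \<one> = \<one>\<^bsub>E\<^esub>"
    and lab: "\<And>g s. g \<in> carrier G \<Longrightarrow> s \<in> S \<Longrightarrow> lab g s \<in> carrier E"
    and step: "\<And>g s. g \<in> carrier G \<Longrightarrow> s \<in> S \<Longrightarrow> \<Phi> (g \<otimes> \<pi> s) = \<Phi> g \<otimes>\<^bsub>E\<^esub> lab g s"
    and inv: "\<And>l g s. l \<in> L \<Longrightarrow> g \<in> carrier G \<Longrightarrow> s \<in> S \<Longrightarrow> lab (l \<otimes> g) s = lab g s"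
    and l: "l \<in> L" and g: "g \<in> carrier G"
  shows "\<Phi> (l \<otimes> g) = \<Phi> l \<otimes>\<^bsub>E\<^esub> \<Phi> g"
proof -
  interpret E: group E by fact
  have lG: "l \<in> carrier G" using L l by (rule subgroup.mem_carrier)
  have \<Phi>E: "\<Phi> x \<in> carrier E" if "x \<in> carrier G" for x using \<Phi>(1) that by auto
  show ?thesis using g
  proof (induction rule: generators_induct)
    case one
    then show ?case using lG \<Phi> \<Phi>E by simp
  next
    case (gen g s)
    have "\<Phi> (l \<otimes> g \<otimes> \<pi> s) = \<Phi> (l \<otimes> g) \<otimes>\<^bsub>E\<^esub> lab (l \<otimes> g) s" using step[of "l \<otimes> g" s] gen lG by simp
    then show ?case using gen inv[OF l] step lG \<Phi>E lab by (simp add: m_assoc E.m_assoc)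
  next
    case (inv g s)
    let ?g = "g \<otimes> inv \<pi> s"
    have g': "?g \<in> carrier G" "?g \<otimes> \<pi> s = g" using inv by (simp_all add: m_assoc)
    have 1: "\<Phi> g = \<Phi> ?g \<otimes>\<^bsub>E\<^esub> lab ?g s" using step[of ?g s] g' inv by simp
    have "l \<otimes> ?g \<otimes> \<pi> s = l \<otimes> g" using g' lG inv by (simp add: m_assoc)
    then have "\<Phi> (l \<otimes> g) = \<Phi> (l \<otimes> ?g) \<otimes>\<^bsub>E\<^esub> lab ?g s"
      using step[of "l \<otimes> ?g" s] assms(7)[OF l g'(1) inv(2)] g' lG inv by simp
    then have "\<Phi> (l \<otimes> ?g) \<otimes>\<^bsub>E\<^esub> lab ?g s = (\<Phi> l \<otimes>\<^bsub>E\<^esub> \<Phi> ?g) \<otimes>\<^bsub>E\<^esub> lab ?g s"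
      using inv 1 \<Phi>E lab lG g' by (simp add: E.m_assoc)
    then show ?case using \<Phi>E lab lG g' inv by (subst (asm) E.right_cancel) auto
  qed
qed

end

text \<open>Without relators every labelling integrates, so maps out of free groups come from the
  same device.\<close>

lemma free_group_presented:
  assumes "freely_generates E Y" "finite Y"
  shows "presented_group E E Y {} id \<rho>"
proof -
  interpret group E using assms(1) by (rule freely_generates_group)
  have "normal_closure E {} \<subseteq> {\<one>\<^bsub>E\<^esub>}" by (rule normal_closure_subset[OF one_is_normal]) simp
  moreover have "\<one>\<^bsub>E\<^esub> \<in> normal_closure E {}"
    by (auto simp: normal_closure_def intro: subgroup.one_closed normal_imp_subgroup)
  ultimately have "normal_closure E {} = {\<one>\<^bsub>E\<^esub>}" by blast
  then have "presentation E Y {} E id"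
    using assms(1) by (auto simp: presentation_def kernel_def hom_def)
  then show ?thesis by unfold_locales (use assms(2) in auto)
qed

text \<open>Labelling the edge of a basis element \<open>y\<close> at the base coset by \<open>y\<close> and all other edges trivially
  sends the first power of \<open>y\<close> that lies in \<open>N\<close> to \<open>y\<close>.\<close>

lemma free_subgroup_onto:
  assumes free: "freely_generates E Y" "finite Y" and N: "subgroup N E"
    and pow: "\<And>y. y \<in> Y \<Longrightarrow> \<exists>k>0. y [^]\<^bsub>E\<^esub> (k::nat) \<in> N"
  shows "\<exists>\<chi>. \<chi> \<in> hom (E\<lparr>carrier := N\<rparr>) E \<and> \<chi> ` N = carrier E"
proof -
  interpret presented_group E E Y "{}" id "\<lambda>_. []" using free by (rule free_group_presented)
  have YE: "y \<in> carrier E" if "y \<in> Y" for y using that S_carrier by auto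
  have NE: "N \<subseteq> carrier E" using N by (rule subgroup.subset)
  let ?lab = "\<lambda>g s. if g \<in> N then s else \<one>\<^bsub>E\<^esub>"
  obtain \<Phi> where \<Phi>: "\<Phi> \<in> carrier E \<rightarrow> carrier E" "\<Phi> \<one>\<^bsub>E\<^esub> = \<one>\<^bsub>E\<^esub>"
    "\<And>g s. g \<in> carrier E \<Longrightarrow> s \<in> Y \<Longrightarrow> \<Phi> (g \<otimes>\<^bsub>E\<^esub> id s) = \<Phi> g \<otimes>\<^bsub>E\<^esub> ?lab g s"
    by (rule labelling_extends[OF is_group, of ?lab]) (use YE in auto)
  have inv: "?lab (l \<otimes>\<^bsub>E\<^esub> g) s = ?lab g s" if l: "l \<in> N" and g: "g \<in> carrier E" for l g s
  proof -
    have "g \<in> N" if "l \<otimes>\<^bsub>E\<^esub> g \<in> N"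
    proof -
      have "inv\<^bsub>E\<^esub> l \<otimes>\<^bsub>E\<^esub> (l \<otimes>\<^bsub>E\<^esub> g) \<in> N" using l that N by (simp add: subgroup.m_closed subgroup.m_inv_closed)
      then show ?thesis using l g NE by (auto simp flip: m_assoc)
    qed
    then show ?thesis using l subgroup.m_closed[OF N] by auto
  qed
  have mult: "\<Phi> (l \<otimes>\<^bsub>E\<^esub> g) = \<Phi> l \<otimes>\<^bsub>E\<^esub> \<Phi> g" if "l \<in> N" "g \<in> carrier E" for l g
    by (rule hom_if_labels_invariant[OF is_group N \<Phi>(1,2) _ \<Phi>(3) inv that]) (use YE in auto)
  have hom: "\<Phi> \<in> hom (E\<lparr>carrier := N\<rparr>) E" using mult \<Phi>(1) NE by (auto simp: hom_def)
  interpret N: group "E\<lparr>carrier := N\<rparr>" using N by (rule subgroup_imp_group)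
  interpret \<Phi>: group_hom "E\<lparr>carrier := N\<rparr>" E \<Phi> by unfold_locales (rule hom)
  have img: "subgroup (\<Phi> ` N) E" using \<Phi>.img_is_subgroup by simp
  have "Y \<subseteq> \<Phi> ` N"
  proof
    fix y assume y: "y \<in> Y"
    define k where "k = (LEAST k. k > 0 \<and> y [^]\<^bsub>E\<^esub> (k::nat) \<in> N)"
    have k: "k > 0" "y [^]\<^bsub>E\<^esub> k \<in> N" using LeastI_ex[OF pow[OF y]] by (auto simp: k_def)
    have notin: "y [^]\<^bsub>E\<^esub> i \<notin> N" if "0 < i" "i < k" for i :: nat
      using not_less_Least[of i "\<lambda>k. k > 0 \<and> y [^]\<^bsub>E\<^esub> (k::nat) \<in> N"] that by (auto simp: k_def)
    have "\<Phi> (y [^]\<^bsub>E\<^esub> Suc i) = y" if "Suc i \<le> k" for i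
      using that
    proof (induction i)
      case 0
      then show ?case using \<Phi>(3)[OF one_closed y] \<Phi>(2) YE[OF y] subgroup.one_closed[OF N] by simp
    next
      case (Suc i)
      have "\<Phi> (y [^]\<^bsub>E\<^esub> Suc i \<otimes>\<^bsub>E\<^esub> id y) = \<Phi> (y [^]\<^bsub>E\<^esub> Suc i) \<otimes>\<^bsub>E\<^esub> \<one>\<^bsub>E\<^esub>"
        using \<Phi>(3)[OF _ y, of "y [^]\<^bsub>E\<^esub> Suc i"] notin[of "Suc i"] Suc.prems YE[OF y] by simp
      then show ?case using Suc YE[OF y] by simp
    qed
    from this[of "k - 1"] have "\<Phi> (y [^]\<^bsub>E\<^esub> k) = y" using k by simp
    then show "y \<in> \<Phi> ` N" using k(2) by (metis image_eqI)
  qed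
  then have "generate E Y \<subseteq> \<Phi> ` N" using img by (rule generate_subgroup_incl)
  then have "carrier E \<subseteq> \<Phi> ` N" using generate_generators by simp
  then show ?thesis using hom \<Phi>(1) NE by blast
qed

section \<open>Transport of bases and construction of free quotients\<close>

lemma freely_generates_subset_basis:
  assumes F: "freely_generates F S" and Y: "Y \<subseteq> S"
  shows "freely_generates (F\<lparr>carrier := generate F Y\<rparr>) Y"
proof -
  interpret group F using F by (rule freely_generates_group)
  let ?H = "generate F Y"
  have YF: "Y \<subseteq> carrier F" using freely_generates_subset[OF F] Y by blast
  have H: "subgroup ?H F" using YF by (rule generate_is_subgroup)
  have YH: "Y \<subseteq> ?H" by (auto intro: generate.incl)
  have val: "word_value (F\<lparr>carrier := ?H\<rparr>) w = word_value F w \<and> word_value F w \<in> ?H" if "fst ` set w \<subseteq> Y" for w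
    using that
  proof (induction w)
    case Nil
    then show ?case using subgroup.one_closed[OF H] by simp
  next
    case (Cons l w)
    then have "fst l \<in> ?H" using YH by auto
    then show ?case using Cons H by (auto simp: subgroup.m_closed subgroup.m_inv_closed m_inv_consistent)
  qed
  let ?W = "{w. reduced_word w \<and> fst ` set w \<subseteq> Y}"
  have "bij_betw (word_value (F\<lparr>carrier := ?H\<rparr>)) ?W ?H" unfolding bij_betw_def
  proof
    have "inj_on (word_value F) {w. reduced_word w \<and> fst ` set w \<subseteq> S}"
      using F by (simp add: freely_generates_def bij_betw_def)
    then have "inj_on (word_value F) ?W" by (rule inj_on_subset) (use Y in auto)
    moreover have "inj_on (word_value (F\<lparr>carrier := ?H\<rparr>)) ?W \<longleftrightarrow> inj_on (word_value F) ?W"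
      by (rule inj_on_cong) (use val in auto)
    ultimately show "inj_on (word_value (F\<lparr>carrier := ?H\<rparr>)) ?W" by blast
    have ex: "\<exists>w. fst ` set w \<subseteq> Y \<and> word_value F w = h" if "h \<in> ?H" for h
      using that
    proof (induction rule: generate.induct)
      case one
      then show ?case by (intro exI[of _ "[]"]) simp
    next
      case (incl h)
      then show ?case using YF by (intro exI[of _ "[(h, True)]"]) auto
    next
      case (inv h)
      then show ?case using YF by (intro exI[of _ "[(h, False)]"]) auto
    next
      case (eng h1 h2)
      then obtain v w where vw: "fst ` set v \<subseteq> Y" "word_value F v = h1" "fst ` set w \<subseteq> Y" "word_value F w = h2"
        by blast
      then show ?case using YF word_value_append[of v w] by (intro exI[of _ "v @ w"]) auto
    qed
    show "word_value (F\<lparr>carrier := ?H\<rparr>) ` ?W = ?H"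
    proof (intro equalityI subsetI)
      fix h assume "h \<in> ?H"
      then obtain w where w: "fst ` set w \<subseteq> Y" "word_value F w = h" using ex by blast
      have r: "fst ` set (reduce w) \<subseteq> Y" using w(1) image_mono[OF set_reduce[of w], of fst] by blast
      have "word_value F (reduce w) = h" using word_value_reduce[of w] w YF by auto
      then have "word_value (F\<lparr>carrier := ?H\<rparr>) (reduce w) = h" using val[OF r] by simp
      moreover have "reduce w \<in> ?W" using r by (simp add: reduced_reduce)
      ultimately show "h \<in> word_value (F\<lparr>carrier := ?H\<rparr>) ` ?W" by blast
    qed (use val in auto)
  qed
  then show ?thesis unfolding freely_generates_def
    using subgroup_imp_group[OF H] YH by simp
qed

lemma free_not_commute:
  assumes F: "freely_generates F S" and xy: "x \<in> S" "y \<in> S" "x \<noteq> y"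
  shows "x \<otimes>\<^bsub>F\<^esub> y \<noteq> y \<otimes>\<^bsub>F\<^esub> x"
proof
  interpret group F using F by (rule freely_generates_group)
  assume eq: "x \<otimes>\<^bsub>F\<^esub> y = y \<otimes>\<^bsub>F\<^esub> x"
  have c: "x \<in> carrier F" "y \<in> carrier F" using xy freely_generates_subset[OF F] by auto
  have "inj_on (word_value F) {w. reduced_word w \<and> fst ` set w \<subseteq> S}"
    using F by (simp add: freely_generates_def bij_betw_def)
  moreover have "word_value F [(x, True), (y, True)] = word_value F [(y, True), (x, True)]"
    using eq c by simp
  ultimately have "[(x, True), (y, True)] = [(y, True), (x, True)]"
    by (rule inj_onD) (use xy in \<open>auto simp: reduced_word_def\<close>)
  then show False using xy by simp
qed

lemma freely_generates_iso:
  assumes E: "freely_generates E Y" and f: "f \<in> iso E E'" and E': "group E'"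
  shows "freely_generates E' (f ` Y)"
proof -
  interpret E: group E using E by (rule freely_generates_group)
  interpret E': group E' by fact
  interpret f: group_hom E E' f using f by unfold_locales (simp add: iso_def)
  have bij: "bij_betw f (carrier E) (carrier E')" using f by (simp add: iso_def)
  have YE: "Y \<subseteq> carrier E" using E by (rule freely_generates_subset)
  have inj: "inj_on f Y" using bij YE by (meson bij_betw_imp_inj_on inj_on_subset)
  let ?m = "map (\<lambda>(s, b). (f s, b))"
  have val: "word_value E' (?m w) = f (word_value E w)" if "fst ` set w \<subseteq> Y" for w
    using that
  proof (induction w)
    case (Cons l w)
    then have "fst l \<in> carrier E" "word_value E w \<in> carrier E" using YE E.word_value_closed[of w] by auto
    then show ?case using Cons by (simp add: split_beta)
  qed simp
  have red: "reduced_word (?m w) \<longleftrightarrow> reduced_word w" if "fst ` set w \<subseteq> Y" for w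
    unfolding reduced_word_def successively_map
    by (rule successively_cong) (use that inj in \<open>auto simp: inj_on_def split_beta image_subset_iff\<close>)
  let ?W = "{w. reduced_word w \<and> fst ` set w \<subseteq> Y}" and ?W' = "{w. reduced_word w \<and> fst ` set w \<subseteq> f ` Y}"
  have W': "?W' = ?m ` ?W"
  proof (intro equalityI subsetI)
    fix w assume w: "w \<in> ?W'"
    define v where "v = map (\<lambda>(s, b). (inv_into Y f s, b)) w"
    have "?m v = map id w" unfolding v_def map_map
      by (rule map_cong) (use w in \<open>auto simp: f_inv_into_f split_beta image_subset_iff\<close>)
    moreover have "fst ` set v \<subseteq> Y" using w by (auto simp: v_def inv_into_into split_beta image_subset_iff)
    ultimately show "w \<in> ?m ` ?W" using w red[of v] by (intro image_eqI[of _ _ v]) auto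
  next
    fix w assume "w \<in> ?m ` ?W"
    then obtain v where v: "w = ?m v" "reduced_word v" "fst ` set v \<subseteq> Y" by blast
    have "fst ` set w \<subseteq> f ` Y" using v(1,3) by (auto simp: split_beta image_subset_iff)
    then show "w \<in> ?W'" using v red by simp
  qed
  have bijE: "bij_betw (word_value E) ?W (carrier E)" using E by (simp add: freely_generates_def)
  have "bij_betw (f \<circ> word_value E) ?W (carrier E')" using bijE bij by (rule bij_betw_trans)
  then have comp: "bij_betw (word_value E' \<circ> ?m) ?W (carrier E')"
    by (rule bij_betw_cong[THEN iffD1, rotated]) (simp add: val)
  then have "bij_betw (word_value E') ?W' (carrier E')" unfolding W'
    by (metis (no_types, lifting) bij_betw_def image_comp inj_on_imageI)
  then show ?thesis using YE E' by (auto simp: freely_generates_def)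
qed

lemma has_nonabelian_free_quotientI:
  assumes H: "group H" and E: "nonabelian_free E" and h: "h \<in> hom H E" "h ` carrier H = carrier E"
  shows "has_nonabelian_free_quotient H"
proof -
  obtain Y where Y: "freely_generates E Y" and nc: "\<not> comm_group E" using E by (auto simp: nonabelian_free_def)
  interpret H: group H by fact
  interpret E: group E using Y by (rule freely_generates_group)
  interpret h: group_hom H E h by unfold_locales (rule h)
  let ?K = "kernel H E h"
  interpret K: normal ?K H by (rule h.normal_kernel)
  have Mod: "group (H Mod ?K)" by (rule K.factorgroup_is_group)
  have "(H Mod ?K) \<cong> E" using h(2) by (rule h.FactGroup_iso)
  then have "E \<cong> (H Mod ?K)" by (rule group.iso_sym[OF Mod])
  then obtain f where f: "f \<in> iso E (H Mod ?K)" by (auto simp: is_iso_def)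
  have "freely_generates (H Mod ?K) (f ` Y)" by (rule freely_generates_iso[OF Y f Mod])
  moreover have "\<not> comm_group (H Mod ?K)"
  proof
    assume comm: "comm_group (H Mod ?K)"
    have fh: "f \<in> hom E (H Mod ?K)" and inj: "inj_on f (carrier E)"
      using f by (auto simp: iso_def bij_betw_def)
    have "comm_group E"
    proof (rule E.group_comm_groupI)
      fix x y assume xy: "x \<in> carrier E" "y \<in> carrier E"
      have "f (x \<otimes>\<^bsub>E\<^esub> y) = f (y \<otimes>\<^bsub>E\<^esub> x)"
        using xy fh comm_monoid.m_comm[OF comm_group.axioms(1)[OF comm], of "f x" "f y"]
        by (simp add: hom_mult hom_in_carrier)
      then show "x \<otimes>\<^bsub>E\<^esub> y = y \<otimes>\<^bsub>E\<^esub> x" using inj xy by (auto dest: inj_onD)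
    qed
    then show False using nc by simp
  qed
  ultimately have "nonabelian_free (H Mod ?K)" by (auto simp: nonabelian_free_def)
  then show ?thesis using h.normal_kernel by (auto simp: has_nonabelian_free_quotient_def)
qed

text \<open>The image of \<open>M\<close> contains positive powers of \<open>x\<close> and
  \<open>y\<close>, because powers of their preimages return to \<open>M\<close> by finiteness of
  the index. Composing with the map of \<open>free_subgroup_onto\<close> therefore makes
  \<open>M\<close> surject onto the free group on \<open>x\<close> and \<open>y\<close>.\<close>

lemma (in group) finite_index_free_quotient:
  assumes L1: "subgroup L1 G" and M: "subgroup M G" "M \<subseteq> L1" "finite (rcosets M)"
    and F: "freely_generates F S" and xy: "x \<in> S" "y \<in> S" "x \<noteq> y"
    and h: "h \<in> hom (G\<lparr>carrier := L1\<rparr>) (F\<lparr>carrier := generate F {x, y}\<rparr>)" "x \<in> h ` L1" "y \<in> h ` L1"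
  shows "has_nonabelian_free_quotient (G\<lparr>carrier := M\<rparr>)"
proof -
  let ?E = "F\<lparr>carrier := generate F {x, y}\<rparr>"
  have free: "freely_generates ?E {x, y}" using F by (rule freely_generates_subset_basis) (use xy in auto)
  interpret E: group ?E using free by (rule freely_generates_group)
  interpret L1: group "G\<lparr>carrier := L1\<rparr>" using L1 by (rule subgroup_imp_group)
  interpret M: group "G\<lparr>carrier := M\<rparr>" using M(1) by (rule subgroup_imp_group)
  interpret h: group_hom "G\<lparr>carrier := L1\<rparr>" ?E h by unfold_locales (rule h(1))
  have hM: "h \<in> hom (G\<lparr>carrier := M\<rparr>) ?E" using h(1) M(2) by (auto simp: hom_def)
  interpret hM: group_hom "G\<lparr>carrier := M\<rparr>" ?E h by unfold_locales (rule hM)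
  have img: "subgroup (h ` M) ?E" using hM.img_is_subgroup by simp
  have pow: "\<exists>k>0. z [^]\<^bsub>?E\<^esub> (k::nat) \<in> h ` M" if z: "z \<in> {x, y}" for z
  proof -
    obtain g where g: "g \<in> L1" "h g = z" using z h(2,3) by auto
    have gG: "g \<in> carrier G" using L1 g(1) by (rule subgroup.mem_carrier)
    have "\<not> inj_on (\<lambda>n::nat. M #> (g [^] n)) UNIV"
    proof
      assume "inj_on (\<lambda>n::nat. M #> (g [^] n)) UNIV"
      moreover have "finite (range (\<lambda>n::nat. M #> (g [^] n)))"
        by (rule finite_subset[OF _ M(3)]) (auto intro!: coset_in_rcosets gG)
      ultimately show False using finite_imageD infinite_UNIV_nat by blast
    qed
    then obtain a b :: nat where ab: "a \<noteq> b" "M #> (g [^] a) = M #> (g [^] b)" unfolding inj_on_def by blast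
    define i j where "i = min a b" "j = max a b"
    have ij: "i < j" "M #> (g [^] j) = M #> (g [^] i)"
      using ab by (auto simp: i_j_def min_def max_def)
    have "g [^] j \<otimes> inv (g [^] i) \<in> M" using ij(2) gG coset_eq_iff[OF M(1)] by simp
    moreover have "g [^] j = g [^] (j - i) \<otimes> g [^] i" using ij gG by (simp add: nat_pow_mult)
    ultimately have "g [^] (j - i) \<in> M" using gG by (simp add: m_assoc)
    moreover have "h (g [^]\<^bsub>G\<lparr>carrier := L1\<rparr>\<^esub> (j - i)) = z [^]\<^bsub>?E\<^esub> (j - i)"
      using h.hom_nat_pow[of g "j - i"] g by simp
    moreover have "g [^]\<^bsub>G\<lparr>carrier := L1\<rparr>\<^esub> n = g [^] n" for n :: nat by (simp add: nat_pow_def)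
    ultimately have "z [^]\<^bsub>?E\<^esub> (j - i) \<in> h ` M" by (metis image_eqI)
    then show ?thesis using ij(1) by (intro exI[of _ "j - i"]) simp
  qed
  obtain \<chi> where \<chi>: "\<chi> \<in> hom (?E\<lparr>carrier := h ` M\<rparr>) ?E" "\<chi> ` h ` M = carrier ?E"
    using free_subgroup_onto[OF free _ img pow] by auto
  have "nonabelian_free ?E" unfolding nonabelian_free_def
  proof (intro conjI exI notI)
    show "freely_generates ?E {x, y}" by (rule free)
    assume "comm_group ?E"
    then interpret c: comm_group ?E .
    have "x \<otimes>\<^bsub>?E\<^esub> y = y \<otimes>\<^bsub>?E\<^esub> x"
      by (rule c.m_comm) (use freely_generates_subset[OF free] in auto)
    then show False using free_not_commute[OF F xy] by simp
  qed
  moreover have "\<chi> \<circ> h \<in> hom (G\<lparr>carrier := M\<rparr>) ?E"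
  proof -
    have "h \<in> hom (G\<lparr>carrier := M\<rparr>) (?E\<lparr>carrier := h ` M\<rparr>)" using hM by (auto simp: hom_def)
    then show ?thesis using \<chi>(1) by (auto simp: hom_def Pi_iff)
  qed
  moreover have "(\<chi> \<circ> h) ` carrier (G\<lparr>carrier := M\<rparr>) = carrier ?E" using \<chi>(2) by (simp add: image_comp)
  ultimately show ?thesis by (intro has_nonabelian_free_quotientI[OF M.is_group])
qed

section \<open>A cocycle of small support yields a free quotient\<close>

context presented_group begin

section \<open>Edges on relator loops and their neighbourhoods\<close>

primrec walk_edges :: "'g \<Rightarrow> ('a \<times> bool) list \<Rightarrow> ('g \<times> 'a) list" where
  "walk_edges g [] = []"
| "walk_edges g (l # w) =
    (if snd l then (g, fst l) # walk_edges (g \<otimes> \<pi> (fst l)) w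
     else (g \<otimes> inv (\<pi> (fst l)), fst l) # walk_edges (g \<otimes> inv (\<pi> (fst l))) w)"

lemma length_walk_edges [simp]: "length (walk_edges g w) = length w"
  by (induction w arbitrary: g) auto

lemma walk_edges_closed:
  "fst ` set w \<subseteq> S \<Longrightarrow> g \<in> carrier G \<Longrightarrow> (x, s) \<in> set (walk_edges g w) \<Longrightarrow> x \<in> carrier G \<and> s \<in> S"
proof (induction w arbitrary: g)
  case (Cons l w)
  then show ?case
    using Cons.IH[of "g \<otimes> \<pi> (fst l)"] Cons.IH[of "g \<otimes> inv \<pi> (fst l)"] by (auto split: if_splits)
qed simp

lemma walk_edges_translate:
  "fst ` set w \<subseteq> S \<Longrightarrow> l \<in> carrier G \<Longrightarrow> g \<in> carrier G \<Longrightarrow>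
     walk_edges (l \<otimes> g) w = map (\<lambda>(x, s). (l \<otimes> x, s)) (walk_edges g w)"
  by (induction w arbitrary: g) (auto simp: m_assoc)

text \<open>The labels are constrained only along the walk in question, so one labelling may come
  from different potentials on different loops.\<close>

lemma walk_telescope:
  assumes E: "group E" and Y: "\<And>x. x \<in> carrier G \<Longrightarrow> Y x \<in> carrier E"
    and w: "fst ` set w \<subseteq> S" "g \<in> carrier G"
    and lab: "\<And>x s. (x, s) \<in> set (walk_edges g w) \<Longrightarrow> lab x s = Y x \<otimes>\<^bsub>E\<^esub> inv\<^bsub>E\<^esub> (Y (x \<otimes> \<pi> s))"
  shows "walk E lab g w = Y g \<otimes>\<^bsub>E\<^esub> inv\<^bsub>E\<^esub> (Y (walk_end g w))"
proof -
  interpret E: group E by fact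
  show ?thesis using w lab
  proof (induction w arbitrary: g)
    case (Cons l w)
    show ?case
    proof (cases "snd l")
      case True
      let ?g = "g \<otimes> \<pi> (fst l)"
      have g: "?g \<in> carrier G" "walk_end ?g w \<in> carrier G"
        using Cons.prems by (auto intro: walk_end_closed)
      have "walk E lab ?g w = Y ?g \<otimes>\<^bsub>E\<^esub> inv\<^bsub>E\<^esub> (Y (walk_end ?g w))"
        by (rule Cons.IH) (use Cons.prems True g in auto)
      moreover have "lab g (fst l) = Y g \<otimes>\<^bsub>E\<^esub> inv\<^bsub>E\<^esub> (Y ?g)" using Cons.prems(3) True by simp
      ultimately show ?thesis using True Y[OF g(1)] Y[OF g(2)] Y[OF Cons.prems(2)]
        by (simp add: E.m_assoc) (simp add: E.m_assoc[symmetric])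
    next
      case False
      let ?g = "g \<otimes> inv (\<pi> (fst l))"
      have l: "fst l \<in> S" using Cons.prems by simp
      have g: "?g \<in> carrier G" "walk_end ?g w \<in> carrier G" "?g \<otimes> \<pi> (fst l) = g"
        using Cons.prems l by (auto intro: walk_end_closed simp: m_assoc)
      have "walk E lab ?g w = Y ?g \<otimes>\<^bsub>E\<^esub> inv\<^bsub>E\<^esub> (Y (walk_end ?g w))"
        by (rule Cons.IH) (use Cons.prems False g in auto)
      moreover have "lab ?g (fst l) = Y ?g \<otimes>\<^bsub>E\<^esub> inv\<^bsub>E\<^esub> (Y (?g \<otimes> \<pi> (fst l)))"
        by (rule Cons.prems(3)) (use False in simp)
      then have "inv\<^bsub>E\<^esub> (lab ?g (fst l)) = Y g \<otimes>\<^bsub>E\<^esub> inv\<^bsub>E\<^esub> (Y ?g)"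
        using g(3) Y[OF g(1)] Y[OF Cons.prems(2)] by (simp add: E.inv_mult_group)
      ultimately show ?thesis using False Y[OF g(1)] Y[OF g(2)] Y[OF Cons.prems(2)]
        by (simp add: E.m_assoc) (simp add: E.m_assoc[symmetric])
    qed
  qed (use Y in simp)
qed

definition relator_length :: nat where
  "relator_length = (\<Sum>r\<in>R. length (\<rho> r))"

definition coset_edges :: "'g set \<Rightarrow> 'g \<Rightarrow> ('a \<times> bool) list \<Rightarrow> ('g set \<times> 'a) set" where
  "coset_edges L g w = (\<lambda>(x, s). (L #> x, s)) ` set (walk_edges g w)"

lemma coset_edges_translate:
  assumes L: "subgroup L G" and w: "fst ` set w \<subseteq> S" and l: "l \<in> L" and g: "g \<in> carrier G"
  shows "coset_edges L (l \<otimes> g) w = coset_edges L g w"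
proof -
  have lG: "l \<in> carrier G" using L l by (rule subgroup.mem_carrier)
  have "coset_edges L (l \<otimes> g) w = (\<lambda>(x, s). (L #> (l \<otimes> x), s)) ` set (walk_edges g w)"
    unfolding coset_edges_def walk_edges_translate[OF w lG g] by (simp add: image_image split_beta)
  also have "\<dots> = coset_edges L g w" unfolding coset_edges_def
    by (rule image_cong) (use walk_edges_closed[OF w g] coset_mult_left[OF L l] in auto)
  finally show ?thesis .
qed

text \<open>A cocycle that vanishes on this set vanishes along every relator loop meeting
  \<open>A\<close>, which keeps it from interacting with a cocycle supported on
  \<open>A\<close>.\<close>

definition relator_neighbourhood :: "'g set \<Rightarrow> ('g set \<times> 'a) set \<Rightarrow> ('g set \<times> 'a) set" where
  "relator_neighbourhood L A = (\<Union>(X, r)\<in>{(X, r) \<in> (rcosets L) \<times> R. coset_edges L (coset_rep G L X) (\<rho> r) \<inter> A \<noteq> {}}.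
     coset_edges L (coset_rep G L X) (\<rho> r))"

text \<open>Each edge of the Schreier graph lies on at most \<open>relator_length\<close> relator loops, each of at most that length.\<close>

lemma card_relator_neighbourhood:
  assumes L: "subgroup L G" and fin: "finite A"
  shows "finite (relator_neighbourhood L A)"
    "card (relator_neighbourhood L A) \<le> relator_length * relator_length * card A"
proof -
  let ?r = "coset_rep G L"
  let ?bad = "{(X, r) \<in> (rcosets L) \<times> R. coset_edges L (?r X) (\<rho> r) \<inter> A \<noteq> {}}"
  let ?q = "\<lambda>r i. fst (walk_edges \<one> (\<rho> r) ! i)"
  let ?I = "SIGMA r:R. {..<length (\<rho> r)} \<times> A"
  \<comment> \<open>A loop through the edge \<open>e\<close> is determined by its relator and the
    position \<open>i\<close> of \<open>e\<close> on it: the base coset is found by moving back by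
    \<open>?q r i\<close>, the initial vertex of that edge on the loop at the identity.\<close>
  let ?f = "\<lambda>(r, i, e). (fst e #> inv (?q r i), r)"
  have finI: "finite ?I" using finite_R fin by auto
  have sub: "?bad \<subseteq> ?f ` ?I"
  proof
    fix y assume "y \<in> ?bad"
    then obtain X r where y: "y = (X, r)" "X \<in> rcosets L" "r \<in> R" "coset_edges L (?r X) (\<rho> r) \<inter> A \<noteq> {}" by blast
    let ?z = "?r X"
    have z: "?z \<in> carrier G" "L #> ?z = X" using coset_rep[OF L y(2)] by auto
    obtain x s where xs: "(x, s) \<in> set (walk_edges ?z (\<rho> r))" "(L #> x, s) \<in> A"
      using y(4) by (auto simp: coset_edges_def)
    then obtain i where i: "i < length (\<rho> r)" "walk_edges ?z (\<rho> r) ! i = (x, s)"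
      by (metis in_set_conv_nth length_walk_edges)
    have "walk_edges ?z (\<rho> r) = map (\<lambda>(x, s). (?z \<otimes> x, s)) (walk_edges \<one> (\<rho> r))"
      using walk_edges_translate[OF rel_over[OF y(3)] z(1) one_closed] z(1) by simp
    then have x: "x = ?z \<otimes> ?q r i" using i by (simp add: split_beta)
    have "walk_edges \<one> (\<rho> r) ! i \<in> set (walk_edges \<one> (\<rho> r))" using i by simp
    then have q: "?q r i \<in> carrier G"
      using walk_edges_closed[OF rel_over[OF y(3)] one_closed] by (metis prod.collapse)
    have "(L #> x) #> inv (?q r i) = L #> (?z \<otimes> ?q r i \<otimes> inv (?q r i))"
      unfolding x using z q subgroup.subset[OF L] by (intro coset_mult_assoc) auto
    also have "\<dots> = X" using z q by (simp add: m_assoc)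
    finally show "y \<in> ?f ` ?I" using y i xs by (intro image_eqI[of _ _ "(r, i, (L #> x, s))"]) auto
  qed
  have finbad: "finite ?bad" by (rule finite_subset[OF sub finite_imageI[OF finI]])
  have "card ?bad \<le> card (?f ` ?I)" by (rule card_mono[OF finite_imageI[OF finI] sub])
  also have "\<dots> \<le> card ?I" using finI by (rule card_image_le)
  also have "\<dots> = relator_length * card A"
    using finite_R fin by (simp add: card_SigmaI card_cartesian_product relator_length_def sum_distrib_right)
  finally have bad: "card ?bad \<le> relator_length * card A" .
  have edges: "finite (coset_edges L g w)" "card (coset_edges L g w) \<le> length w" for g w
  proof -
    show "finite (coset_edges L g w)" by (simp add: coset_edges_def)
    have "card (coset_edges L g w) \<le> card (set (walk_edges g w))"
      unfolding coset_edges_def by (rule card_image_le) simp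
    also have "\<dots> \<le> length w" using card_length[of "walk_edges g w"] by simp
    finally show "card (coset_edges L g w) \<le> length w" .
  qed
  show "finite (relator_neighbourhood L A)"
    unfolding relator_neighbourhood_def using finbad edges(1) by (intro finite_UN_I) auto
  have "card (relator_neighbourhood L A) \<le> (\<Sum>(X, r)\<in>?bad. card (coset_edges L (?r X) (\<rho> r)))"
    unfolding relator_neighbourhood_def using card_UN_le[OF finbad, of "\<lambda>(X, r). coset_edges L (?r X) (\<rho> r)"]
    by (simp add: split_beta)
  also have "\<dots> \<le> (\<Sum>y\<in>?bad. relator_length)"
  proof (rule sum_mono, clarify)
    fix X r assume "r \<in> R"
    then have "length (\<rho> r) \<le> relator_length" unfolding relator_length_def
      using finite_R by (intro member_le_sum) auto
    then show "card (coset_edges L (?r X) (\<rho> r)) \<le> relator_length" using edges(2) le_trans by blast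
  qed
  also have "\<dots> = card ?bad * relator_length" by simp
  also have "\<dots> \<le> (relator_length * card A) * relator_length" using bad by (rule mult_le_mono1)
  finally show "card (relator_neighbourhood L A) \<le> relator_length * relator_length * card A"
    by (simp add: mult_ac)
qed

section \<open>Connectivity away from the support of a cocycle\<close>

definition support :: "nat \<Rightarrow> 'g set \<Rightarrow> ('g \<Rightarrow> int) \<Rightarrow> ('g set \<times> 'a) set" where
  "support p L \<phi> = edge_support p L (\<lambda>_. \<phi>) 1"

lemma support_iff:
  assumes "subgroup L G" "quasi_additive p G L \<phi>" "g \<in> carrier G" "s \<in> S"
  shows "(L #> g, s) \<in> support p L \<phi> \<longleftrightarrow> \<not> int p dvd \<phi> (g \<otimes> \<pi> s) - \<phi> g"
  using edge_support_iff[OF assms(1) _ assms(3,4), of 1 p "\<lambda>_. \<phi>"] assms(2) by (simp add: support_def)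

lemma finite_support: "finite (rcosets L) \<Longrightarrow> finite (support p L \<phi>)"
  by (simp add: support_def finite_edge_support)

definition flat_step :: "nat \<Rightarrow> ('g \<Rightarrow> int) \<Rightarrow> ('g \<times> 'g) set" where
  "flat_step p \<phi> = {(g, g \<otimes> \<pi> s) | g s. g \<in> carrier G \<and> s \<in> S \<and> int p dvd \<phi> (g \<otimes> \<pi> s) - \<phi> g}"

text \<open>Its classes in \<open>G\<close> are the components of the Cayley graph after deleting
  all edges along which \<open>\<phi>\<close> changes modulo \<open>p\<close>.\<close>

definition flat_connected :: "nat \<Rightarrow> ('g \<Rightarrow> int) \<Rightarrow> ('g \<times> 'g) set" where
  "flat_connected p \<phi> = (flat_step p \<phi> \<union> (flat_step p \<phi>)\<inverse>)\<^sup>*"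

lemma flat_connected_sym: "(x, y) \<in> flat_connected p \<phi> \<Longrightarrow> (y, x) \<in> flat_connected p \<phi>"
  unfolding flat_connected_def by (rule symD[OF sym_rtrancl]) (auto simp: sym_def)

lemma flat_connected_trans:
  "(x, y) \<in> flat_connected p \<phi> \<Longrightarrow> (y, z) \<in> flat_connected p \<phi> \<Longrightarrow> (x, z) \<in> flat_connected p \<phi>"
  unfolding flat_connected_def by (rule rtrancl_trans)

lemma flat_connected_refl: "(x, x) \<in> flat_connected p \<phi>"
  by (simp add: flat_connected_def)

lemma flat_connected_step:
  "g \<in> carrier G \<Longrightarrow> s \<in> S \<Longrightarrow> int p dvd \<phi> (g \<otimes> \<pi> s) - \<phi> g \<Longrightarrow> (g, g \<otimes> \<pi> s) \<in> flat_connected p \<phi>"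
  unfolding flat_connected_def by (rule r_into_rtrancl) (auto simp: flat_step_def)

lemma flat_connected_induct:
  assumes xy: "(x, y) \<in> flat_connected p \<phi>" and x: "x \<in> carrier G"
    and one: "P x"
    and step: "\<And>g s. g \<in> carrier G \<Longrightarrow> s \<in> S \<Longrightarrow> int p dvd \<phi> (g \<otimes> \<pi> s) - \<phi> g \<Longrightarrow> P g \<longleftrightarrow> P (g \<otimes> \<pi> s)"
  shows "y \<in> carrier G \<and> P y"
  using xy unfolding flat_connected_def
proof (induction rule: rtrancl_induct)
  case (step y z)
  then consider g s where "g \<in> carrier G" "s \<in> S" "int p dvd \<phi> (g \<otimes> \<pi> s) - \<phi> g" "y = g" "z = g \<otimes> \<pi> s"
    | g s where "g \<in> carrier G" "s \<in> S" "int p dvd \<phi> (g \<otimes> \<pi> s) - \<phi> g" "z = g" "y = g \<otimes> \<pi> s"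
    by (auto simp: flat_step_def)
  then show ?case using step.IH assms(4) by cases auto
qed (use x one in auto)

lemma flat_connected_closed: "(x, y) \<in> flat_connected p \<phi> \<Longrightarrow> x \<in> carrier G \<Longrightarrow> y \<in> carrier G"
  using flat_connected_induct[of x y p \<phi> "\<lambda>_. True"] by simp

lemma flat_connected_value:
  "(x, y) \<in> flat_connected p \<phi> \<Longrightarrow> x \<in> carrier G \<Longrightarrow> int p dvd \<phi> y - \<phi> x"
proof -
  assume xy: "(x, y) \<in> flat_connected p \<phi>" and x: "x \<in> carrier G"
  have "y \<in> carrier G \<and> int p dvd \<phi> y - \<phi> x"
  proof (rule flat_connected_induct[OF xy x])
    fix g s assume "int p dvd \<phi> (g \<otimes> \<pi> s) - \<phi> g"
    then have "[\<phi> (g \<otimes> \<pi> s) - \<phi> x = \<phi> g - \<phi> x] (mod int p)" by (simp add: cong_iff_dvd_diff)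
    then show "int p dvd \<phi> g - \<phi> x \<longleftrightarrow> int p dvd \<phi> (g \<otimes> \<pi> s) - \<phi> x" by (simp add: cong_dvd_iff)
  qed simp
  then show ?thesis by simp
qed

context
  fixes L and p :: nat and \<phi>
  assumes L: "subgroup L G" and \<phi>: "quasi_additive p G L \<phi>"
begin

lemma flat_connected_translate:
  assumes xy: "(x, y) \<in> flat_connected p \<phi>" and x: "x \<in> carrier G" and l: "l \<in> L"
  shows "(l \<otimes> x, l \<otimes> y) \<in> flat_connected p \<phi>"
proof -
  have lG: "l \<in> carrier G" using L l by (rule subgroup.mem_carrier)
  have "y \<in> carrier G \<and> (l \<otimes> x, l \<otimes> y) \<in> flat_connected p \<phi>"
  proof (rule flat_connected_induct[OF xy x flat_connected_refl])
    fix g s assume g: "g \<in> carrier G" and s: "s \<in> S" and d: "int p dvd \<phi> (g \<otimes> \<pi> s) - \<phi> g"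
    have "int p dvd \<phi> (l \<otimes> g \<otimes> \<pi> s) - \<phi> (l \<otimes> g)"
      using cong_dvd_iff[OF quasi_additive_difference[OF L \<phi> l g, of "\<pi> s"]] d s by simp
    then have "(l \<otimes> g, l \<otimes> g \<otimes> \<pi> s) \<in> flat_connected p \<phi>" using g s lG by (intro flat_connected_step) auto
    then have e: "(l \<otimes> g, l \<otimes> (g \<otimes> \<pi> s)) \<in> flat_connected p \<phi>" using g s lG by (simp add: m_assoc)
    show "(l \<otimes> x, l \<otimes> g) \<in> flat_connected p \<phi> \<longleftrightarrow> (l \<otimes> x, l \<otimes> (g \<otimes> \<pi> s)) \<in> flat_connected p \<phi>"
      using e flat_connected_trans flat_connected_sym by blast
  qed
  then show ?thesis by simp
qed

text \<open>If some cosets were unreachable, shifting \<open>\<phi>\<close> by a constant on them would remove a boundary edge from its support.\<close>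

lemma minimal_support_connected:
  assumes fin: "finite (rcosets L)" and nontriv: "\<exists>l\<in>L. \<not> int p dvd \<phi> l"
    and min: "\<And>\<phi>'. quasi_additive p G L \<phi>' \<Longrightarrow> \<exists>l\<in>L. \<not> int p dvd \<phi>' l \<Longrightarrow>
      card (support p L \<phi>) \<le> card (support p L \<phi>')"
    and g: "g \<in> carrier G"
  shows "\<exists>a. (\<one>, a) \<in> flat_connected p \<phi> \<and> L #> a = L #> g"
proof (rule ccontr)
  \<comment> \<open>The union of the cosets of \<open>L\<close> that meet the component of the
    identity. An edge leaving \<open>V\<close> must belong to the support, since otherwise a
    translate by \<open>L\<close> would continue the component across it.\<close>
  define V where "V = {x \<in> carrier G. \<exists>a. (\<one>, a) \<in> flat_connected p \<phi> \<and> L #> a = L #> x}"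
  assume "\<not> ?thesis"
  then have gV: "g \<notin> V" by (auto simp: V_def)
  have V_coset: "x \<in> V \<longleftrightarrow> y \<in> V" if "x \<in> carrier G" "y \<in> carrier G" "L #> x = L #> y" for x y
    using that by (auto simp: V_def)
  have LV: "l \<in> V" if l: "l \<in> L" for l
    using coset_self[OF L l] coset_one[OF L] subgroup.mem_carrier[OF L l] flat_connected_refl[of \<one>]
    unfolding V_def by blast
  have boundary: "\<not> int p dvd \<phi> (x \<otimes> \<pi> s) - \<phi> x"
    if x: "x \<in> carrier G" and s: "s \<in> S" and b: "(x \<in> V) \<noteq> (x \<otimes> \<pi> s \<in> V)" for x s
  proof
    assume d: "int p dvd \<phi> (x \<otimes> \<pi> s) - \<phi> x"
    have *: "y' \<in> V" if V: "y \<in> V" and yy': "(y, y') \<in> flat_connected p \<phi>" for y y'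
    proof -
      obtain a where a: "(\<one>, a) \<in> flat_connected p \<phi>" "L #> a = L #> y" and y: "y \<in> carrier G"
        using V by (auto simp: V_def)
      have aG: "a \<in> carrier G" using flat_connected_closed[OF a(1) one_closed] .
      have y'G: "y' \<in> carrier G" using flat_connected_closed[OF yy' y] .
      define l where "l = a \<otimes> inv y"
      have l: "l \<in> L" using a(2) coset_eq_iff[OF L aG y] by (simp add: l_def)
      have lG: "l \<in> carrier G" using L l by (rule subgroup.mem_carrier)
      have "(l \<otimes> y, l \<otimes> y') \<in> flat_connected p \<phi>" by (rule flat_connected_translate[OF yy' y l])
      moreover have "l \<otimes> y = a" using aG y by (simp add: l_def m_assoc)
      ultimately have "(\<one>, l \<otimes> y') \<in> flat_connected p \<phi>" using a(1) flat_connected_trans by blast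
      then show ?thesis using coset_mult_left[OF L l y'G] y'G by (auto simp: V_def)
    qed
    have e: "(x, x \<otimes> \<pi> s) \<in> flat_connected p \<phi>" using x s d by (rule flat_connected_step)
    show False using b *[OF _ e] *[OF _ flat_connected_sym[OF e]] by blast
  qed
  have "\<exists>x s. x \<in> carrier G \<and> s \<in> S \<and> (x \<in> V) \<noteq> (x \<otimes> \<pi> s \<in> V)"
  proof (rule ccontr)
    assume no: "\<not> ?thesis"
    have "g \<in> V" using g
    proof (induction rule: generators_induct)
      case (inv x s)
      then have "x \<otimes> inv \<pi> s \<in> carrier G" "x \<otimes> inv \<pi> s \<otimes> \<pi> s = x" by (simp_all add: m_assoc)
      then show ?case using no inv by metis
    qed (use no LV subgroup.one_closed[OF L] in auto)
    then show False using gV by simp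
  qed
  then obtain x0 s0 where e0: "x0 \<in> carrier G" "s0 \<in> S" "(x0 \<in> V) \<noteq> (x0 \<otimes> \<pi> s0 \<in> V)" by blast
  \<comment> \<open>The shift cancels the jump of \<open>\<phi>\<close> across the chosen boundary
    edge; the sign depends on which end lies outside \<open>V\<close>, where the shift
    applies.\<close>
  define t where "t = (if x0 \<in> V then - 1 else 1) * (\<phi> (x0 \<otimes> \<pi> s0) - \<phi> x0)"
  define \<phi>' where "\<phi>' x = \<phi> x + (if x \<in> V then 0 else t)" for x
  have \<phi>'L: "\<phi>' l = \<phi> l" if "l \<in> L" for l using LV[OF that] by (simp add: \<phi>'_def)
  have quasi': "quasi_additive p G L \<phi>'" unfolding quasi_additive_def
  proof (intro ballI)
    fix l x assume l: "l \<in> L" and x: "x \<in> carrier G"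
    have lG: "l \<in> carrier G" using L l by (rule subgroup.mem_carrier)
    have "l \<otimes> x \<in> V \<longleftrightarrow> x \<in> V" using V_coset[of "l \<otimes> x" x] coset_mult_left[OF L l x] x lG by simp
    then have "[\<phi>' (l \<otimes> x) = (\<phi> l + \<phi> x) + (if x \<in> V then 0 else t)] (mod int p)"
      unfolding \<phi>'_def using quasi_additiveD[OF \<phi> l x] by (intro cong_add) auto
    then show "[\<phi>' (l \<otimes> x) = \<phi>' l + \<phi>' x] (mod int p)" using \<phi>'L[OF l] by (simp add: \<phi>'_def add.assoc)
  qed
  have "support p L \<phi>' \<subseteq> support p L \<phi> - {(L #> x0, s0)}"
  proof
    fix e assume e: "e \<in> support p L \<phi>'"
    then have "e \<in> (rcosets L) \<times> S" using edge_support_subset unfolding support_def by blast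
    then obtain x s where xs: "x \<in> carrier G" "s \<in> S" "e = (L #> x, s)" by (auto simp: rcosets_image)
    have nd: "\<not> int p dvd \<phi>' (x \<otimes> \<pi> s) - \<phi>' x" using e xs support_iff[OF L quasi' xs(1,2)] by simp
    have "\<not> int p dvd \<phi> (x \<otimes> \<pi> s) - \<phi> x"
    proof (cases "(x \<in> V) = (x \<otimes> \<pi> s \<in> V)")
      case True
      then show ?thesis using nd by (auto simp: \<phi>'_def split: if_splits)
    qed (use boundary xs in blast)
    then have "e \<in> support p L \<phi>" using xs support_iff[OF L \<phi> xs(1,2)] by simp
    moreover have "e \<noteq> (L #> x0, s0)"
    proof
      assume "e = (L #> x0, s0)"
      then have "\<not> int p dvd \<phi>' (x0 \<otimes> \<pi> s0) - \<phi>' x0"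
        using e support_iff[OF L quasi' e0(1,2)] by simp
      moreover have "\<phi>' (x0 \<otimes> \<pi> s0) - \<phi>' x0 = 0" using e0(3) by (auto simp: \<phi>'_def t_def)
      ultimately show False by simp
    qed
    ultimately show "e \<in> support p L \<phi> - {(L #> x0, s0)}" by simp
  qed
  moreover have "(L #> x0, s0) \<in> support p L \<phi>"
    using support_iff[OF L \<phi> e0(1,2)] boundary[OF e0] by simp
  ultimately have "support p L \<phi>' \<subset> support p L \<phi>" by blast
  then have "card (support p L \<phi>') < card (support p L \<phi>)"
    using finite_support[OF fin] by (rule psubset_card_mono[rotated])
  moreover have "card (support p L \<phi>) \<le> card (support p L \<phi>')"
    using nontriv \<phi>'L by (intro min[OF quasi']) auto
  ultimately show False by simp
qed

end

text \<open>The target is an arbitrary group \<open>E\<close> with two marked elements.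
  \<open>L\<close> permutes the components left by the support of \<open>\<phi>\<close>, and two
  cocycles independent on the stabiliser \<open>D\<close> of one component label crossings from one
  component to another. These labels are invariant under the common kernel \<open>K\<close>, and
  commutators of a crossing with elements of \<open>D\<close> realise \<open>y1\<close> and
  \<open>y2\<close>. In \<open>room\<close>, each support edge accounts for itself, its
  neighbourhood and its crossing loop; the summand \<open>2\<close> leaves space for the two
  cocycles.\<close>

theorem free_quotient_of_small_support:
  assumes L: "subgroup L G" and fin: "finite (rcosets L)" and p: "prime p"
    and chars: "p ^ u \<le> card (characters p G L)"
    and \<phi>0: "quasi_additive p G L \<phi>0" "\<exists>l\<in>L. \<not> int p dvd \<phi>0 l"
    and room: "(relator_length * relator_length + 2) * card (support p L \<phi>0) + 2 \<le> u"
    and E: "group E" and y12: "y1 \<in> carrier E" "y2 \<in> carrier E"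
  shows "\<exists>K \<Phi>. subgroup K G \<and> K \<subseteq> L \<and> char_kernel p G L \<subseteq> K \<and>
    \<Phi> \<in> hom (G\<lparr>carrier := K\<rparr>) E \<and> y1 \<in> \<Phi> ` K \<and> y2 \<in> \<Phi> ` K"
proof -
  interpret E: group E by fact
  have p0: "p > 0" using p prime_gt_0_nat by blast
  have p1: "\<not> int p dvd 1" using prime_gt_1_nat[OF p] by (simp add: zdvd1_eq)
  have LG: "l \<in> carrier G" if "l \<in> L" for l using that L by (rule subgroup.mem_carrier[rotated])
  have finC: "finite (characters p G L)" using L fin p0 by (rule finite_characters)
  let ?N = "\<lambda>\<phi>. quasi_additive p G L \<phi> \<and> (\<exists>l\<in>L. \<not> int p dvd \<phi> l)"
  \<comment> \<open>Minimality of the support is what makes every coset of \<open>L\<close> meet the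
    component of the identity.\<close>
  obtain \<phi> where N\<phi>: "?N \<phi>" and min: "\<And>\<phi>'. ?N \<phi>' \<Longrightarrow> card (support p L \<phi>) \<le> card (support p L \<phi>')"
    using ex_has_least_nat[of ?N \<phi>0 "\<lambda>\<phi>. card (support p L \<phi>)"] \<phi>0 by blast
  have \<phi>: "quasi_additive p G L \<phi>" and nontriv: "\<exists>l\<in>L. \<not> int p dvd \<phi> l" using N\<phi> by auto
  define B where "B = support p L \<phi>"
  have finB: "finite B" unfolding B_def by (rule finite_support[OF fin])
  have cardB: "card B \<le> card (support p L \<phi>0)" unfolding B_def using min \<phi>0 by blast
  have B_iff: "(L #> g, s) \<in> B \<longleftrightarrow> \<not> int p dvd \<phi> (g \<otimes> \<pi> s) - \<phi> g" if "g \<in> carrier G" "s \<in> S" for g s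
    unfolding B_def by (rule support_iff[OF L \<phi> that])
  have B_sub: "B \<subseteq> (rcosets L) \<times> S" unfolding B_def support_def by (rule edge_support_subset)
  let ?conn = "flat_connected p \<phi>"
  define A where "A = {a. (\<one>, a) \<in> ?conn}"
  have AG: "a \<in> carrier G" if "a \<in> A" for a
    using that flat_connected_closed[OF _ one_closed] by (auto simp: A_def)
  have \<phi>1: "int p dvd \<phi> \<one>"
    using additive_mod_one[OF L quasi_additive_imp_additive[OF \<phi> subgroup.subset[OF L]]] .
  have \<phi>A: "int p dvd \<phi> a" if "a \<in> A" for a
  proof -
    have "int p dvd \<phi> a - \<phi> \<one>" using that flat_connected_value[of \<one> a p \<phi>] by (simp add: A_def)
    then show ?thesis using \<phi>1 by (metis diff_add_cancel dvd_add)
  qed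
  have trans_L: "(l \<otimes> x, l \<otimes> y) \<in> ?conn" if "(x, y) \<in> ?conn" "x \<in> carrier G" "l \<in> L" for x y l
    using that by (rule flat_connected_translate[OF L \<phi>])
  have conn_A: "(x, x \<otimes> a) \<in> ?conn" if "x \<in> L" "a \<in> A" for x a
    using trans_L[of \<one> a x] that LG by (simp add: A_def)
  have A_mult: "x \<otimes> a \<in> A" if "x \<in> L" "x \<in> A" "a \<in> A" for x a
    using conn_A[OF that(1,3)] that(2) flat_connected_trans unfolding A_def by blast
  \<comment> \<open>The stabiliser of the component \<open>A\<close> in \<open>L\<close>: an element
    of \<open>L\<close> preserves \<open>A\<close> exactly when it moves the identity to a point of
    \<open>A\<close>.\<close>
  define D where "D = A \<inter> L"
  have D: "subgroup D G"
  proof (rule subgroupI)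
    show "D \<subseteq> carrier G" using LG by (auto simp: D_def)
    show "D \<noteq> {}" using subgroup.one_closed[OF L] flat_connected_refl by (auto simp: D_def A_def)
    fix a assume a: "a \<in> D"
    then have aL: "a \<in> L" "inv a \<in> L" "a \<in> A" using subgroup.m_inv_closed[OF L] by (auto simp: D_def)
    have "(inv a, \<one>) \<in> ?conn" using conn_A[OF aL(2,3)] LG[OF aL(1)] by simp
    then show "inv a \<in> D" using aL flat_connected_sym by (auto simp: D_def A_def)
    fix b assume "b \<in> D"
    then show "a \<otimes> b \<in> D" using a A_mult subgroup.m_closed[OF L] by (auto simp: D_def)
  qed
  have DL: "D \<subseteq> L" and DA: "D \<subseteq> A" by (auto simp: D_def)
  have D_diff: "x \<otimes> inv y \<in> D" if xy: "x \<in> A" "y \<in> A" "L #> x = L #> y" for x y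
  proof -
    let ?l = "x \<otimes> inv y"
    have l: "?l \<in> L" using xy AG coset_eq_iff[OF L] by simp
    have "(?l, ?l \<otimes> y) \<in> ?conn" by (rule conn_A[OF l xy(2)])
    moreover have "?l \<otimes> y = x" using xy AG by (simp add: m_assoc)
    ultimately have "(\<one>, ?l) \<in> ?conn" using xy(1) flat_connected_sym flat_connected_trans unfolding A_def by (metis mem_Collect_eq)
    then show ?thesis using l by (simp add: D_def A_def)
  qed
  have "\<exists>a. a \<in> A \<and> L #> a = L #> g" if "g \<in> carrier G" for g
    using minimal_support_connected[OF L \<phi> fin nontriv _ that] min by (auto simp: A_def)
  then have "\<forall>g. \<exists>a. g \<in> carrier G \<longrightarrow> a \<in> A \<and> L #> a = L #> g" by blast
  from choice[OF this] obtain cov where cov': "\<forall>g. g \<in> carrier G \<longrightarrow> cov g \<in> A \<and> L #> cov g = L #> g" by (rule exE)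
  have cov: "cov g \<in> A" "L #> cov g = L #> g" if "g \<in> carrier G" for g using cov' that by auto
  text \<open>Together with \<open>D\<close>, the loops \<open>loop e\<close> crossing one edge \<open>e\<close> of the support generate \<open>L\<close>.\<close>
  define start where "start e = cov (coset_rep G L (fst e))" for e :: "'g set \<times> 'a"
  define stop where "stop e = cov (start e \<otimes> \<pi> (snd e))" for e
  define loop where "loop e = start e \<otimes> \<pi> (snd e) \<otimes> inv (stop e)" for e
  have edge: "start e \<in> A" "L #> start e = fst e" "stop e \<in> A" "L #> stop e = L #> (start e \<otimes> \<pi> (snd e))"
    "loop e \<in> L" "start e \<otimes> \<pi> (snd e) = loop e \<otimes> stop e" if e: "e \<in> (rcosets L) \<times> S" for e
  proof -
    have X: "fst e \<in> rcosets L" and s: "\<pi> (snd e) \<in> carrier G" using e by auto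
    show st: "start e \<in> A" "L #> start e = fst e"
      using cov[OF coset_rep(1)[OF L X]] coset_rep(2)[OF L X] by (simp_all add: start_def)
    have z: "start e \<otimes> \<pi> (snd e) \<in> carrier G" using AG[OF st(1)] s by simp
    show sp: "stop e \<in> A" "L #> stop e = L #> (start e \<otimes> \<pi> (snd e))"
      using cov[OF z] by (simp_all add: stop_def)
    show "loop e \<in> L" using sp coset_eq_iff[OF L z AG[OF sp(1)]] by (simp add: loop_def)
    show "start e \<otimes> \<pi> (snd e) = loop e \<otimes> stop e" using z AG[OF sp(1)] by (simp add: loop_def m_assoc)
  qed
  obtain \<theta> :: "nat \<Rightarrow> 'g \<Rightarrow> int" where \<theta>: "\<And>j. j < u \<Longrightarrow> additive_mod p G L (\<theta> j)" "jointly_surj p L \<theta> u"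
  proof -
    have "jointly_surj p L (\<lambda>_ _. 0) 0" using subgroup.one_closed[OF L] by (auto simp: jointly_surj_def)
    from jointly_surj_extend[OF L p finC _ this _ chars] show ?thesis using that by blast
  qed
  define f where "f j = coset_extension G L (\<theta> j) (\<lambda>_. 0)" for j
  have f: "quasi_additive p G L (f j)" "\<And>l. l \<in> L \<Longrightarrow> f j l = \<theta> j l" if "j < u" for j
    using coset_extension_quasi[OF L \<theta>(1)[OF that], of "\<lambda>_. 0"] coset_extension_self[OF L]
    by (simp_all add: f_def)
  define \<Psi> where "\<Psi> c g = (\<Sum>j<u. c j * f j g)" for c :: "nat \<Rightarrow> int" and g
  have \<Psi>: "quasi_additive p G L (\<Psi> c)" for c unfolding quasi_additive_def
  proof (intro ballI)
    fix l x assume l: "l \<in> L" and x: "x \<in> carrier G"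
    have "[\<Psi> c (l \<otimes> x) = (\<Sum>j<u. c j * (f j l + f j x))] (mod int p)" unfolding \<Psi>_def
      by (intro cong_sum cong_mult cong_refl quasi_additiveD[OF f(1) l x]) simp
    then show "[\<Psi> c (l \<otimes> x) = \<Psi> c l + \<Psi> c x] (mod int p)"
      by (simp add: \<Psi>_def distrib_left sum.distrib)
  qed
  have \<Psi>add: "additive_mod p G L (\<Psi> c)" for c
    using quasi_additive_imp_additive[OF \<Psi> subgroup.subset[OF L]] .
  have \<Psi>_diff: "\<Psi> (\<lambda>j. c j - c' j) g = \<Psi> c g - \<Psi> c' g" for c c' g
    by (simp add: \<Psi>_def left_diff_distrib sum_subtractf)
  have \<Psi>_dvd: "int p dvd \<Psi> c g" if "\<And>j. j < u \<Longrightarrow> int p dvd c j" for c g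
    unfolding \<Psi>_def by (intro dvd_sum dvd_mult2) (use that in simp)
  define NB where "NB = B \<union> relator_neighbourhood L B"
  \<comment> \<open>Conditions of the first kind keep \<open>\<psi>\<close> constant along every
    relator loop that meets the support; those of the second kind kill it on the crossing loops, so
    that it has to be detected on \<open>D\<close>.\<close>
  let ?D1 = "\<lambda>e c. \<Psi> c (coset_rep G L (fst e) \<otimes> \<pi> (snd e)) - \<Psi> c (coset_rep G L (fst e))"
  let ?D2 = "\<lambda>e c. \<Psi> c (loop e)"
  let ?DD = "?D1 ` NB \<union> ?D2 ` B"
  have finNB: "finite NB" unfolding NB_def using finB card_relator_neighbourhood(1)[OF L finB] by simp
  have "card ?DD \<le> card NB + card B"
    using card_Un_le[of "?D1 ` NB" "?D2 ` B"] card_image_le[OF finNB, of ?D1] card_image_le[OF finB, of ?D2] by linarith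
  also have "\<dots> \<le> card B + relator_length * relator_length * card B + card B"
    using card_Un_le[of B "relator_neighbourhood L B"] card_relator_neighbourhood(2)[OF L finB]
    unfolding NB_def by linarith
  also have "\<dots> = (relator_length * relator_length + 2) * card B" by (simp add: algebra_simps)
  also have "\<dots> \<le> (relator_length * relator_length + 2) * card (support p L \<phi>0)" using cardB by (rule mult_le_mono2)
  finally have cardDD: "card ?DD + 2 \<le> card {..<u}" using room by simp
  have "\<exists>c :: nat \<Rightarrow> nat \<Rightarrow> int. (\<forall>m<2. \<forall>D\<in>?DD. int p dvd D (c m)) \<and>
    (\<forall>b. (\<forall>j\<in>{..<u}. int p dvd (\<Sum>m<2. b m * c m j)) \<longrightarrow> (\<forall>m<2. int p dvd b m))"
  proof (rule independent_solutions[OF _ p _ _ cardDD])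
    show "finite ?DD" using finNB finB by simp
    fix D assume "D \<in> ?DD"
    then show "linear_mod p {..<u} D"
    proof
      assume "D \<in> ?D1 ` NB"
      then show ?thesis unfolding linear_mod_def by (auto simp: \<Psi>_diff intro!: dvd_diff \<Psi>_dvd)
    next
      assume "D \<in> ?D2 ` B"
      then show ?thesis unfolding linear_mod_def by (auto simp: \<Psi>_diff intro!: \<Psi>_dvd)
    qed
  qed simp
  then obtain c :: "nat \<Rightarrow> nat \<Rightarrow> int" where c: "\<forall>m<2. \<forall>D\<in>?DD. int p dvd D (c m)"
    and indep: "\<forall>b. (\<forall>j\<in>{..<u}. int p dvd (\<Sum>m<2. b m * c m j)) \<longrightarrow> (\<forall>m<2. int p dvd b m)" by blast
  define \<psi> where "\<psi> m = \<Psi> (c m)" for m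
  have \<psi>: "quasi_additive p G L (\<psi> m)" "additive_mod p G L (\<psi> m)" for m
    unfolding \<psi>_def by (rule \<Psi> \<Psi>add)+
  have DDm: "\<forall>D\<in>?DD. int p dvd D (c m)" if "m < 2" for m by (rule mp[OF spec[OF c] that])
  have \<psi>_NB: "int p dvd \<psi> m (g \<otimes> \<pi> s) - \<psi> m g"
    if m: "m < 2" and e: "(L #> g, s) \<in> NB" and g: "g \<in> carrier G" and s: "s \<in> S" for m g s
  proof -
    let ?z = "coset_rep G L (L #> g)"
    have z: "?z \<in> carrier G" using coset_rep(1)[OF L coset_in_rcosets[OF g]] .
    from bspec[OF DDm[OF m] UnI1[OF imageI[OF e]]]
    have "int p dvd \<psi> m (?z \<otimes> \<pi> s) - \<psi> m ?z" by (simp add: \<psi>_def)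
    then show ?thesis
      using cong_dvd_iff[OF quasi_additive_difference[OF L \<psi>(1) coset_decomp(1)[OF L g] z, of "\<pi> s" m]]
        coset_decomp(2)[OF L g] s by simp
  qed
  have \<psi>_loop: "int p dvd \<psi> m (loop e)" if "m < 2" "e \<in> B" for m e
    using bspec[OF DDm[OF that(1)] UnI2[OF imageI[OF that(2)]]] by (simp add: \<psi>_def)
  \<comment> \<open>Follow a path from the identity. A step off the support stays in its component;
    a step through a support edge \<open>e\<close> contributes an element of \<open>D\<close>, then
    \<open>loop e\<close> or its inverse, and continues at a point of \<open>A\<close>. The factor
    collected in \<open>L\<close> is one on which the combination vanishes.\<close>
  have generated: "\<exists>z\<in>L. \<exists>a\<in>A. int p dvd \<Psi> C z \<and> g = z \<otimes> a"
    if CD: "\<And>l. l \<in> D \<Longrightarrow> int p dvd \<Psi> C l" and Cloop: "\<And>e. e \<in> B \<Longrightarrow> int p dvd \<Psi> C (loop e)"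
      and g: "g \<in> carrier G" for C g
  proof -
    have mult: "x \<otimes> y \<in> L \<and> int p dvd \<Psi> C (x \<otimes> y)"
      if "x \<in> L" "int p dvd \<Psi> C x" "y \<in> L" "int p dvd \<Psi> C y" for x y
      using that subgroup.m_closed[OF L] cong_dvd_iff[OF additive_modD[OF \<Psi>add that(1,3), of C]] by simp
    have inv: "inv x \<in> L \<and> int p dvd \<Psi> C (inv x)" if "x \<in> L" "int p dvd \<Psi> C x" for x
      using that subgroup.m_inv_closed[OF L] cong_dvd_iff[OF additive_mod_inv[OF L \<Psi>add that(1), of C]] by simp
    show ?thesis using g
    proof (induction rule: generators_induct)
      case one
      show ?case using subgroup.one_closed[OF L] additive_mod_one[OF L \<Psi>add] flat_connected_refl
        by (intro bexI[of _ \<one>]) (auto simp: A_def)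
    next
      case (gen g s)
      then obtain z a where za: "z \<in> L" "a \<in> A" "int p dvd \<Psi> C z" "g = z \<otimes> a" by blast
      have aG: "a \<in> carrier G" and zG: "z \<in> carrier G" and sG: "\<pi> s \<in> carrier G" using za AG LG gen by auto
      show ?case
      proof (cases "(L #> a, s) \<in> B")
        case False
        then have "(a, a \<otimes> \<pi> s) \<in> ?conn" using B_iff[OF aG gen(2)] by (intro flat_connected_step[OF aG gen(2)]) simp
        then have "a \<otimes> \<pi> s \<in> A" using za(2) flat_connected_trans unfolding A_def by blast
        moreover have "g \<otimes> \<pi> s = z \<otimes> (a \<otimes> \<pi> s)" using za zG aG sG by (simp add: m_assoc)
        ultimately show ?thesis using za by blast
      next
        case True
        define e where "e = (L #> a, s)"
        have eB: "e \<in> B" and fst_e: "fst e = L #> a" and snd_e: "snd e = s" using True by (simp_all add: e_def)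
        then have e: "e \<in> (rcosets L) \<times> S" using B_sub by blast
        note ed = edge[OF e, unfolded fst_e snd_e]
        define l where "l = a \<otimes> inv (start e)"
        have l: "l \<in> D" unfolding l_def using D_diff[OF za(2) ed(1)] ed(2) by simp
        have st: "start e \<in> carrier G" "stop e \<in> carrier G" "loop e \<in> carrier G" using ed AG LG by auto
        have lG: "l \<in> carrier G" using l DL LG by blast
        have al: "a = l \<otimes> start e" using aG st by (simp add: l_def m_assoc)
        have "g \<otimes> \<pi> s = z \<otimes> (l \<otimes> (start e \<otimes> \<pi> s))" using za(4) al zG lG st sG by (simp add: m_assoc)
        also have "\<dots> = z \<otimes> l \<otimes> loop e \<otimes> stop e" unfolding ed(6) using zG lG st by (simp add: m_assoc)
        finally have "g \<otimes> \<pi> s = z \<otimes> l \<otimes> loop e \<otimes> stop e" .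
        moreover have "z \<otimes> l \<otimes> loop e \<in> L \<and> int p dvd \<Psi> C (z \<otimes> l \<otimes> loop e)"
          using mult[of z l] mult[of "z \<otimes> l" "loop e"] za CD[OF l] l DL Cloop[OF eB] ed(5) by blast
        ultimately show ?thesis using ed(3) by blast
      qed
    next
      case (inv g s)
      then obtain z a where za: "z \<in> L" "a \<in> A" "int p dvd \<Psi> C z" "g = z \<otimes> a" by blast
      define b where "b = a \<otimes> inv \<pi> s"
      have aG: "a \<in> carrier G" and zG: "z \<in> carrier G" and sG: "\<pi> s \<in> carrier G" using za AG LG inv by auto
      have b: "b \<in> carrier G" "b \<otimes> \<pi> s = a" "g \<otimes> inv \<pi> s = z \<otimes> b"
        using aG zG sG za(4) by (simp_all add: b_def m_assoc)
      show ?case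
      proof (cases "(L #> b, s) \<in> B")
        case False
        then have "(b, a) \<in> ?conn" using B_iff[OF b(1) inv(2)] flat_connected_step[OF b(1) inv(2)] b(2) by simp
        then have "b \<in> A" using za(2) flat_connected_trans flat_connected_sym unfolding A_def by blast
        then show ?thesis using za b(3) by blast
      next
        case True
        define e where "e = (L #> b, s)"
        have eB: "e \<in> B" and fst_e: "fst e = L #> b" and snd_e: "snd e = s" using True by (simp_all add: e_def)
        then have e: "e \<in> (rcosets L) \<times> S" using B_sub by blast
        note ed = edge[OF e, unfolded fst_e snd_e]
        have st: "start e \<in> carrier G" "stop e \<in> carrier G" "loop e \<in> carrier G" using ed AG LG by auto
        have "L #> stop e = L #> (b \<otimes> \<pi> s)"
          unfolding ed(4) by (rule coset_mult_right[OF L st(1) b(1) sG ed(2)])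
        then have coset: "L #> a = L #> stop e" using b(2) by simp
        define l where "l = a \<otimes> inv (stop e)"
        have l: "l \<in> D" unfolding l_def by (rule D_diff[OF za(2) ed(3) coset])
        have lG: "l \<in> carrier G" using l DL LG by blast
        have "stop e = inv (loop e) \<otimes> (start e \<otimes> \<pi> s)"
          unfolding ed(6) using st by (simp add: m_assoc[symmetric])
        then have "a = l \<otimes> (inv (loop e) \<otimes> (start e \<otimes> \<pi> s))" using aG st by (simp add: l_def m_assoc)
        then have "b = l \<otimes> inv (loop e) \<otimes> start e" using lG st sG by (simp add: b_def m_assoc)
        then have "g \<otimes> inv \<pi> s = z \<otimes> l \<otimes> inv (loop e) \<otimes> start e" using b(3) zG lG st by (simp add: m_assoc)
        moreover have "z \<otimes> l \<otimes> inv (loop e) \<in> L \<and> int p dvd \<Psi> C (z \<otimes> l \<otimes> inv (loop e))"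
          using mult[of z l] mult[of "z \<otimes> l" "inv (loop e)"] \<open>\<And>x. x \<in> L \<Longrightarrow> int p dvd \<Psi> C x \<Longrightarrow> inv x \<in> L \<and> int p dvd \<Psi> C (inv x)\<close>[of "loop e"]
            za CD[OF l] l DL Cloop[OF eB] ed(5) by blast
        ultimately show ?thesis using ed(1) by blast
      qed
    qed
  qed
  have vanish_L: "int p dvd \<Psi> C l"
    if CD: "\<And>l. l \<in> D \<Longrightarrow> int p dvd \<Psi> C l" and Cloop: "\<And>e. e \<in> B \<Longrightarrow> int p dvd \<Psi> C (loop e)"
      and l: "l \<in> L" for C l
  proof -
    obtain z a where za: "z \<in> L" "a \<in> A" "int p dvd \<Psi> C z" "l = z \<otimes> a"
      using generated[OF CD Cloop LG[OF l]] by blast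
    have "a = inv z \<otimes> l" using za AG LG by (simp add: m_assoc[symmetric])
    then have "a \<in> L" using subgroup.m_closed[OF L subgroup.m_inv_closed[OF L za(1)] l] by (rule ssubst)
    then have "int p dvd \<Psi> C a" using za(2) CD by (simp add: D_def)
    then have "int p dvd \<Psi> C z + \<Psi> C a" using za(3) by simp
    then show ?thesis using cong_dvd_iff[OF additive_modD[OF \<Psi>add za(1) \<open>a \<in> L\<close>, of C]] za(4) by simp
  qed
  \<comment> \<open>A relation on \<open>D\<close> also holds on the crossing loops, hence on all of
    \<open>L\<close>; the independence of the \<open>\<theta> j\<close> on \<open>L\<close> then
    makes its coefficients zero.\<close>
  have \<psi>_surj: "jointly_surj p D \<psi> 2"
  proof (rule jointly_surj_independent[OF D p])
    show "additive_mod p G D (\<psi> m)" for m using \<psi>(2) DL by (rule additive_mod_subset)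
    fix b m assume b: "\<And>l. l \<in> D \<Longrightarrow> int p dvd (\<Sum>m<2. b m * \<psi> m l)" and m: "m < (2::nat)"
    define C where "C j = (\<Sum>m<2. b m * c m j)" for j
    have \<Psi>C: "\<Psi> C g = (\<Sum>m<2. b m * \<psi> m g)" for g
      unfolding \<psi>_def \<Psi>_def C_def sum_distrib_left sum_distrib_right
      by (subst sum.swap) (simp add: mult.assoc)
    have "int p dvd \<Psi> C l" if "l \<in> L" for l
    proof (rule vanish_L[OF _ _ that])
      show "int p dvd \<Psi> C (loop e)" if "e \<in> B" for e
        unfolding \<Psi>C by (intro dvd_sum dvd_mult \<psi>_loop) (use that in auto)
    qed (simp add: \<Psi>C b)
    moreover have "\<exists>l\<in>L. [\<Psi> C l = C j] (mod int p)" if j: "j < u" for j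
    proof -
      obtain l where l: "l \<in> L" "\<And>i. i < u \<Longrightarrow> [\<theta> i l = of_bool (i = j)] (mod int p)"
        using jointly_surjD[OF \<theta>(2), of "\<lambda>i. of_bool (i = j)"] by blast
      have "[\<Psi> C l = (\<Sum>i<u. C i * of_bool (i = j))] (mod int p)" unfolding \<Psi>_def
        by (intro cong_sum cong_mult cong_refl) (use f(2) l in auto)
      also have "(\<Sum>i<u. C i * of_bool (i = j)) = (\<Sum>i<u. if i = j then C j else 0)"
        by (intro sum.cong) auto
      also have "\<dots> = C j" using j by simp
      finally show ?thesis using l(1) by blast
    qed
    ultimately have "int p dvd C j" if "j < u" for j using that cong_dvd_iff by blast
    then show "int p dvd b m" using spec[OF indep, of b] m by (simp add: C_def)
  qed
  have "B \<noteq> {}"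
  proof
    assume empty: "B = {}"
    have "int p dvd \<phi> g" if "g \<in> carrier G" for g
    proof (rule cong_zero_induct[where D = \<phi>, OF generate_generators \<phi>1 _ that])
      fix g t assume g: "g \<in> carrier G" and "t \<in> \<pi> ` S"
      then obtain s where "s \<in> S" "t = \<pi> s" by auto
      then show "[\<phi> (g \<otimes> t) = \<phi> g] (mod int p)" using B_iff[OF g] empty by (simp add: cong_iff_dvd_diff)
    qed
    then show False using nontriv LG by blast
  qed
  then obtain X0 s0 where e0: "(X0, s0) \<in> B" by auto
  have Xs0: "X0 \<in> rcosets L" "s0 \<in> S" using e0 B_sub by auto
  have sG: "\<pi> s0 \<in> carrier G" using Xs0(2) by simp
  \<comment> \<open>A point of the component in the given coset is corrected by an element of
    \<open>D\<close> with the opposite values of \<open>\<psi>\<close>.\<close>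
  have adjust: "\<exists>a\<in>A. L #> a = L #> g \<and> (\<forall>m<2. int p dvd \<psi> m a)" if g: "g \<in> carrier G" for g
  proof -
    obtain d where d: "d \<in> D" "\<And>m. m < 2 \<Longrightarrow> [\<psi> m d = - \<psi> m (cov g)] (mod int p)"
      using jointly_surjD[OF \<psi>_surj, of "\<lambda>m. - \<psi> m (cov g)"] by blast
    have dL: "d \<in> L" "d \<in> A" using d(1) by (auto simp: D_def)
    have covG: "cov g \<in> carrier G" using cov(1)[OF g] by (rule AG)
    have "int p dvd \<psi> m (d \<otimes> cov g)" if m: "m < 2" for m
    proof -
      have "[\<psi> m (d \<otimes> cov g) = \<psi> m d + \<psi> m (cov g)] (mod int p)"
        by (rule quasi_additiveD[OF \<psi>(1) dL(1) covG])
      moreover have "int p dvd \<psi> m d + \<psi> m (cov g)" using d(2)[OF m] by (simp add: cong_iff_dvd_diff)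
      ultimately show ?thesis by (simp add: cong_dvd_iff)
    qed
    moreover have "L #> (d \<otimes> cov g) = L #> g" using coset_mult_left[OF L dL(1) covG] cov(2)[OF g] by simp
    ultimately show ?thesis using A_mult[OF dL cov(1)[OF g]] by blast
  qed
  obtain a where a: "a \<in> A" "L #> a = X0" "\<And>m. m < 2 \<Longrightarrow> int p dvd \<psi> m a"
    using adjust[OF coset_rep(1)[OF L Xs0(1)]] coset_rep(2)[OF L Xs0(1)] by auto
  have aG: "a \<in> carrier G" using a(1) by (rule AG)
  define as where "as = a \<otimes> \<pi> s0"
  have asG: "as \<in> carrier G" using aG sG by (simp add: as_def)
  obtain a' where a': "a' \<in> A" "L #> a' = L #> as" "\<And>m. m < 2 \<Longrightarrow> int p dvd \<psi> m a'"
    using adjust[OF asG] by auto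
  have a'G: "a' \<in> carrier G" using a'(1) by (rule AG)
  \<comment> \<open>\<open>la\<close> crosses one support edge, from \<open>a\<close> to
    \<open>as\<close>: it moves the component \<open>A\<close> to the one containing
    \<open>as\<close>. Since \<open>\<phi>\<close> vanishes at \<open>a\<close>, its value
    \<open>j\<close> at \<open>as\<close> is the jump and is nonzero modulo
    \<open>p\<close>.\<close>
  define la where "la = as \<otimes> inv a'"
  have la: "la \<in> L" "la \<otimes> a' = as" using a'(2) coset_eq_iff[OF L asG a'G] asG a'G by (simp_all add: la_def m_assoc)
  have laG: "la \<in> carrier G" using la(1) by (rule LG)
  define j where "j = \<phi> as"
  have j: "\<not> int p dvd j"
  proof -
    have "\<not> int p dvd \<phi> as - \<phi> a" using B_iff[OF aG Xs0(2)] e0 a(2) by (simp add: as_def)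
    then show ?thesis using \<phi>A[OF a(1)] by (metis j_def dvd_diff)
  qed
  have \<psi>as: "int p dvd \<psi> m as" if m: "m < 2" for m
  proof -
    have "int p dvd \<psi> m as - \<psi> m a" unfolding as_def
      by (rule \<psi>_NB[OF m _ aG Xs0(2)]) (use e0 a(2) in \<open>simp add: NB_def\<close>)
    then show ?thesis using a(3)[OF m] by (metis diff_add_cancel dvd_add)
  qed
  \<comment> \<open>A function of the residues of \<open>\<phi>\<close>, \<open>\<psi> 0\<close> and
    \<open>\<psi> 1\<close> only. It is trivial where \<open>\<phi>\<close> vanishes and at
    \<open>as\<close>; just past a crossing with jump \<open>j\<close> it takes the marked values
    when \<open>\<psi>\<close> is one of the two unit vectors.\<close>
  define Y where "Y x = (if [\<phi> x = j] (mod int p) \<and> [\<psi> 0 x = 1] (mod int p) \<and> [\<psi> 1 x = 0] (mod int p) then y1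
    else if [\<phi> x = j] (mod int p) \<and> [\<psi> 0 x = 0] (mod int p) \<and> [\<psi> 1 x = 1] (mod int p) then y2
    else \<one>\<^bsub>E\<^esub>)" for x
  have YE: "Y x \<in> carrier E" for x using y12 by (simp add: Y_def)
  have Y_cong: "Y x = Y y" if "[\<phi> x = \<phi> y] (mod int p)" "\<And>m. m < 2 \<Longrightarrow> [\<psi> m x = \<psi> m y] (mod int p)" for x y
    using that(1) that(2)[of 0] that(2)[of 1] unfolding Y_def by (auto simp: cong_def)
  \<comment> \<open>A relator loop missing the support has only trivial labels. On one that meets it
    the \<open>\<psi> m\<close> are constant, so \<open>Y\<close> does not change on edges where
    \<open>\<phi>\<close> does not; every label is then a quotient of values of \<open>Y\<close> and
    the product telescopes.\<close>
  define lab where "lab g s = (if int p dvd \<phi> (g \<otimes> \<pi> s) - \<phi> g then \<one>\<^bsub>E\<^esub> else Y g \<otimes>\<^bsub>E\<^esub> inv\<^bsub>E\<^esub> (Y (g \<otimes> \<pi> s)))" for g s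
  have labE: "lab g s \<in> carrier E" for g s using YE by (simp add: lab_def)
  have rel: "walk E lab g (\<rho> r) = \<one>\<^bsub>E\<^esub>" if r: "r \<in> R" and g: "g \<in> carrier G" for r g
  proof (cases "coset_edges L g (\<rho> r) \<inter> B = {}")
    case True
    have "walk E lab g (\<rho> r) = \<one>\<^bsub>E\<^esub> \<otimes>\<^bsub>E\<^esub> inv\<^bsub>E\<^esub> \<one>\<^bsub>E\<^esub>"
    proof (rule walk_telescope[OF E _ rel_over[OF r] g])
      fix x s assume xs: "(x, s) \<in> set (walk_edges g (\<rho> r))"
      then have "(L #> x, s) \<in> coset_edges L g (\<rho> r)" by (force simp: coset_edges_def)
      then have "(L #> x, s) \<notin> B" using True by blast
      then have "int p dvd \<phi> (x \<otimes> \<pi> s) - \<phi> x" using B_iff walk_edges_closed[OF rel_over[OF r] g xs] by blast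
      then show "lab x s = \<one>\<^bsub>E\<^esub> \<otimes>\<^bsub>E\<^esub> inv\<^bsub>E\<^esub> \<one>\<^bsub>E\<^esub>" by (simp add: lab_def)
    qed simp
    then show ?thesis by simp
  next
    case False
    let ?z = "coset_rep G L (L #> g)"
    have z: "?z \<in> carrier G" using coset_rep(1)[OF L coset_in_rcosets[OF g]] .
    have "coset_edges L g (\<rho> r) = coset_edges L ?z (\<rho> r)"
      using coset_edges_translate[OF L rel_over[OF r] coset_decomp(1)[OF L g] z] coset_decomp(2)[OF L g] by simp
    then have nb: "coset_edges L g (\<rho> r) \<subseteq> NB"
      using False coset_in_rcosets[OF g, of L] r unfolding NB_def relator_neighbourhood_def by blast
    have "walk E lab g (\<rho> r) = Y g \<otimes>\<^bsub>E\<^esub> inv\<^bsub>E\<^esub> (Y (walk_end g (\<rho> r)))"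
    proof (rule walk_telescope[OF E YE rel_over[OF r] g])
      fix x s assume xs: "(x, s) \<in> set (walk_edges g (\<rho> r))"
      then have "(L #> x, s) \<in> coset_edges L g (\<rho> r)" by (force simp: coset_edges_def)
      then have e: "(L #> x, s) \<in> NB" using nb by blast
      have xs': "x \<in> carrier G" "s \<in> S" using walk_edges_closed[OF rel_over[OF r] g xs] by auto
      have \<psi>eq: "[\<psi> m x = \<psi> m (x \<otimes> \<pi> s)] (mod int p)" if "m < 2" for m
        using \<psi>_NB[OF that e xs'] by (simp add: cong_iff_dvd_diff dvd_diff_commute)
      show "lab x s = Y x \<otimes>\<^bsub>E\<^esub> inv\<^bsub>E\<^esub> (Y (x \<otimes> \<pi> s))"
      proof (cases "int p dvd \<phi> (x \<otimes> \<pi> s) - \<phi> x")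
        case True
        then have "Y x = Y (x \<otimes> \<pi> s)" by (intro Y_cong \<psi>eq) (simp_all add: cong_iff_dvd_diff dvd_diff_commute)
        then show ?thesis using True YE by (simp add: lab_def)
      qed (simp add: lab_def)
    qed
    then show ?thesis using walk_end_relator[OF r g] YE by simp
  qed
  obtain \<Phi> where \<Phi>: "\<Phi> \<in> carrier G \<rightarrow> carrier E" "\<Phi> \<one> = \<one>\<^bsub>E\<^esub>"
    "\<And>g s. g \<in> carrier G \<Longrightarrow> s \<in> S \<Longrightarrow> \<Phi> (g \<otimes> \<pi> s) = \<Phi> g \<otimes>\<^bsub>E\<^esub> lab g s"
    by (rule labelling_extends[OF E labE rel]) auto
  have \<Phi>E: "\<Phi> x \<in> carrier E" if "x \<in> carrier G" for x using \<Phi>(1) that by auto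
  define K where "K = {l \<in> L. int p dvd \<phi> l \<and> (\<forall>m<2. int p dvd \<psi> m l)}"
  have \<phi>add: "additive_mod p G L \<phi>" using quasi_additive_imp_additive[OF \<phi> subgroup.subset[OF L]] .
  have K: "subgroup K G"
  proof (rule subgroupI)
    show "K \<subseteq> carrier G" using LG by (auto simp: K_def)
    show "K \<noteq> {}" using subgroup.one_closed[OF L] additive_mod_one[OF L \<phi>add] additive_mod_one[OF L \<psi>(2)]
      by (auto simp: K_def)
    fix x assume x: "x \<in> K"
    then have xL: "x \<in> L" by (simp add: K_def)
    show "inv x \<in> K" using x subgroup.m_inv_closed[OF L xL] cong_dvd_iff[OF additive_mod_inv[OF L \<phi>add xL]]
        cong_dvd_iff[OF additive_mod_inv[OF L \<psi>(2) xL]] by (simp add: K_def)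
    fix y assume y: "y \<in> K"
    then have yL: "y \<in> L" by (simp add: K_def)
    show "x \<otimes> y \<in> K" using x y subgroup.m_closed[OF L xL yL] cong_dvd_iff[OF additive_modD[OF \<phi>add xL yL]]
        cong_dvd_iff[OF additive_modD[OF \<psi>(2) xL yL]] by (simp add: K_def)
  qed
  have ker_K: "char_kernel p G L \<subseteq> K" using \<phi>add \<psi>(2) by (auto simp: K_def char_kernel_def)
  have lab_K: "lab (l \<otimes> g) s = lab g s" if l: "l \<in> K" and g: "g \<in> carrier G" and s: "s \<in> S" for l g s
  proof -
    have lL: "l \<in> L" using l by (simp add: K_def)
    have lG: "l \<in> carrier G" using lL by (rule LG)
    have Yl: "Y (l \<otimes> x) = Y x" if x: "x \<in> carrier G" for x
    proof (rule Y_cong)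
      have cong: "[h (l \<otimes> x) = h x] (mod int p)" if h: "quasi_additive p G L h" "int p dvd h l" for h
      proof -
        have "[h (l \<otimes> x) = h l + h x] (mod int p)" by (rule quasi_additiveD[OF h(1) lL x])
        also have "[h l + h x = 0 + h x] (mod int p)" using h(2) by (intro cong_add cong_refl) (simp add: cong_0_iff)
        finally show ?thesis by simp
      qed
      show "[\<phi> (l \<otimes> x) = \<phi> x] (mod int p)" using l by (intro cong \<phi>) (simp add: K_def)
      show "[\<psi> m (l \<otimes> x) = \<psi> m x] (mod int p)" if "m < 2" for m using l that by (intro cong \<psi>(1)) (simp add: K_def)
    qed
    have "int p dvd \<phi> (l \<otimes> g \<otimes> \<pi> s) - \<phi> (l \<otimes> g) \<longleftrightarrow> int p dvd \<phi> (g \<otimes> \<pi> s) - \<phi> g"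
      using cong_dvd_iff[OF quasi_additive_difference[OF L \<phi> lL g, of "\<pi> s"]] s by simp
    moreover have "Y (l \<otimes> g \<otimes> \<pi> s) = Y (g \<otimes> \<pi> s)" using Yl[of "g \<otimes> \<pi> s"] lG g s by (simp add: m_assoc)
    ultimately show ?thesis using Yl[OF g] by (simp add: lab_def)
  qed
  have \<Phi>mult: "\<Phi> (l \<otimes> g) = \<Phi> l \<otimes>\<^bsub>E\<^esub> \<Phi> g" if "l \<in> K" "g \<in> carrier G" for l g
    by (rule hom_if_labels_invariant[OF E K \<Phi>(1,2) labE \<Phi>(3) lab_K that])
  have \<Phi>hom: "\<Phi> \<in> hom (G\<lparr>carrier := K\<rparr>) E"
    using \<Phi>mult \<Phi>(1) subgroup.subset[OF K] by (auto simp: hom_def)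
  have \<Phi>conn: "\<Phi> y = \<Phi> x" if xy: "(x, y) \<in> ?conn" and x: "x \<in> carrier G" for x y
  proof -
    have "y \<in> carrier G \<and> \<Phi> y = \<Phi> x"
    proof (rule flat_connected_induct[OF xy x])
      fix g s assume "g \<in> carrier G" "s \<in> S" "int p dvd \<phi> (g \<otimes> \<pi> s) - \<phi> g"
      then show "\<Phi> g = \<Phi> x \<longleftrightarrow> \<Phi> (g \<otimes> \<pi> s) = \<Phi> x" using \<Phi>(3) \<Phi>E by (simp add: lab_def)
    qed simp
    then show ?thesis by simp
  qed
  \<comment> \<open>The way from \<open>x\<close> to \<open>x \<otimes> la\<close> stays in a
    component up to \<open>x \<otimes> a\<close>, crosses one support edge to
    \<open>x \<otimes> as\<close>, and stays in a component again, so only that edge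
    contributes.\<close>
  have cross: "\<Phi> (x \<otimes> la) = \<Phi> x \<otimes>\<^bsub>E\<^esub> (Y (x \<otimes> a) \<otimes>\<^bsub>E\<^esub> inv\<^bsub>E\<^esub> (Y (x \<otimes> as)))" if x: "x \<in> L" for x
  proof -
    have xG: "x \<in> carrier G" using x by (rule LG)
    have "\<Phi> (x \<otimes> a) = \<Phi> x" by (rule \<Phi>conn[OF conn_A[OF x a(1)] xG])
    moreover have "\<Phi> (x \<otimes> a \<otimes> \<pi> s0) = \<Phi> (x \<otimes> a) \<otimes>\<^bsub>E\<^esub> lab (x \<otimes> a) s0" using xG aG Xs0 by (intro \<Phi>(3)) auto
    moreover have "x \<otimes> a \<otimes> \<pi> s0 = x \<otimes> as" using xG aG sG by (simp add: as_def m_assoc)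
    moreover have "lab (x \<otimes> a) s0 = Y (x \<otimes> a) \<otimes>\<^bsub>E\<^esub> inv\<^bsub>E\<^esub> (Y (x \<otimes> a \<otimes> \<pi> s0))"
    proof -
      have "(L #> (x \<otimes> a), s0) \<in> B" using coset_mult_left[OF L x aG] a(2) e0 by simp
      then show ?thesis using B_iff[of "x \<otimes> a" s0] xG aG Xs0 by (simp add: lab_def)
    qed
    moreover have "\<Phi> (x \<otimes> la \<otimes> a') = \<Phi> (x \<otimes> la)"
      by (rule \<Phi>conn[OF conn_A[OF subgroup.m_closed[OF L x la(1)] a'(1)]]) (use xG laG in simp)
    moreover have "x \<otimes> la \<otimes> a' = x \<otimes> as" using xG laG a'G la(2) by (simp add: m_assoc)
    ultimately show ?thesis by simp
  qed
  have cong_zero: "[0 = x] (mod int p) \<longleftrightarrow> int p dvd x" for x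
    using cong_0_iff[of x "int p"] cong_sym_eq[of 0 x "int p"] by simp
  have not10: "\<not> [1 = 0] (mod int p)" "\<not> [0 = 1] (mod int p)" "\<not> [0 = j] (mod int p)"
    using p1 j cong_zero[of 1] cong_zero[of j] cong_0_iff[of 1 "int p"] by simp_all
  have attained: "\<exists>x\<in>K. \<Phi> x = Y (d \<otimes> as)" if d: "d \<in> D" for d
  proof -
    have dL: "d \<in> L" and dA: "d \<in> A" using d by (auto simp: D_def)
    have dG: "d \<in> carrier G" using dL by (rule LG)
    \<comment> \<open>The commutator of \<open>la\<close> and \<open>d\<close>.
      \<open>\<Phi>\<close> is trivial at \<open>la\<close> and at \<open>la \<otimes> d\<close>,
      while \<open>la \<otimes> d = ?k \<otimes> d \<otimes> la\<close> is reached from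
      \<open>?k \<otimes> d\<close> by a crossing that contributes the inverse of
      \<open>Y (d \<otimes> as)\<close>. Comparing the two values determines
      \<open>\<Phi> ?k\<close>.\<close>
    let ?k = "la \<otimes> d \<otimes> inv (d \<otimes> la)"
    have k: "?k \<in> K" using char_kernel_commutator[OF L la(1) dL] ker_K by blast
    have kL: "?k \<in> L" and kG: "?k \<in> carrier G" using k LG by (auto simp: K_def)
    have val: "[h (?k \<otimes> d \<otimes> y) = h d + h y] (mod int p)"
      if h: "quasi_additive p G L h" "int p dvd h ?k" and y: "y \<in> carrier G" for h y
    proof -
      have "[h (?k \<otimes> (d \<otimes> y)) = h ?k + h (d \<otimes> y)] (mod int p)" using kL dG y by (intro quasi_additiveD[OF h(1)]) auto
      also have "[h ?k + h (d \<otimes> y) = 0 + (h d + h y)] (mod int p)"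
        using h(2) by (intro cong_add quasi_additiveD[OF h(1) dL y]) (simp add: cong_0_iff)
      finally show ?thesis using kG dG y by (simp add: m_assoc)
    qed
    have \<phi>k: "int p dvd \<phi> ?k" and \<psi>k: "\<And>m. m < 2 \<Longrightarrow> int p dvd \<psi> m ?k" using k by (auto simp: K_def)
    have Yas: "Y as = \<one>\<^bsub>E\<^esub>"
    proof -
      have "[\<psi> 0 as = 0] (mod int p)" "[\<psi> 1 as = 0] (mod int p)" using \<psi>as by (auto simp: cong_0_iff)
      then show ?thesis using not10 unfolding Y_def by (metis cong_sym cong_trans)
    qed
    have Y0: "Y x = \<one>\<^bsub>E\<^esub>" if "int p dvd \<phi> x" for x
    proof -
      have "\<not> [\<phi> x = j] (mod int p)" using that j by (metis cong_dvd_iff)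
      then show ?thesis by (simp add: Y_def)
    qed
    have "\<Phi> (\<one> \<otimes> la) = \<Phi> \<one> \<otimes>\<^bsub>E\<^esub> (Y (\<one> \<otimes> a) \<otimes>\<^bsub>E\<^esub> inv\<^bsub>E\<^esub> (Y (\<one> \<otimes> as)))"
      by (rule cross[OF subgroup.one_closed[OF L]])
    then have 1: "\<Phi> la = \<one>\<^bsub>E\<^esub>" using laG aG asG Y0[OF \<phi>A[OF a(1)]] Yas \<Phi>(2) by simp
    have 2: "\<Phi> (la \<otimes> d) = \<one>\<^bsub>E\<^esub>" using \<Phi>conn[OF conn_A[OF la(1) dA] laG] 1 by simp
    have kdL: "?k \<otimes> d \<in> L" using kL dL L by (simp add: subgroup.m_closed)
    have kd_la: "?k \<otimes> d \<otimes> la = la \<otimes> d" using laG dG by (simp add: m_assoc inv_mult_group)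
    have "\<Phi> (?k \<otimes> d \<otimes> la) = \<Phi> (?k \<otimes> d) \<otimes>\<^bsub>E\<^esub> (Y (?k \<otimes> d \<otimes> a) \<otimes>\<^bsub>E\<^esub> inv\<^bsub>E\<^esub> (Y (?k \<otimes> d \<otimes> as)))"
      by (rule cross[OF kdL])
    moreover have "Y (?k \<otimes> d \<otimes> a) = \<one>\<^bsub>E\<^esub>"
    proof (rule Y0)
      have "int p dvd \<phi> d + \<phi> a" using \<phi>A[OF dA] \<phi>A[OF a(1)] by simp
      then show "int p dvd \<phi> (?k \<otimes> d \<otimes> a)" using cong_dvd_iff[OF val[OF \<phi> \<phi>k aG]] by simp
    qed
    moreover have "Y (?k \<otimes> d \<otimes> as) = Y (d \<otimes> as)"
    proof (rule Y_cong)
      show "[\<phi> (?k \<otimes> d \<otimes> as) = \<phi> (d \<otimes> as)] (mod int p)"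
        using val[OF \<phi> \<phi>k asG] quasi_additiveD[OF \<phi> dL asG] cong_trans cong_sym by blast
      show "[\<psi> m (?k \<otimes> d \<otimes> as) = \<psi> m (d \<otimes> as)] (mod int p)" if "m < 2" for m
        using val[OF \<psi>(1) \<psi>k[OF that] asG] quasi_additiveD[OF \<psi>(1) dL asG, of m] cong_trans cong_sym by blast
    qed
    moreover have kd: "\<Phi> (?k \<otimes> d) = \<Phi> ?k" by (rule \<Phi>conn[OF conn_A[OF kL dA] kG])
    ultimately have "\<one>\<^bsub>E\<^esub> = \<Phi> ?k \<otimes>\<^bsub>E\<^esub> inv\<^bsub>E\<^esub> (Y (d \<otimes> as))" using 2 kd_la YE \<Phi>E[OF kG] by simp
    then have "\<Phi> ?k = Y (d \<otimes> as)"
      using YE[of "d \<otimes> as"] \<Phi>E[OF kG] by (metis E.inv_equality E.inv_inv E.inv_closed)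
    then show ?thesis using k by blast
  qed
  have val_as: "[\<phi> (d \<otimes> as) = j] (mod int p)" "\<And>m. m < 2 \<Longrightarrow> [\<psi> m (d \<otimes> as) = \<psi> m d] (mod int p)" if d: "d \<in> D" for d
  proof -
    have dL: "d \<in> L" and dA: "d \<in> A" using d by (auto simp: D_def)
    have "[\<phi> (d \<otimes> as) = \<phi> d + \<phi> as] (mod int p)" by (rule quasi_additiveD[OF \<phi> dL asG])
    also have "[\<phi> d + \<phi> as = 0 + j] (mod int p)"
      using \<phi>A[OF dA] by (intro cong_add) (simp_all add: cong_0_iff j_def)
    finally show "[\<phi> (d \<otimes> as) = j] (mod int p)" by simp
    fix m :: nat assume m: "m < 2"
    have "[\<psi> m (d \<otimes> as) = \<psi> m d + \<psi> m as] (mod int p)" by (rule quasi_additiveD[OF \<psi>(1) dL asG])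
    also have "[\<psi> m d + \<psi> m as = \<psi> m d + 0] (mod int p)"
      using \<psi>as[OF m] by (intro cong_add cong_refl) (simp add: cong_0_iff)
    finally show "[\<psi> m (d \<otimes> as) = \<psi> m d] (mod int p)" by simp
  qed
  \<comment> \<open>Multiplying \<open>as\<close> by elements of \<open>D\<close> keeps
    \<open>\<phi>\<close> at \<open>j\<close>, so unit vectors as values of \<open>\<psi>\<close>
    bring \<open>Y\<close> to the marked elements.\<close>
  obtain d1 where d1: "d1 \<in> D" "\<And>m. m < 2 \<Longrightarrow> [\<psi> m d1 = of_bool (m = 0)] (mod int p)"
    using jointly_surjD[OF \<psi>_surj, of "\<lambda>m. of_bool (m = 0)"] by blast
  obtain d2 where d2: "d2 \<in> D" "\<And>m. m < 2 \<Longrightarrow> [\<psi> m d2 = of_bool (m = 1)] (mod int p)"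
    using jointly_surjD[OF \<psi>_surj, of "\<lambda>m. of_bool (m = 1)"] by blast
  have "Y (d1 \<otimes> as) = y1"
  proof -
    have "[\<psi> 0 (d1 \<otimes> as) = 1] (mod int p)" using cong_trans[OF val_as(2)[OF d1(1)] d1(2), of 0] by simp
    moreover have "[\<psi> 1 (d1 \<otimes> as) = 0] (mod int p)" using cong_trans[OF val_as(2)[OF d1(1)] d1(2), of 1] by simp
    ultimately show ?thesis using val_as(1)[OF d1(1)] by (simp add: Y_def)
  qed
  moreover have "Y (d2 \<otimes> as) = y2"
  proof -
    have "[\<psi> 0 (d2 \<otimes> as) = 0] (mod int p)" using cong_trans[OF val_as(2)[OF d2(1)] d2(2), of 0] by simp
    moreover have "[\<psi> 1 (d2 \<otimes> as) = 1] (mod int p)" using cong_trans[OF val_as(2)[OF d2(1)] d2(2), of 1] by simp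
    moreover from calculation(1) have "\<not> [\<psi> 0 (d2 \<otimes> as) = 1] (mod int p)" using not10 cong_trans cong_sym by blast
    ultimately show ?thesis using val_as(1)[OF d2(1)] by (simp add: Y_def)
  qed
  ultimately have "y1 \<in> \<Phi> ` K" "y2 \<in> \<Phi> ` K" using attained[OF d1(1)] attained[OF d2(1)] by (metis image_eqI)+
  moreover have "K \<subseteq> L" by (auto simp: K_def)
  ultimately show ?thesis using K ker_K \<Phi>hom by blast
qed

end

section \<open>Linear growth of the number of characters\<close>

context presented_group begin

text \<open>The number of independent characters minus one is at least the index divided by
  \<open>c\<close>, for all finite index subgroups inside \<open>K\<close>. The \<open>+ 1\<close>
  matches the \<open>- 1\<close> in the rank gradient.\<close>

definition linear_growth :: "nat \<Rightarrow> 'g set \<Rightarrow> nat \<Rightarrow> bool" where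
  "linear_growth p K c \<longleftrightarrow> c > 0 \<and> (\<forall>L. subgroup L G \<longrightarrow> L \<subseteq> K \<longrightarrow> finite (rcosets L) \<longrightarrow>
     (\<exists>u. p ^ (u + 1) \<le> card (characters p G L) \<and> card (rcosets L) \<le> c * u))"

lemma linear_growthD:
  "linear_growth p K c \<Longrightarrow> subgroup L G \<Longrightarrow> L \<subseteq> K \<Longrightarrow> finite (rcosets L) \<Longrightarrow>
     \<exists>u. p ^ (u + 1) \<le> card (characters p G L) \<and> card (rcosets L) \<le> c * u"
  by (simp add: linear_growth_def)

text \<open>For index \<open>q\<close> the number of independent characters is at least
  \<open>q * card S - (q - 1)\<close> minus the number of conditions, and the relator
  \<open>r\<close> costs at most \<open>b r\<close> conditions per coset. The critical total cost is
  \<open>card S - 1\<close>; a gap of \<open>1/c\<close> below it leaves \<open>q/c\<close>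
  dimensions beyond the first.\<close>

lemma characters_growth:
  assumes L: "subgroup L G" and fin: "finite (rcosets L)" and p: "prime p"
    and ranks: "\<And>r. r \<in> R \<Longrightarrow> relator_rank_le p L r (n r)"
    and n: "\<And>r. r \<in> R \<Longrightarrow> real (n r) \<le> real (card (rcosets L)) * b r"
    and b: "(\<Sum>r\<in>R. b r) \<le> real (card S) - 1 - 1 / real c" and c: "c > 0"
  shows "\<exists>u. p ^ (u + 1) \<le> card (characters p G L) \<and> card (rcosets L) \<le> c * u"
proof -
  let ?q = "card (rcosets L)" and ?N = "\<Sum>r\<in>R. n r"
  have p1: "p > 1" using prime_gt_1_nat[OF p] .
  have q: "?q > 0" using fin subgroup_in_rcosets'[OF L] card_gt_0_iff by blast
  have "real ?N \<le> real ?q * (\<Sum>r\<in>R. b r)" using n by (simp add: sum_distrib_left sum_mono)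
  also have "\<dots> \<le> real ?q * (real (card S) - 1 - 1 / real c)" using b by (intro mult_left_mono) auto
  finally have N: "real ?N + real ?q + real ?q / real c \<le> real ?q * real (card S)" by (simp add: algebra_simps)
  then have "real (?N + ?q) \<le> real (?q * card S)" using c by (simp add: le_diff_eq[symmetric]) (smt (verit) divide_nonneg_nonneg of_nat_0_le_iff)
  then have le: "?N + ?q \<le> ?q * card S" by linarith
  define u where "u = ?q * card S - (?N + ?q)"
  have u: "?q * card S = ?N + ?q + u" using le by (simp add: u_def)
  have "real ?q / real c \<le> real u"
  proof -
    have "real ?q * real (card S) = real ?N + real ?q + real u" using u by (metis of_nat_add of_nat_mult)
    then show ?thesis using N by linarith
  qed
  then have "real ?q \<le> real (c * u)" using c by (simp add: divide_le_eq mult.commute)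
  then have "?q \<le> c * u" by linarith
  moreover have "p ^ (u + 1) \<le> card (characters p G L)"
  proof -
    have "?q * card S = ?N + ((u + 1) + (?q - 1))" using u q by simp
    then have "p ^ (?q * card S) = p ^ ?N * (p ^ (u + 1) * p ^ (?q - 1))" by (simp only: power_add)
    moreover have "p ^ (?q * card S) \<le> p ^ ?N * (card (characters p G L) * p ^ (?q - 1))"
      by (rule card_characters_lower[OF L fin _ ranks]) (use p1 in auto)
    ultimately have "p ^ ?N * (p ^ (u + 1) * p ^ (?q - 1)) \<le> p ^ ?N * (card (characters p G L) * p ^ (?q - 1))"
      by (simp only:)
    then show ?thesis using p1 by simp
  qed
  ultimately show ?thesis by blast
qed

section \<open>Towers of subgroups of p-power index\<close>

definition p_tower :: "nat \<Rightarrow> 'g set \<Rightarrow> 'g set \<Rightarrow> bool" where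
  "p_tower p K L \<longleftrightarrow> subgroup L G \<and> L \<subseteq> K \<and> finite (rcosets L) \<and> L \<lhd> G\<lparr>carrier := K\<rparr> \<and>
     (\<exists>t. card (rcosets\<^bsub>G\<lparr>carrier := K\<rparr>\<^esub> L) = p ^ t)"

context
  fixes p K c
  assumes p: "prime p" and K: "subgroup K G" "finite (rcosets K)" and growth: "linear_growth p K c"
begin

lemma p_tower_self: "p_tower p K K"
proof -
  interpret K: group "G\<lparr>carrier := K\<rparr>" using K(1) by (rule subgroup_imp_group)
  have "rcosets\<^bsub>G\<lparr>carrier := K\<rparr>\<^esub> K = {K}"
    using coset_self[OF K(1)] subgroup.one_closed[OF K(1)] by (auto simp: rcosets_restrict_image)
  then have "card (rcosets\<^bsub>G\<lparr>carrier := K\<rparr>\<^esub> K) = p ^ 0" by simp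
  then have "\<exists>t. card (rcosets\<^bsub>G\<lparr>carrier := K\<rparr>\<^esub> K) = p ^ t" by (rule exI)
  then show ?thesis using K K.normal_self unfolding p_tower_def by auto
qed

text \<open>The exponent \<open>u + 1\<close> in the growth hypothesis is positive, so every member
  of the tower has a nontrivial character and each step strictly increases the index.\<close>

lemma p_tower_step:
  assumes L: "p_tower p K L"
  shows "p_tower p K (char_kernel p G L)"
    and "card (rcosets (char_kernel p G L)) =
      card (rcosets L) * card (rcosets\<^bsub>G\<lparr>carrier := L\<rparr>\<^esub> (char_kernel p G L))"
    and "card (rcosets L) < card (rcosets (char_kernel p G L))"
proof -
  let ?M = "char_kernel p G L"
  have p1: "p > 1" using prime_gt_1_nat[OF p] .
  have LG: "subgroup L G" and LK: "L \<subseteq> K" and fin: "finite (rcosets L)" and norm: "L \<lhd> G\<lparr>carrier := K\<rparr>"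
    using L by (auto simp: p_tower_def)
  obtain t where t: "card (rcosets\<^bsub>G\<lparr>carrier := K\<rparr>\<^esub> L) = p ^ t" using L by (auto simp: p_tower_def)
  have finC: "finite (characters p G L)" using finite_characters[OF LG fin] p1 by simp
  obtain n where n: "card (rcosets\<^bsub>G\<lparr>carrier := L\<rparr>\<^esub> ?M) = p ^ n"
    "finite (rcosets\<^bsub>G\<lparr>carrier := L\<rparr>\<^esub> ?M)" "card (characters p G L) \<le> p ^ n"
    by (rule index_char_kernel[OF LG p finC])
  have MG: "subgroup ?M G" using LG by (rule char_kernel_subgroup)
  have M_sub': "?M \<subseteq> L" by (rule char_kernel_subset)
  interpret K: group "G\<lparr>carrier := K\<rparr>" using K(1) by (rule subgroup_imp_group)
  have "card (rcosets\<^bsub>G\<lparr>carrier := K\<rparr>\<^esub> ?M) =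
    card (rcosets\<^bsub>G\<lparr>carrier := K\<rparr>\<^esub> L) * card (rcosets\<^bsub>G\<lparr>carrier := L\<rparr>\<^esub> ?M)"
    using K.index_mult[of ?M L] subgroup_incl[OF MG K(1)] subgroup_incl[OF LG K(1)] LK M_sub' by simp
  then have "card (rcosets\<^bsub>G\<lparr>carrier := K\<rparr>\<^esub> ?M) = p ^ (t + n)" using t n by (simp add: power_add)
  moreover have "finite (rcosets ?M)" using finite_rcosets_trans[OF MG LG M_sub' fin n(2)] .
  ultimately show "p_tower p K ?M"
    using MG M_sub' LK char_kernel_normal[OF K(1) norm LG] unfolding p_tower_def by blast
  show mult: "card (rcosets ?M) = card (rcosets L) * card (rcosets\<^bsub>G\<lparr>carrier := L\<rparr>\<^esub> ?M)"
    by (rule index_mult[OF MG LG M_sub'])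
  obtain u where "p ^ (u + 1) \<le> card (characters p G L)" using linear_growthD[OF growth LG LK fin] by blast
  then have "p ^ (u + 1) \<le> p ^ n" using n(3) by simp
  then have "u + 1 \<le> n" by (rule power_le_imp_le_exp[OF p1])
  then have "1 < p ^ n" using p1 by (intro one_less_power) auto
  moreover have "card (rcosets L) > 0" using fin subgroup_in_rcosets'[OF LG] card_gt_0_iff by blast
  ultimately show "card (rcosets L) < card (rcosets ?M)" using mult n(1) by simp
qed

lemma p_tower_large_index: "\<exists>L. p_tower p K L \<and> B \<le> card (rcosets L)"
proof (induction B)
  case 0
  then show ?case using p_tower_self by auto
next
  case (Suc B)
  then obtain L where "p_tower p K L" "B \<le> card (rcosets L)" by blast
  then show ?case using p_tower_step(1,3)[of L] by (intro exI[of _ "char_kernel p G L"]) auto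
qed

text \<open>Each step of the tower multiplies the relative size of the support by at most \<open>1 - p^-k\<close>.\<close>

lemma tower_of_small_supports:
  fixes k Q :: nat
  assumes k: "k = c * (card R + 1)" and Q: "k * k + k \<le> Q"
  shows "\<exists>L \<phi>. p_tower p K L \<and> Q \<le> card (rcosets L) \<and> (\<forall>i<k. quasi_additive p G L (\<phi> i)) \<and>
    jointly_surj p L \<phi> k \<and>
    card (edge_support p L \<phi> k) * p ^ (k * j) \<le> card (rcosets L) * card S * (p ^ k - 1) ^ j"
proof -
  have p1: "p > 1" using prime_gt_1_nat[OF p] .
  have c: "c > 0" using growth by (simp add: linear_growth_def)
  have ck: "c \<le> k" unfolding k by simp
  \<comment> \<open>From \<open>q \<le> c * u\<close> and the choice of \<open>k\<close> follows
    \<open>q * card R + q \<le> u * k\<close>; once \<open>q\<close> is at least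
    \<open>k * k + k\<close>, this is the room that \<open>tower_step\<close> asks for. Both
    constants come from here.\<close>
  have room: "k \<le> u \<and> q * card R + k \<le> (u - k) * k" if q: "Q \<le> q" "q \<le> c * u" for q u
  proof -
    have "c * k \<le> k * k" using ck by (rule mult_le_mono1)
    then have "c * k \<le> c * u" using Q q by linarith
    then have ku: "k \<le> u" using c by simp
    have "q * (card R + 1) \<le> (c * u) * (card R + 1)" using q(2) by (rule mult_le_mono1)
    also have "\<dots> = u * k" unfolding k by (simp add: algebra_simps)
    finally have "q * card R + q \<le> u * k" by simp
    then have "q * card R + k + k * k \<le> u * k" using Q q(1) by linarith
    then show ?thesis using ku by (simp add: diff_mult_distrib)
  qed
  show ?thesis
  proof (induction j)
    case 0
    obtain L where L: "p_tower p K L" "Q \<le> card (rcosets L)" using p_tower_large_index by blast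
    have LG: "subgroup L G" and LK: "L \<subseteq> K" and fin: "finite (rcosets L)" using L(1) by (auto simp: p_tower_def)
    obtain u where u: "p ^ (u + 1) \<le> card (characters p G L)" "card (rcosets L) \<le> c * u"
      using linear_growthD[OF growth LG LK fin] by blast
    have "k \<le> u" using room[OF L(2) u(2)] by simp
    then have "p ^ k \<le> p ^ (u + 1)" using p1 by (intro power_increasing) auto
    then have chars: "p ^ k \<le> card (characters p G L)" using u(1) by linarith
    have finC: "finite (characters p G L)" using finite_characters[OF LG fin] p1 by simp
    have "jointly_surj p L (\<lambda>_ _. 0) 0" using subgroup.one_closed[OF LG] by (auto simp: jointly_surj_def)
    from jointly_surj_extend[OF LG p finC _ this _ chars]
    obtain \<theta> :: "nat \<Rightarrow> 'g \<Rightarrow> int" where \<theta>: "\<forall>i<k. additive_mod p G L (\<theta> i)" "jointly_surj p L \<theta> k" by blast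
    define \<phi> where "\<phi> i = coset_extension G L (\<theta> i) (\<lambda>_. 0)" for i
    have "quasi_additive p G L (\<phi> i)" if "i < k" for i
      unfolding \<phi>_def by (rule coset_extension_quasi[OF LG]) (use \<theta> that in auto)
    moreover have "jointly_surj p L \<phi> k"
      by (rule jointly_surj_cong[OF \<theta>(2)]) (simp add: \<phi>_def coset_extension_self[OF LG])
    moreover have "card (edge_support p L \<phi> k) \<le> card ((rcosets L) \<times> S)"
      using fin finite_S by (intro card_mono edge_support_subset) auto
    then have "card (edge_support p L \<phi> k) * p ^ (k * 0) \<le> card (rcosets L) * card S * (p ^ k - 1) ^ 0"
      by (simp add: card_cartesian_product)
    ultimately show ?case using L by blast
  next
    case (Suc j)
    then obtain L \<phi> where L: "p_tower p K L" "Q \<le> card (rcosets L)"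
      and \<phi>: "\<And>i. i < k \<Longrightarrow> quasi_additive p G L (\<phi> i)" "jointly_surj p L \<phi> k"
      and supp: "card (edge_support p L \<phi> k) * p ^ (k * j) \<le> card (rcosets L) * card S * (p ^ k - 1) ^ j"
      by blast
    have LG: "subgroup L G" and LK: "L \<subseteq> K" and fin: "finite (rcosets L)" using L(1) by (auto simp: p_tower_def)
    obtain u where u: "p ^ (u + 1) \<le> card (characters p G L)" "card (rcosets L) \<le> c * u"
      using linear_growthD[OF growth LG LK fin] by blast
    have ku: "k \<le> u" "card (rcosets L) * card R + k \<le> (u - k) * k" using room[OF L(2) u(2)] by auto
    have "p ^ u \<le> p ^ (u + 1)" using p1 by (intro power_increasing) auto
    then have chars: "p ^ u \<le> card (characters p G L)" using u(1) by linarith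
    let ?M = "char_kernel p G L"
    let ?P = "card (rcosets\<^bsub>G\<lparr>carrier := L\<rparr>\<^esub> ?M)"
    obtain \<phi>' where \<phi>': "\<forall>i<k. quasi_additive p G ?M (\<phi>' i)" "jointly_surj p ?M \<phi>' k"
      "card (edge_support p ?M \<phi>' k) * p ^ k \<le> card (edge_support p L \<phi> k) * ?P * (p ^ k - 1)"
      using tower_step[OF LG fin p chars ku(1) \<phi> ku(2) refl] by blast
    have "card (edge_support p ?M \<phi>' k) * p ^ (k * Suc j) = (card (edge_support p ?M \<phi>' k) * p ^ k) * p ^ (k * j)"
      by (simp add: power_add mult_ac)
    also have "\<dots> \<le> (card (edge_support p L \<phi> k) * ?P * (p ^ k - 1)) * p ^ (k * j)" using \<phi>'(3) by (rule mult_le_mono1)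
    also have "\<dots> = (card (edge_support p L \<phi> k) * p ^ (k * j)) * (?P * (p ^ k - 1))" by (simp add: mult_ac)
    also have "\<dots> \<le> (card (rcosets L) * card S * (p ^ k - 1) ^ j) * (?P * (p ^ k - 1))" using supp by (rule mult_le_mono1)
    also have "\<dots> = card (rcosets ?M) * card S * (p ^ k - 1) ^ Suc j"
      unfolding p_tower_step(2)[OF L(1)] by (simp add: mult_ac)
    finally show ?case using p_tower_step(1,3)[OF L(1)] L(2) \<phi>'(1,2) by (meson le_trans less_imp_le)
  qed
qed

text \<open>The target is the free group on \<open>x\<close> and \<open>y\<close> inside
  \<open>F\<close>. \<open>char_kernel p G L\<close> lies in the domain of the resulting
  homomorphism and belongs to the tower, which makes \<open>K\<close> \<open>p\<close>-large; its
  normal core in \<open>G\<close> makes \<open>G\<close> large.\<close>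

theorem free_quotient_of_linear_growth:
  assumes xy: "x \<in> S" "y \<in> S" "x \<noteq> y"
  shows "p_large p (G\<lparr>carrier := K\<rparr>)" "large G"
proof -
  have p1: "p > 1" using prime_gt_1_nat[OF p] .
  have c: "c > 0" using growth by (simp add: linear_growth_def)
  define k where "k = c * (card R + 1)"
  have k0: "k > 0" using c by (simp add: k_def)
  define W where "W = relator_length * relator_length + 2"
  define X where "X = real (W * card S * 2 * c)"
  have X0: "X \<ge> 0" by (simp add: X_def)
  \<comment> \<open>\<open>X\<close> collects the constants so that at depth \<open>j\<close> the
    support times \<open>2 * c * W\<close> is at most the index, hence the support times
    \<open>2 * W\<close> is at most \<open>u\<close>. Asking below for an index of at least
    \<open>4 * c\<close> gives \<open>u \<ge> 4\<close>, so that the other half of \<open>u\<close>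
    absorbs the summand \<open>2\<close> of the room condition.\<close>
  have "\<exists>j. X * (real (p ^ k - 1) / real (p ^ k)) ^ j < 1"
  proof -
    have "real (p ^ k - 1) < real (p ^ k)" using p1 by (simp only: of_nat_less_iff) simp
    moreover have "real (p ^ k) > 0" using p1 by simp
    ultimately have "real (p ^ k - 1) / real (p ^ k) < 1" by (simp only: divide_less_eq_1_pos)
    then obtain j where j: "(real (p ^ k - 1) / real (p ^ k)) ^ j < 1 / (X + 1)"
      using real_arch_pow_inv[of "1 / (X + 1)"] X0 by auto
    define y where "y = (real (p ^ k - 1) / real (p ^ k)) ^ j"
    have "y * (X + 1) < 1" using j X0 unfolding y_def[symmetric] by (subst (asm) pos_less_divide_eq) auto
    moreover have "y * (X + 1) = X * y + y" by (simp add: algebra_simps)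
    moreover have "0 \<le> y" unfolding y_def by (intro zero_le_power divide_nonneg_nonneg) auto
    ultimately have "X * y < 1" by linarith
    then show ?thesis unfolding y_def by blast
  qed
  then obtain j where "X * (real (p ^ k - 1) / real (p ^ k)) ^ j < 1" by blast
  then have "real (W * card S * 2 * c * (p ^ k - 1) ^ j) < real (p ^ (k * j))"
    using p1 unfolding X_def by (simp add: power_divide power_mult[symmetric] divide_less_eq del: of_nat_diff)
  then have j: "W * card S * 2 * c * (p ^ k - 1) ^ j \<le> p ^ (k * j)" by linarith
  obtain L \<phi> where L: "p_tower p K L" "k * k + k + 4 * c \<le> card (rcosets L)"
    and \<phi>: "\<And>i. i < k \<Longrightarrow> quasi_additive p G L (\<phi> i)" "jointly_surj p L \<phi> k"
    and supp: "card (edge_support p L \<phi> k) * p ^ (k * j) \<le> card (rcosets L) * card S * (p ^ k - 1) ^ j"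
    using tower_of_small_supports[OF k_def, of "k * k + k + 4 * c" j] by auto
  have LG: "subgroup L G" and LK: "L \<subseteq> K" and fin: "finite (rcosets L)" using L(1) by (auto simp: p_tower_def)
  let ?q = "card (rcosets L)" and ?e = "card (edge_support p L \<phi> k)"
  obtain u where u: "p ^ (u + 1) \<le> card (characters p G L)" "?q \<le> c * u"
    using linear_growthD[OF growth LG LK fin] by blast
  have "(2 * c * W * ?e) * p ^ (k * j) = (2 * c * W) * (?e * p ^ (k * j))" by simp
  also have "\<dots> \<le> (2 * c * W) * (?q * card S * (p ^ k - 1) ^ j)" using supp by (rule mult_le_mono2)
  also have "\<dots> = ?q * (W * card S * 2 * c * (p ^ k - 1) ^ j)" by (simp add: mult_ac)
  also have "\<dots> \<le> ?q * p ^ (k * j)" using j by (rule mult_le_mono2)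
  finally have "2 * c * W * ?e \<le> ?q" using p1 by simp
  moreover have "c * (2 * (W * ?e)) = 2 * c * W * ?e" by (simp only: mult_ac)
  ultimately have "c * (2 * (W * ?e)) \<le> c * u" using u(2) by linarith
  then have 1: "2 * (W * ?e) \<le> u" using c by simp
  have "c * 4 \<le> c * u" using L(2) u(2) by linarith
  then have "4 \<le> u" using c by simp
  then have 2: "W * ?e + 2 \<le> u" using 1 by linarith
  have "support p L (\<phi> 0) \<subseteq> edge_support p L \<phi> k" using k0 by (auto simp: support_def edge_support_def)
  then have "card (support p L (\<phi> 0)) \<le> ?e" by (rule card_mono[OF finite_edge_support[OF fin]])
  then have "W * card (support p L (\<phi> 0)) \<le> W * ?e" by (rule mult_le_mono2)
  then have room: "(relator_length * relator_length + 2) * card (support p L (\<phi> 0)) + 2 \<le> u"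
    using 2 unfolding W_def by linarith
  have nontriv: "\<exists>l\<in>L. \<not> int p dvd \<phi> 0 l"
  proof -
    obtain l where l: "l \<in> L" "[\<phi> 0 l = 1] (mod int p)" using jointly_surjD[OF \<phi>(2), of "\<lambda>_. 1"] k0 by blast
    have "\<not> int p dvd 1" using p1 by (simp add: zdvd1_eq)
    then show ?thesis using l cong_dvd_iff by blast
  qed
  have "p ^ u \<le> p ^ (u + 1)" using p1 by (intro power_increasing) auto
  then have chars: "p ^ u \<le> card (characters p G L)" using u(1) by linarith
  let ?E = "F\<lparr>carrier := generate F {x, y}\<rparr>"
  have "freely_generates ?E {x, y}" using free_F by (rule freely_generates_subset_basis) (use xy in auto)
  then have E: "group ?E" by (rule freely_generates_group)
  have "x \<in> carrier ?E" "y \<in> carrier ?E" by (auto intro: generate.incl)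
  from free_quotient_of_small_support[OF LG fin p chars \<phi>(1)[OF k0] nontriv room E this]
  obtain L1 \<Phi> where L1: "subgroup L1 G" "L1 \<subseteq> L" "char_kernel p G L \<subseteq> L1"
    and \<Phi>: "\<Phi> \<in> hom (G\<lparr>carrier := L1\<rparr>) ?E" "x \<in> \<Phi> ` L1" "y \<in> \<Phi> ` L1" by blast
  let ?M = "char_kernel p G L"
  have M: "p_tower p K ?M" using L(1) by (rule p_tower_step)
  have quot: "has_nonabelian_free_quotient (G\<lparr>carrier := N\<rparr>)" if "subgroup N G" "N \<subseteq> L1" "finite (rcosets N)" for N
    by (rule finite_index_free_quotient[OF L1(1) that free_F xy \<Phi>])
  have MG: "subgroup ?M G" "finite (rcosets ?M)" using M by (auto simp: p_tower_def)
  have "?M \<subseteq> K" using M by (simp add: p_tower_def)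
  then have finK: "finite (rcosets\<^bsub>G\<lparr>carrier := K\<rparr>\<^esub> ?M)"
    by (rule finite_rcosets_intermediate[OF MG(1) K(1) _ MG(2)])
  show "p_large p (G\<lparr>carrier := K\<rparr>)" unfolding p_large_def
    using M finK quot[OF MG(1) L1(3) MG(2)] by (intro exI[of _ ?M]) (auto simp: p_tower_def)
  obtain N where N: "N \<lhd> G" "N \<subseteq> ?M" "finite (rcosets N)" using finite_index_core[OF MG] by blast
  have "has_nonabelian_free_quotient (G\<lparr>carrier := N\<rparr>)"
    using N L1(3) by (intro quot normal_imp_subgroup) auto
  then show "large G" unfolding large_def using N by blast
qed

text \<open>Let \<open>L\<close>, the intersection of \<open>H\<close> and \<open>K\<close>, have
  index \<open>m\<close> in \<open>H\<close>, and let \<open>H\<close> need \<open>d\<close>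
  generators. Schreier's bound inside \<open>H\<close> against growth for \<open>L\<close> gives
  \<open>u \<le> m * (d - 1)\<close>, while \<open>c * u\<close> is at least \<open>m\<close> times
  the index of \<open>H\<close>. The factor \<open>m\<close> cancels, so \<open>1/c\<close> bounds
  every term of the infimum from below.\<close>

theorem rank_gradient_of_linear_growth: "rank_gradient G > 0"
proof -
  have p1: "p > 1" using prime_gt_1_nat[OF p] .
  have c: "c > 0" using growth by (simp add: linear_growth_def)
  have "1 / real c \<le> (real (min_generators G H) - 1) / real (card (rcosets H))"
    if H: "finite_index_subgroup H G" for H
  proof -
    have HG: "subgroup H G" and finH: "finite (rcosets H)" using H by (auto simp: finite_index_subgroup_def)
    let ?d = "min_generators G H"
    have "\<exists>n. \<exists>T\<subseteq>H. finite T \<and> card T = n \<and> generate G T = H"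
      using finite_index_finitely_generated[OF HG finH _ generate_generators] finite_S by blast
    from LeastI_ex[OF this] obtain T where T: "T \<subseteq> H" "finite T" "card T = ?d" "generate G T = H"
      unfolding min_generators_def[symmetric] by blast
    define L where "L = H \<inter> K"
    have LG: "subgroup L G" unfolding L_def using HG K(1) by (rule subgroups_Inter_pair)
    have LH: "L \<subseteq> H" and LK: "L \<subseteq> K" by (auto simp: L_def)
    have finL: "finite (rcosets L)" unfolding L_def by (rule finite_rcosets_Int[OF HG K(1) finH K(2)])
    obtain u where u: "p ^ (u + 1) \<le> card (characters p G L)" "card (rcosets L) \<le> c * u"
      using linear_growthD[OF growth LG LK finL] by blast
    interpret H: group "G\<lparr>carrier := H\<rparr>" using HG by (rule subgroup_imp_group)
    let ?m = "card (rcosets\<^bsub>G\<lparr>carrier := H\<rparr>\<^esub> L)"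
    have finHL: "finite (rcosets\<^bsub>G\<lparr>carrier := H\<rparr>\<^esub> L)" by (rule finite_rcosets_intermediate[OF LG HG LH finL])
    have LH': "subgroup L (G\<lparr>carrier := H\<rparr>)" using LG HG LH by (rule subgroup_incl)
    have m0: "?m > 0" using finHL H.subgroup_in_rcosets'[OF LH'] card_gt_0_iff by blast
    have "characters p (G\<lparr>carrier := H\<rparr>) L = characters p G L" by (simp add: characters_def additive_mod_def)
    moreover have "generate (G\<lparr>carrier := H\<rparr>) T = carrier (G\<lparr>carrier := H\<rparr>)"
      using generate_consistent[OF T(1) HG] T(4) by simp
    ultimately have "card (characters p G L) * p ^ (?m - 1) \<le> p ^ (?m * ?d)"
      using H.card_characters_upper(2)[OF T(2) _ LH' finHL, where p = p] p1 T(3) by simp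
    then have "p ^ (u + 1) * p ^ (?m - 1) \<le> p ^ (?m * ?d)" using u(1) by (meson le_trans mult_le_mono1)
    then have "p ^ (u + 1 + (?m - 1)) \<le> p ^ (?m * ?d)" by (simp only: power_add)
    then have "u + 1 + (?m - 1) \<le> ?m * ?d" by (rule power_le_imp_le_exp[OF p1])
    then have "u + ?m \<le> ?m * ?d" using m0 by simp
    then have "real u + real ?m \<le> real ?m * real ?d" by (metis of_nat_add of_nat_le_iff of_nat_mult)
    then have ud: "real u \<le> real ?m * (real ?d - 1)" by (simp add: algebra_simps)
    have "real (card (rcosets H)) * real ?m = real (card (rcosets L))" using index_mult[OF LG HG LH] by simp
    also have "\<dots> \<le> real c * real u" using u(2) by (metis of_nat_le_iff of_nat_mult)
    also have "\<dots> \<le> real c * (real ?m * (real ?d - 1))" using ud by (intro mult_left_mono) auto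
    finally have "real ?m * real (card (rcosets H)) \<le> real ?m * (real c * (real ?d - 1))" by (simp add: mult_ac)
    then have "real (card (rcosets H)) \<le> real c * (real ?d - 1)" using m0 by simp
    moreover have "card (rcosets H) > 0" using finH subgroup_in_rcosets'[OF HG] card_gt_0_iff by blast
    ultimately show ?thesis using c by (simp add: field_simps)
  qed
  moreover have "finite_index_subgroup K G" using K by (simp add: finite_index_subgroup_def)
  ultimately have "1 / real c \<le> rank_gradient G" unfolding rank_gradient_def
    by (intro cInf_greatest) auto
  moreover have "0 < 1 / real c" using c by simp
  ultimately show ?thesis by linarith
qed

end

end

section \<open>Orders modulo the finite residual\<close>

context group begin

text \<open>As \<open>ord\<close> is \<open>0\<close> for infinite order, the divisibility form
  covers that case too.\<close>

lemma pow_in_finite_residual_iff: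
  assumes g: "g \<in> carrier G"
  shows "g [^] (n::nat) \<in> finite_residual G \<longleftrightarrow>
    group.ord (G Mod finite_residual G) (finite_residual G #> g) dvd n"
proof -
  let ?N = "finite_residual G"
  interpret N: normal ?N G by (rule finite_residual_normal)
  interpret Q: group "G Mod ?N" by (rule N.factorgroup_is_group)
  have N: "subgroup ?N G" by (rule normal_imp_subgroup[OF finite_residual_normal])
  have "?N #> g \<in> carrier (G Mod ?N)" using g by (simp add: carrier_FactGroup)
  then have "Q.ord (?N #> g) dvd n \<longleftrightarrow> (?N #> g) [^]\<^bsub>G Mod ?N\<^esub> n = ?N" using Q.pow_eq_id by simp
  also have "(?N #> g) [^]\<^bsub>G Mod ?N\<^esub> n = ?N #> (g [^] n)" using g by (simp add: N.FactGroup_pow)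
  also have "?N #> (g [^] n) = ?N \<longleftrightarrow> g [^] n \<in> ?N"
    using coset_eq_iff[OF N _ one_closed, of "g [^] n"] coset_one[OF N] g by simp
  finally show ?thesis by simp
qed

lemma finite_residual_subset: "subgroup L G \<Longrightarrow> finite (rcosets L) \<Longrightarrow> finite_residual G \<subseteq> L"
  by (auto simp: finite_residual_def finite_index_subgroup_def)

text \<open>Each of the finitely many powers is missed by some subgroup of finite index, and normal
  cores of these are intersected one at a time.\<close>

lemma finite_index_normal_avoiding_powers:
  assumes g: "g \<in> carrier G" and "\<And>s. 0 < s \<Longrightarrow> s < n \<Longrightarrow> g [^] (s::nat) \<notin> finite_residual G"
  shows "\<exists>K. K \<lhd> G \<and> finite (rcosets K) \<and> (\<forall>s. 0 < s \<longrightarrow> s < n \<longrightarrow> g [^] s \<notin> K)"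
  using assms(2)
proof (induction n)
  case 0
  have "finite (rcosets (carrier G))"
    using finite_rcosets_if_fibres[OF subgroup_self, of UNIV "\<lambda>_. ()"] by auto
  then show ?case using normal_self by auto
next
  case (Suc n)
  then obtain K where K: "K \<lhd> G" "finite (rcosets K)" "\<And>s. 0 < s \<Longrightarrow> s < n \<Longrightarrow> g [^] s \<notin> K" by force
  show ?case
  proof (cases "n = 0")
    case True
    then show ?thesis using K by auto
  next
    case False
    then have "g [^] n \<notin> finite_residual G" using Suc.prems by simp
    then obtain H where H: "subgroup H G" "finite (rcosets H)" "g [^] n \<notin> H"
      by (auto simp: finite_residual_def finite_index_subgroup_def)
    obtain N where N: "N \<lhd> G" "N \<subseteq> H" "finite (rcosets N)" using finite_index_core[OF H(1,2)] by blast
    have "K \<inter> N \<lhd> G" using K(1) N(1) by (rule normal_subgroup_intersect)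
    moreover have "finite (rcosets (K \<inter> N))"
      by (rule finite_rcosets_Int[OF normal_imp_subgroup[OF K(1)] normal_imp_subgroup[OF N(1)] K(2) N(3)])
    moreover have "g [^] s \<notin> K \<inter> N" if "0 < s" "s < Suc n" for s
      using that K(3)[of s] H(3) N(2) by (cases "s = n") auto
    ultimately show ?thesis by blast
  qed
qed

end

section \<open>Relators that cost fewer conditions than the deficiency accounts for\<close>

theorem theorem3p3:
  fixes F :: "'a monoid" and G :: "'g monoid"
    and S R :: "'a set" and \<pi> :: "'a \<Rightarrow> 'g" and \<psi> :: "'a \<Rightarrow> 'g set"
    and p d :: nat
    and r u w :: "nat \<Rightarrow> 'a" and m a k l :: "nat \<Rightarrow> nat"
  assumes "prime p"
    and "group G"
    and "finite S" and "card S \<ge> 2"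
    and "presentation F S R G \<pi>"
    and "R = r ` {1..d}"
    and "p_deficiency F S R p = 1"
    and "\<And>i. i \<in> {1..d} \<Longrightarrow> minimal_root F (r i) (u i)"
    and "\<And>i. i \<in> {1..d} \<Longrightarrow> m i = root_exponent F (r i)"
    and "\<And>i. i \<in> {1..d} \<Longrightarrow> minimal_p_root F p (r i) (w i)"
    and "\<And>i. i \<in> {1..d} \<Longrightarrow> a i = p_exponent F p (r i)"
    and "\<And>x. x \<in> carrier F \<Longrightarrow> \<psi> x = finite_residual G #>\<^bsub>G\<^esub> \<pi> x"
    and "\<And>i. i \<in> {1..d} \<Longrightarrow> k i = group.ord (G Mod finite_residual G) (\<psi> (u i))"
    and "\<And>i. i \<in> {1..d} \<Longrightarrow> l i = group.ord (G Mod finite_residual G) (\<psi> (w i))"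
  shows "((\<exists>i\<in>{1..d}. l i < p ^ a i) \<longrightarrow> p_large p G \<and> rank_gradient G > 0) \<and>
         ((\<forall>i\<in>{1..d}. l i = p ^ a i) \<and> (\<exists>i\<in>{1..d}. l i < k i) \<longrightarrow>
            (\<exists>H. finite_index_subgroup H G \<and> p_large p (G\<lparr>carrier := H\<rparr>)) \<and>
            large G \<and> rank_gradient G > 0)"
proof -
  interpret G: group G by fact
  have free: "freely_generates F S" using assms(5) by (simp add: presentation_def)
  interpret F: group F using free by (rule freely_generates_group)
  have SF: "S \<subseteq> carrier F" using free by (rule freely_generates_subset)
  let ?RG = "finite_residual G"
  have p1: "p > 1" using prime_gt_1_nat[OF assms(1)] .
  obtain x y where xy: "x \<in> S" "y \<in> S" "x \<noteq> y"
    using assms(3,4) card_le_Suc0_iff_eq[of S] by fastforce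
  have finR: "finite R" using assms(6) by simp
  have w: "w i \<in> carrier F" "r i = w i [^]\<^bsub>F\<^esub> (p ^ a i)" if "i \<in> {1..d}" for i
    using assms(10)[OF that] assms(11)[OF that] by (auto simp: minimal_p_root_def)
  have u: "u i \<in> carrier F" "u i [^]\<^bsub>F\<^esub> m i = r i" if "i \<in> {1..d}" for i
    using assms(8)[OF that] assms(9)[OF that] by (auto simp: minimal_root_def)
  define pe where "pe = p_exponent F p"
  have deficiency: "(\<Sum>s\<in>R. 1 / real p ^ pe s) = real (card S) - 1"
    using assms(7) by (simp add: p_deficiency_def pe_def)
  \<comment> \<open>The indexing by \<open>{1..d}\<close> may list a relator repeatedly, so a root
    is chosen for each element of the set \<open>R\<close>.\<close>
  have "\<forall>s. \<exists>v. s \<in> R \<longrightarrow> v \<in> carrier F \<and> s = v [^]\<^bsub>F\<^esub> (p ^ pe s)"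
  proof (intro allI)
    fix s
    show "\<exists>v. s \<in> R \<longrightarrow> v \<in> carrier F \<and> s = v [^]\<^bsub>F\<^esub> (p ^ pe s)"
    proof (cases "s \<in> R")
      case True
      then obtain i where i: "i \<in> {1..d}" "s = r i" using assms(6) by blast
      have "pe s = a i" using assms(11)[OF i(1)] i(2) by (simp add: pe_def)
      then show ?thesis using w[OF i(1)] i(2) by (intro exI[of _ "w i"]) simp
    qed simp
  qed
  from choice[OF this] obtain wr where wr': "\<forall>s. s \<in> R \<longrightarrow> wr s \<in> carrier F \<and> s = wr s [^]\<^bsub>F\<^esub> (p ^ pe s)" by (rule exE)
  have "\<forall>v. \<exists>ws. v \<in> carrier F \<longrightarrow> fst ` set ws \<subseteq> S \<and> word_value F ws = v"
    using free_word_ex[OF free] by blast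
  from choice[OF this] obtain word where word': "\<forall>v. v \<in> carrier F \<longrightarrow> fst ` set (word v) \<subseteq> S \<and> word_value F (word v) = v"
    by (rule exE)
  have word: "fst ` set (word v) \<subseteq> S" "word_value F (word v) = v" if "v \<in> carrier F" for v using word' that by auto
  have word_pow: "fst ` set (concat (replicate n (word v))) \<subseteq> S"
    "word_value F (concat (replicate n (word v))) = v [^]\<^bsub>F\<^esub> n" if "v \<in> carrier F" for v n
  proof -
    have "set (concat (replicate n (word v))) \<subseteq> set (word v)" by (induction n) auto
    then show "fst ` set (concat (replicate n (word v))) \<subseteq> S" using word(1)[OF that] by blast
    show "word_value F (concat (replicate n (word v))) = v [^]\<^bsub>F\<^esub> n"
      using F.word_value_concat_replicate[of "word v" n] word[OF that] SF by auto
  qed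
  have presented: "presented_group G F S R \<pi> (\<lambda>s. concat (replicate (P s) (word (v s))))"
    if "\<And>s. s \<in> R \<Longrightarrow> v s \<in> carrier F \<and> s = v s [^]\<^bsub>F\<^esub> P s" for v and P :: "'a \<Rightarrow> nat"
    by unfold_locales (use assms(3,5) finR that word_pow in auto)
  have ord_w: "\<pi> (w i) [^]\<^bsub>G\<^esub> n \<in> ?RG \<longleftrightarrow> l i dvd n" if "i \<in> {1..d}" "\<pi> (w i) \<in> carrier G" for i and n :: nat
    using G.pow_in_finite_residual_iff[OF that(2), of n] assms(14)[OF that(1)] assms(12)[OF w(1)[OF that(1)]] by simp
  have ord_u: "\<pi> (u i) [^]\<^bsub>G\<^esub> n \<in> ?RG \<longleftrightarrow> k i dvd n" if "i \<in> {1..d}" "\<pi> (u i) \<in> carrier G" for i and n :: nat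
    using G.pow_in_finite_residual_iff[OF that(2), of n] assms(13)[OF that(1)] assms(12)[OF u(1)[OF that(1)]] by simp
  have RG: "subgroup ?RG G" by (rule normal_imp_subgroup[OF G.finite_residual_normal])
  \<comment> \<open>Deficiency one says that the costs of the relators add up to the critical value
    \<open>card S - 1\<close>. Lowering the cost of the single relator \<open>s0\<close> to
    \<open>b0\<close> opens the gap that linear growth requires.\<close>
  have sum_remove: "(\<Sum>s\<in>R. if s = s0 then b0 else 1 / real p ^ pe s) = real (card S) - 1 - 1 / real p ^ pe s0 + b0"
    if "s0 \<in> R" for s0 and b0 :: real
    using deficiency sum.remove[OF finR that, of "\<lambda>s. 1 / real p ^ pe s"]
      sum.remove[OF finR that, of "\<lambda>s. if s = s0 then b0 else 1 / real p ^ pe s"] by simp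
  \<comment> \<open>The power \<open>l i\<close> of the image of the root lies, with all its
    conjugates, in every finite index subgroup, so on the cosets of any \<open>L\<close> its orbits
    are shorter than \<open>p ^ a i\<close>. The relator costs nothing, and the gap is
    \<open>1 / p ^ a i\<close>.\<close>
  have case1: "p_large p G \<and> rank_gradient G > 0" if i: "i \<in> {1..d}" and less: "l i < p ^ a i" for i
  proof -
    define v where "v s = (if s = r i then w i else wr s)" for s
    have iR: "r i \<in> R" using i assms(6) by blast
    have pei: "pe (r i) = a i" using assms(11)[OF i] by (simp add: pe_def)
    have v: "v s \<in> carrier F \<and> s = v s [^]\<^bsub>F\<^esub> (p ^ pe s)" if "s \<in> R" for s
      using that wr' w[OF i] pei by (auto simp: v_def)
    interpret presented_group G F S R \<pi> "\<lambda>s. concat (replicate (p ^ pe s) (word (v s)))"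
      by (rule presented) (use v in auto)
    have vpow: "\<pi> (v s) [^]\<^bsub>G\<^esub> (p ^ pe s) = \<one>\<^bsub>G\<^esub>" if "s \<in> R" for s
      using \<pi>.hom_nat_pow[of "v s" "p ^ pe s"] v[OF that] \<pi>_relator[OF that] by simp
    \<comment> \<open>\<open>l i\<close> divides \<open>p ^ a i\<close>, which excludes the value
      \<open>0\<close> that \<open>ord\<close> has for infinite order; the return to a coset needs a
      positive exponent.\<close>
    have lpos: "l i > 0"
    proof -
      have "l i dvd p ^ a i" using ord_w[OF i, of "p ^ a i"] vpow[OF iR] w[OF i] subgroup.one_closed[OF RG] pei
        by (simp add: v_def)
      then show ?thesis using p1 by (metis dvd_pos_nat less_imp_le not_gr_zero power_eq_0_iff not_one_le_zero le_eq_less_or_eq)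
    qed
    define c where "c = p ^ a i"
    have c: "c > 0" using p1 by (simp add: c_def)
    have "linear_growth p (carrier G) c" unfolding linear_growth_def
    proof (intro conjI c allI impI)
      fix L assume L: "subgroup L G" and fin: "finite (rcosets\<^bsub>G\<^esub> L)"
      let ?q = "card (rcosets\<^bsub>G\<^esub> L)"
      have rank: "\<exists>n. relator_rank_le p L s n \<and> real n \<le> real ?q * (if s = r i then 0 else 1 / real p ^ pe s)"
        if s: "s \<in> R" for s
      proof -
        note rank = relator_rank_le_prime_power[OF L fin word(1)[OF conjunct1[OF v[OF s]]]
            arg_cong[OF word(2)[OF conjunct1[OF v[OF s]], symmetric], of \<pi>] vpow[OF s] _ assms(1) refl refl]
        show ?thesis
        proof (cases "s = r i")
          case True
          have "\<exists>t. 0 < t \<and> t < p ^ pe s \<and> L #>\<^bsub>G\<^esub> (g \<otimes>\<^bsub>G\<^esub> \<pi> (v s) [^]\<^bsub>G\<^esub> t) = L #>\<^bsub>G\<^esub> g"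
            if g: "g \<in> carrier G" for g
          proof (intro exI conjI)
            show "0 < l i" by (rule lpos)
            show "l i < p ^ pe s" using less pei True by simp
            have vs: "\<pi> (v s) \<in> carrier G" using v[OF s] by simp
            have "\<pi> (v s) [^]\<^bsub>G\<^esub> l i \<in> ?RG" using ord_w[OF i, of "l i"] w[OF i] True by (simp add: v_def)
            then have "g \<otimes>\<^bsub>G\<^esub> \<pi> (v s) [^]\<^bsub>G\<^esub> l i \<otimes>\<^bsub>G\<^esub> inv\<^bsub>G\<^esub> g \<in> ?RG"
              using normal.inv_op_closed2[OF G.finite_residual_normal g] by blast
            then show "L #>\<^bsub>G\<^esub> (g \<otimes>\<^bsub>G\<^esub> \<pi> (v s) [^]\<^bsub>G\<^esub> l i) = L #>\<^bsub>G\<^esub> g"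
              using G.finite_residual_subset[OF L fin] g vs by (subst G.coset_eq_iff[OF L]) auto
          qed
          then have "relator_rank_le p L s 0" using rank(2) p1 by simp
          then show ?thesis using True by (intro exI[of _ 0]) simp
        next
          case False
          obtain n where n: "relator_rank_le p L s n" "n * p ^ pe s \<le> ?q" using rank(1) p1 by auto
          have "real n * real p ^ pe s \<le> real ?q" using n(2) by (metis of_nat_le_iff of_nat_mult of_nat_power)
          then have "real n \<le> real ?q * (1 / real p ^ pe s)" using p1 by (simp add: pos_le_divide_eq)
          then show ?thesis using n(1) False by auto
        qed
      qed
      then have "\<forall>s. \<exists>n. s \<in> R \<longrightarrow> relator_rank_le p L s n \<and> real n \<le> real ?q * (if s = r i then 0 else 1 / real p ^ pe s)"
        by blast
      from choice[OF this] obtain n where n: "\<forall>s. s \<in> R \<longrightarrow> relator_rank_le p L s (n s) \<and>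
        real (n s) \<le> real ?q * (if s = r i then 0 else 1 / real p ^ pe s)" by (rule exE)
      show "\<exists>u. p ^ (u + 1) \<le> card (characters p G L) \<and> ?q \<le> c * u"
      proof (rule characters_growth[OF L fin assms(1) _ _ _ c])
        show "relator_rank_le p L s (n s)" if "s \<in> R" for s using n that by blast
        show "real (n s) \<le> real ?q * (if s = r i then 0 else 1 / real p ^ pe s)" if "s \<in> R" for s using n that by blast
        show "(\<Sum>s\<in>R. if s = r i then 0 else 1 / real p ^ pe s) \<le> real (card S) - 1 - 1 / real c"
          using sum_remove[OF iR, of 0] pei by (simp add: c_def)
      qed
    qed
    moreover have "finite (rcosets\<^bsub>G\<^esub> (carrier G))"
      using G.finite_rcosets_if_fibres[OF G.subgroup_self, of UNIV "\<lambda>_. ()"] by auto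
    ultimately have "p_large p (G\<lparr>carrier := carrier G\<rparr>)" "rank_gradient G > 0"
      using free_quotient_of_linear_growth(1)[OF assms(1) G.subgroup_self _ _ xy]
        rank_gradient_of_linear_growth[OF assms(1) G.subgroup_self] by blast+
    then show ?thesis by simp
  qed
  \<comment> \<open>The distinguished relator is spelled with its minimal root. Below a normal
    subgroup \<open>K\<close> avoiding the positive powers of the image of \<open>u i\<close> before
    \<open>k i\<close>, all orbits have length at least \<open>k i\<close>, so the relator costs at
    most \<open>1 / k i\<close> per coset instead of \<open>1 / p ^ a i\<close>.\<close>
  have case2: "(\<exists>H. finite_index_subgroup H G \<and> p_large p (G\<lparr>carrier := H\<rparr>)) \<and> large G \<and> rank_gradient G > 0"
    if i: "i \<in> {1..d}" and l: "l i = p ^ a i" and less: "l i < k i" for i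
  proof -
    define v where "v s = (if s = r i then u i else wr s)" for s
    define P where "P s = (if s = r i then m i else p ^ pe s)" for s
    have iR: "r i \<in> R" using i assms(6) by blast
    have pei: "pe (r i) = a i" using assms(11)[OF i] by (simp add: pe_def)
    have v: "v s \<in> carrier F \<and> s = v s [^]\<^bsub>F\<^esub> P s" if "s \<in> R" for s
      using that wr' u[OF i] by (auto simp: v_def P_def)
    interpret presented_group G F S R \<pi> "\<lambda>s. concat (replicate (P s) (word (v s)))"
      by (rule presented) (use v in auto)
    have vpow: "\<pi> (v s) [^]\<^bsub>G\<^esub> P s = \<one>\<^bsub>G\<^esub>" if "s \<in> R" for s
      using \<pi>.hom_nat_pow[of "v s" "P s"] v[OF that] \<pi>_relator[OF that] by simp
    have ui: "\<pi> (u i) \<in> carrier G" using u[OF i] by simp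
    have "\<pi> (u i) [^]\<^bsub>G\<^esub> t \<notin> ?RG" if "0 < t" "t < k i" for t :: nat
      using ord_u[OF i ui, of t] that by (auto dest: dvd_imp_le)
    then obtain K where K: "K \<lhd> G" "finite (rcosets\<^bsub>G\<^esub> K)"
      "\<And>t. 0 < t \<Longrightarrow> t < k i \<Longrightarrow> \<pi> (u i) [^]\<^bsub>G\<^esub> (t::nat) \<notin> K"
      using G.finite_index_normal_avoiding_powers[OF ui, of "k i"] by blast
    have KG: "subgroup K G" using K(1) by (rule normal_imp_subgroup)
    \<comment> \<open>The gap is the difference of the reciprocals of \<open>p ^ a i\<close> and
      \<open>k i\<close>; as \<open>k i\<close> exceeds \<open>p ^ a i\<close> by at least one, it
      is at least the reciprocal of their product.\<close>
    define c where "c = p ^ a i * k i"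
    have ki: "k i > 0" using less by simp
    have c: "c > 0" using p1 ki by (simp add: c_def)
    have "linear_growth p K c" unfolding linear_growth_def
    proof (intro conjI c allI impI)
      fix L assume L: "subgroup L G" and LK: "L \<subseteq> K" and fin: "finite (rcosets\<^bsub>G\<^esub> L)"
      let ?q = "card (rcosets\<^bsub>G\<^esub> L)"
      have rank: "\<exists>n. relator_rank_le p L s n \<and> real n \<le> real ?q * (if s = r i then 1 / real (k i) else 1 / real p ^ pe s)"
        if s: "s \<in> R" for s
      proof (cases "s = r i")
        case True
        have full: "L #>\<^bsub>G\<^esub> (g \<otimes>\<^bsub>G\<^esub> \<pi> (v s) [^]\<^bsub>G\<^esub> t) \<noteq> L #>\<^bsub>G\<^esub> g"
          if g: "g \<in> carrier G" and t: "0 < t" "t < k i" for g and t :: nat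
        proof
          assume eq: "L #>\<^bsub>G\<^esub> (g \<otimes>\<^bsub>G\<^esub> \<pi> (v s) [^]\<^bsub>G\<^esub> t) = L #>\<^bsub>G\<^esub> g"
          have vs: "\<pi> (v s) = \<pi> (u i)" using True by (simp add: v_def)
          let ?z = "\<pi> (u i) [^]\<^bsub>G\<^esub> t"
          have z: "?z \<in> carrier G" using ui by simp
          have "g \<otimes>\<^bsub>G\<^esub> ?z \<otimes>\<^bsub>G\<^esub> inv\<^bsub>G\<^esub> g \<in> K" using eq vs G.coset_eq_iff[OF L _ g, of "g \<otimes>\<^bsub>G\<^esub> ?z"] g z LK by auto
          then have "inv\<^bsub>G\<^esub> g \<otimes>\<^bsub>G\<^esub> (g \<otimes>\<^bsub>G\<^esub> ?z \<otimes>\<^bsub>G\<^esub> inv\<^bsub>G\<^esub> g) \<otimes>\<^bsub>G\<^esub> g \<in> K"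
            using normal.inv_op_closed1[OF K(1) g] by blast
          moreover have "inv\<^bsub>G\<^esub> g \<otimes>\<^bsub>G\<^esub> (g \<otimes>\<^bsub>G\<^esub> ?z \<otimes>\<^bsub>G\<^esub> inv\<^bsub>G\<^esub> g) \<otimes>\<^bsub>G\<^esub> g = ?z"
          proof -
            have "g \<otimes>\<^bsub>G\<^esub> ?z \<otimes>\<^bsub>G\<^esub> inv\<^bsub>G\<^esub> g \<otimes>\<^bsub>G\<^esub> g = g \<otimes>\<^bsub>G\<^esub> ?z" using g z by (simp add: G.m_assoc)
            then have "inv\<^bsub>G\<^esub> g \<otimes>\<^bsub>G\<^esub> (g \<otimes>\<^bsub>G\<^esub> ?z \<otimes>\<^bsub>G\<^esub> inv\<^bsub>G\<^esub> g) \<otimes>\<^bsub>G\<^esub> g = inv\<^bsub>G\<^esub> g \<otimes>\<^bsub>G\<^esub> (g \<otimes>\<^bsub>G\<^esub> ?z)"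
              using g z G.m_assoc[of "inv\<^bsub>G\<^esub> g" "g \<otimes>\<^bsub>G\<^esub> ?z \<otimes>\<^bsub>G\<^esub> inv\<^bsub>G\<^esub> g" g] by simp
            then show ?thesis using g z by (simp add: G.m_assoc[symmetric])
          qed
          ultimately show False using K(3)[OF t] by simp
        qed
        obtain n where n: "relator_rank_le p L s n" "n * k i \<le> ?q"
          using relator_rank_le_power[OF L fin word(1)[OF conjunct1[OF v[OF s]]]
            arg_cong[OF word(2)[OF conjunct1[OF v[OF s]], symmetric], of \<pi>] vpow[OF s] _ ki full refl, where p = p] p1 by auto
        have "real n * real (k i) \<le> real ?q" using n(2) by (metis of_nat_le_iff of_nat_mult)
        then have "real n \<le> real ?q * (1 / real (k i))" using ki by (simp add: pos_le_divide_eq)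
        then show ?thesis using n(1) True by auto
      next
        case False
        then have Ps: "P s = p ^ pe s" by (simp add: P_def)
        obtain n where n: "relator_rank_le p L s n" "n * p ^ pe s \<le> ?q"
          using relator_rank_le_prime_power(1)[OF L fin word(1)[OF conjunct1[OF v[OF s]]]
            arg_cong[OF word(2)[OF conjunct1[OF v[OF s]], symmetric], of \<pi>] vpow[OF s] _ assms(1) Ps refl] p1 by auto
        have "real n * real p ^ pe s \<le> real ?q" using n(2) by (metis of_nat_le_iff of_nat_mult of_nat_power)
        then have "real n \<le> real ?q * (1 / real p ^ pe s)" using p1 by (simp add: pos_le_divide_eq)
        then show ?thesis using n(1) False by auto
      qed
      then have "\<forall>s. \<exists>n. s \<in> R \<longrightarrow> relator_rank_le p L s n \<and> real n \<le> real ?q * (if s = r i then 1 / real (k i) else 1 / real p ^ pe s)"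
        by blast
      from choice[OF this] obtain n where n: "\<forall>s. s \<in> R \<longrightarrow> relator_rank_le p L s (n s) \<and>
        real (n s) \<le> real ?q * (if s = r i then 1 / real (k i) else 1 / real p ^ pe s)" by (rule exE)
      show "\<exists>u. p ^ (u + 1) \<le> card (characters p G L) \<and> ?q \<le> c * u"
      proof (rule characters_growth[OF L fin assms(1) _ _ _ c])
        show "relator_rank_le p L s (n s)" if "s \<in> R" for s using n that by blast
        show "real (n s) \<le> real ?q * (if s = r i then 1 / real (k i) else 1 / real p ^ pe s)" if "s \<in> R" for s using n that by blast
        have "real p ^ a i + 1 \<le> real (k i)" using less l by (metis Suc_eq_plus1 Suc_leI of_nat_1 of_nat_add of_nat_le_iff of_nat_power)
        then have "1 / real c \<le> 1 / real p ^ a i - 1 / real (k i)"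
          using p1 ki by (simp add: c_def field_simps)
        then show "(\<Sum>s\<in>R. if s = r i then 1 / real (k i) else 1 / real p ^ pe s) \<le> real (card S) - 1 - 1 / real c"
          using sum_remove[OF iR, of "1 / real (k i)"] pei by simp
      qed
    qed
    from free_quotient_of_linear_growth[OF assms(1) KG K(2) this xy]
      rank_gradient_of_linear_growth[OF assms(1) KG K(2) this]
    show ?thesis using KG K(2) unfolding finite_index_subgroup_def by blast
  qed
  show ?thesis using case1 case2 by blast
qed

end
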